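(* Let $u_0\in L^1(\mathbb R^N)\cap L^\infty(\mathbb R^N)$, $u_0\ge0$, $p\ge1+2/N$, and let $u$ be the solution of $$u_t(x,t)=\int_{\mathbb R^N} J(x-y)\big(u(y,t)-u(x,t)\big)\,dy-u^p(x,t)\ \text{ in }\mathbb R^N\times(0,\infty),\qquad u(x,0)=u_0(x).$$ (i) If $p>1+2/N$ then, for every $R>0$, $$t^{N/2}|u(x,t)-U(x,t)|\to0\quad\text{as }t\to\infty,\ \text{uniformly in }|x|\le R\sqrt t,$$ where $U$ is the solution of $U_t-\mathfrak a\Delta U=0$ in $\mathbb R^N\times(0,\infty)$ with $U(x,0)=M\delta$, $\delta$ is Dirac's delta at the origin, and $$M=\int_{\mathbb R^N} u_0(x)\,dx-\int_0^\infty\!\int_{\mathbb R^N} u^p(x,t)\,dx\,dt .$$ (ii) If $p=1+2/N$ then, for every $R>0$, $$t^{N/2}u(x,t)\to0\quad\text{as }t\to\infty,\ \text{uniformly in }|x|\le R\sqrt t.$$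
   Context: Standing assumptions: $J\in C_0^\infty(\mathbb R^N)$ is radially symmetric, $J\ge 0$, $\int J=1$, and $\mathfrak a=\frac1{2N}\int_{\mathbb R^N}J(x)|x|^2\,dx$. The solution $u$ of the nonlocal Cauchy problem is the nonnegative bounded one. *)

theory Defs
  imports "HOL-Analysis.Analysis"
begin

text \<open>Functions of class \<open>C\<^sup>k\<close> on the whole space: all partial derivatives, along the
  coordinate directions, exist and are continuous up to order \<open>k\<close>.\<close>

primrec C_class :: "nat \<Rightarrow> ('a::euclidean_space \<Rightarrow> real) \<Rightarrow> bool" where
  "C_class 0 f \<longleftrightarrow> continuous_on UNIV f"
| "C_class (Suc k) f \<longleftrightarrow> f differentiable_on UNIV \<and>
     (\<forall>i\<in>Basis. C_class k (\<lambda>x. frechet_derivative f (at x) i))"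

definition compact_support :: "('a::euclidean_space \<Rightarrow> real) \<Rightarrow> bool" where
  "compact_support f \<longleftrightarrow> compact (closure (support_on UNIV f))"

definition smooth_compact_support :: "('a::euclidean_space \<Rightarrow> real) \<Rightarrow> bool" where
  "smooth_compact_support f \<longleftrightarrow> (\<forall>k. C_class k f) \<and> compact_support f"

definition radially_symmetric :: "('a::euclidean_space \<Rightarrow> real) \<Rightarrow> bool" where
  "radially_symmetric f \<longleftrightarrow> (\<forall>x y. norm x = norm y \<longrightarrow> f x = f y)"

text \<open>The sum of the pure second partial derivatives.\<close>

definition laplacian :: "('a::euclidean_space \<Rightarrow> real) \<Rightarrow> 'a \<Rightarrow> real" where
  "laplacian f x = (\<Sum>i\<in>Basis. (deriv ^^ 2) (\<lambda>s. f (x + s *\<^sub>R i)) 0)"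

definition diffusivity :: "('a::euclidean_space \<Rightarrow> real) \<Rightarrow> real" where
  "diffusivity J = 1 / (2 * real DIM('a)) * (LINT x|lebesgue. J x * (norm x)\<^sup>2)"

text \<open>\<open>u\<close> is a nonnegative bounded solution of
  \<open>u\<^sub>t = \<integral> J (x - y) (u(y,t) - u(x,t)) dy - u\<^sup>p\<close>, \<open>u(\<cdot>,0) = u\<^sub>0\<close>.
  Since \<open>u\<^sub>0\<close> is only an \<open>L\<^sup>\<infinity>\<close> function and the equation does not regularise,
  everything is required off a set \<open>Z\<close>, meant to be null and independent of \<open>t\<close>;
  \<open>Z = {}\<close> is the case of a solution defined at every point.\<close>

definition nonlocal_solution ::
  "('a::euclidean_space \<Rightarrow> real) \<Rightarrow> real \<Rightarrow> ('a \<Rightarrow> real) \<Rightarrow> 'a set \<Rightarrow> ('a \<Rightarrow> real \<Rightarrow> real) \<Rightarrow> bool" where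
  "nonlocal_solution J p u0 Z u \<longleftrightarrow>
     (\<forall>x. x \<notin> Z \<longrightarrow> (\<forall>t\<ge>0. 0 \<le> u x t)) \<and>
     (\<exists>B. \<forall>x. x \<notin> Z \<longrightarrow> (\<forall>t\<ge>0. u x t \<le> B)) \<and>
     (\<forall>t\<ge>0. (\<lambda>x. u x t) \<in> borel_measurable lebesgue) \<and>
     (\<forall>x. x \<notin> Z \<longrightarrow> u x 0 = u0 x \<and> continuous_on {0..} (u x)) \<and>
     (\<forall>x. x \<notin> Z \<longrightarrow> (\<forall>t>0. (u x has_real_derivative
        (LINT y|lebesgue. J (x - y) * (u y t - u x t)) - u x t powr p) (at t)))"

text \<open>\<open>U\<close> is the solution of \<open>U\<^sub>t - a \<Delta>U = 0\<close> for \<open>t > 0\<close> with \<open>U(\<cdot>,0) = M \<delta>\<close>.  The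
  equation holds classically, and the initial datum is attained in the sense of measures.
  The bound on the \<open>L\<^sup>1\<close> norms fixes a uniqueness class, which contains
  \<open>M\<close> times the heat kernel; without a growth condition uniqueness fails.\<close>

definition heat_solution_delta ::
  "real \<Rightarrow> real \<Rightarrow> ('a::euclidean_space \<Rightarrow> real \<Rightarrow> real) \<Rightarrow> bool" where
  "heat_solution_delta a M U \<longleftrightarrow>
     continuous_on (UNIV \<times> {0<..}) (\<lambda>(x, t). U x t) \<and>
     continuous_on (UNIV \<times> {0<..}) (\<lambda>(x, t). deriv (U x) t) \<and>
     (\<forall>t>0. C_class 2 (\<lambda>x. U x t)) \<and>
     (\<forall>x. \<forall>t>0. (U x has_real_derivative a * laplacian (\<lambda>y. U y t) x) (at t)) \<and>
     (\<exists>C. \<forall>t>0. integrable lebesgue (\<lambda>x. U x t) \<and> (LINT x|lebesgue. \<bar>U x t\<bar>) \<le> C) \<and>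
     (\<forall>\<phi>. continuous_on UNIV \<phi> \<and> compact_support \<phi> \<longrightarrow>
        ((\<lambda>t. LINT x|lebesgue. U x t * \<phi> x) \<longlongrightarrow> M * \<phi> 0) (at_right 0))"

end

theory Submission
  imports Defs "HOL-Probability.Characteristic_Functions" "HOL-Real_Asymp.Real_Asymp"
begin

text \<open>Let \<open>A\<close> be convolution with \<open>J\<close> and \<open>S t = exp (t (A - 1))\<close>.  On the Fourier side \<open>A\<close> is the
  symbol \<open>\<integral> J x cos (x \<bullet> \<xi>) dx = 1 - \<a> |\<xi>|\<^sup>2 + o(|\<xi>|\<^sup>2)\<close>, which stays away from \<open>1\<close> off the origin.  Hence, up
  to terms of size \<open>(1 + t) exp (- t)\<close>, \<open>S t\<close> maps \<open>L\<^sup>1\<close> to \<open>L\<^sup>\<infinity>\<close> with norm \<open>O(t powr (- N / 2))\<close>, and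
  \<open>t powr (N / 2) * (S t f - (\<integral> f) G t)\<close> tends to \<open>0\<close> uniformly, \<open>G\<close> being the heat kernel.

  By comparison \<open>u (t0 + t) \<le> S t (u t0)\<close>, so \<open>u\<close> decays like \<open>t powr (- N / 2)\<close>.  The difference of
  the two sides is nonnegative and has integral at most the mass absorbed after \<open>t0\<close>; smoothing by \<open>S\<close>
  over the window \<open>[(1 - \<delta>) t, t]\<close> makes it uniformly small.  Therefore \<open>u\<close> behaves like
  \<open>m G t\<close> with \<open>m\<close> the limit of the mass, for all \<open>p \<ge> 1 + 2 / N\<close>.  In the critical case \<open>m > 0\<close> would
  give \<open>\<integral> u\<^sup>p \<ge> c / t\<close>, contradicting that the absorbed mass is finite.\<close>

section \<open>Lebesgue integration and Gaussians\<close>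

text \<open>The equation does not regularise: the flow keeps the summand
  \<open>exp (- t) * f\<close>, so a function small in \<open>L^1\<close> becomes small pointwise
  only after a time in which that summand has died out. This is why a window of length
  \<open>\<delta> * t\<close> is needed. It is also why pointwise statements hold off a null set,
  where no maximum point can be selected; comparison therefore iterates an integral inequality. As
  \<open>J\<close> is even, all transforms are real, and cosines do the work of the Fourier
  transform. Plancherel for \<open>J\<close> makes the square of the symbol integrable, so the
  exponential series is split after its first-order term: the remainder is quadratic in the symbol.
  The profile \<open>U\<close> is any solution in the stated class, so the limit along the heat
  kernel has to be accompanied by a uniqueness proof, done by duality with the backward kernel. The
  constant \<open>M\<close> is tied to the dynamics by the balance
  \<open>mass' = - absorbed\<close>, which identifies it with the limit of the mass.\<close>

lemma sigma_finite_lebesgue: "sigma_finite_measure (lebesgue :: 'a::euclidean_space measure)"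
proof
  obtain A :: "'a set set" where A: "countable A" "A \<subseteq> sets lborel" "\<Union>A = space lborel"
    "\<forall>a\<in>A. emeasure lborel a \<noteq> \<infinity>"
    using sigma_finite_measure.sigma_finite_countable[OF sigma_finite_lborel] by blast
  show "\<exists>A. countable A \<and> A \<subseteq> sets (lebesgue :: 'a measure) \<and> \<Union>A = space lebesgue \<and>
      (\<forall>a\<in>A. emeasure lebesgue a \<noteq> \<infinity>)"
    using A by (intro exI[of _ A]) (auto simp: subset_eq sets_completionI_sets)
qed

interpretation lebesgue: sigma_finite_measure "lebesgue :: 'a::euclidean_space measure"
  by (rule sigma_finite_lebesgue)

interpretation lebesgue_pair: pair_sigma_finite
  "lebesgue :: 'a::euclidean_space measure" "lebesgue :: 'b::euclidean_space measure"
  by (intro pair_sigma_finite.intro sigma_finite_lebesgue)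

lemma lebesgue_affine_map_measurable [measurable]:
  fixes t :: "'a::euclidean_space"
  assumes "c \<noteq> 0"
  shows "(\<lambda>x. t + c *\<^sub>R x) \<in> lebesgue \<rightarrow>\<^sub>M lebesgue"
  using lebesgue_affine_measurable[of "\<lambda>_. c" t] assms
  unfolding scaleR_scaleR[symmetric] scaleR_sum_right[symmetric] euclidean_representation by simp

lemma lebesgue_affine_density:
  fixes t :: "'a::euclidean_space"
  assumes "c \<noteq> 0"
  shows "lebesgue = density (distr lebesgue lebesgue (\<lambda>x. t + c *\<^sub>R x)) (\<lambda>_. ennreal (\<bar>c\<bar> ^ DIM('a)))"
  using lebesgue_affine_euclidean[of "\<lambda>_. c" t] assms
  unfolding scaleR_scaleR[symmetric] scaleR_sum_right[symmetric] euclidean_representation by simp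

text \<open>The substitutions made with it are translation and reflection (\<open>c = 1\<close> and
  \<open>c = - 1\<close>) and the rescalings of Gaussians and of frequencies.\<close>

lemma has_bochner_integral_affine:
  fixes f :: "'a::euclidean_space \<Rightarrow> real"
  assumes c: "c \<noteq> 0" and f: "has_bochner_integral lebesgue f I"
  shows "has_bochner_integral lebesgue (\<lambda>x. f (t + c *\<^sub>R x)) (I / \<bar>c\<bar> ^ DIM('a))"
proof -
  have [measurable]: "f \<in> borel_measurable lebesgue" using f by auto
  have m: "(\<lambda>x. t + c *\<^sub>R x) \<in> lebesgue \<rightarrow>\<^sub>M lebesgue"
    using c by (rule lebesgue_affine_map_measurable)
  have "has_bochner_integral (density (distr lebesgue lebesgue (\<lambda>x. t + c *\<^sub>R x))
     (\<lambda>_. ennreal (\<bar>c\<bar> ^ DIM('a)))) f I"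
    using f lebesgue_affine_density[OF c, of t] by simp
  then have "has_bochner_integral lebesgue (\<lambda>x. \<bar>c\<bar> ^ DIM('a) * f (t + c *\<^sub>R x)) I"
    using m c by (simp add: has_bochner_integral_iff integrable_density integral_density
        integrable_distr_eq integral_distr)
  then have "has_bochner_integral lebesgue
      (\<lambda>x. (1 / \<bar>c\<bar> ^ DIM('a)) * (\<bar>c\<bar> ^ DIM('a) * f (t + c *\<^sub>R x))) ((1 / \<bar>c\<bar> ^ DIM('a)) * I)"
    by (rule has_bochner_integral_mult_right)
  then show ?thesis using c by simp
qed

lemma
  fixes f :: "'a::euclidean_space \<Rightarrow> real"
  assumes "integrable lebesgue f"
  shows integrable_lebesgue_translate: "integrable lebesgue (\<lambda>x. f (t + x))"
    and integral_lebesgue_translate: "(LINT x|lebesgue. f (t + x)) = (LINT x|lebesgue. f x)"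
    and integrable_lebesgue_reflect: "integrable lebesgue (\<lambda>x. f (t - x))"
    and integral_lebesgue_reflect: "(LINT x|lebesgue. f (t - x)) = (LINT x|lebesgue. f x)"
  using has_bochner_integral_affine[of 1 f "integral\<^sup>L lebesgue f" t]
    has_bochner_integral_affine[of "-1" f "integral\<^sup>L lebesgue f" t] assms
  by (auto simp: has_bochner_integral_iff)

text \<open>The mean value inequality bounds the difference quotients by \<open>w\<close>, and
  dominated convergence along sequences does the rest. The derivative is asked off one null set for
  all \<open>s\<close> at once, which is the form in which the evolution equation holds.\<close>

lemma has_real_derivative_integral:
  fixes f f' :: "real \<Rightarrow> 'b \<Rightarrow> real"
  assumes r: "0 < r"
    and int: "\<And>s. \<bar>s - t\<bar> < r \<Longrightarrow> integrable M (f s)"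
    and meas: "f' t \<in> borel_measurable M"
    and der: "AE x in M. \<forall>s. \<bar>s - t\<bar> < r \<longrightarrow>
        ((\<lambda>s. f s x) has_real_derivative f' s x) (at s) \<and> \<bar>f' s x\<bar> \<le> w x"
    and w: "integrable M w"
  shows "integrable M (f' t)"
    and "((\<lambda>s. integral\<^sup>L M (f s)) has_real_derivative integral\<^sup>L M (f' t)) (at t)"
proof -
  show "integrable M (f' t)"
  proof (rule Bochner_Integration.integrable_bound[OF w meas])
    show "AE x in M. norm (f' t x) \<le> norm (w x)"
      using der 
    proof eventually_elim
      case (elim x)
      then have "\<bar>f' t x\<bar> \<le> w x" using r by simp
      then show ?case by simp
    qed
  qed
  have *: "(\<lambda>n. (integral\<^sup>L M (f (t + X n)) - integral\<^sup>L M (f t)) / X n) \<longlonglongrightarrow> integral\<^sup>L M (f' t)"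
    if X: "\<And>n. X n \<noteq> 0" "\<And>n. \<bar>X n\<bar> < r" "X \<longlonglongrightarrow> 0" for X :: "nat \<Rightarrow> real"
  proof -
    have "(\<lambda>n. LINT x|M. (f (t + X n) x - f t x) / X n) \<longlonglongrightarrow> integral\<^sup>L M (f' t)"
    proof (rule integral_dominated_convergence[OF meas _ w])
      show "(\<lambda>x. (f (t + X n) x - f t x) / X n) \<in> borel_measurable M" for n
        using int[of "t + X n"] int[of t] X(2)[of n] r by auto
      show "AE x in M. (\<lambda>n. (f (t + X n) x - f t x) / X n) \<longlonglongrightarrow> f' t x"
        using der
      proof eventually_elim
        case (elim x)
        then have "((\<lambda>h. (f (t + h) x - f t x) / h) \<longlongrightarrow> f' t x) (at 0)"
          using r unfolding DERIV_def by auto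
        then show ?case using X by (auto simp: tendsto_at_iff_sequentially o_def)
      qed
      show "AE x in M. norm ((f (t + X n) x - f t x) / X n) \<le> w x" for n
        using der
      proof eventually_elim
        case (elim x)
        have zr: "\<bar>z - t\<bar> < r" if "z \<in> {t - r<..<t + r}" for z
          using that by (auto simp: abs_less_iff)
        have "norm (f (t + X n) x - f t x) \<le> w x * norm ((t + X n) - t)"
        proof (rule field_differentiable_bound[of "{t - r<..<t + r}"])
          show "((\<lambda>s. f s x) has_field_derivative f' z x) (at z within {t - r<..<t + r})"
            if "z \<in> {t - r<..<t + r}" for z
            by (rule has_field_derivative_at_within) (use elim zr[OF that] in blast)
          show "norm (f' z x) \<le> w x" if "z \<in> {t - r<..<t + r}" for z
            using elim zr[OF that] by simp
          show "t + X n \<in> {t - r<..<t + r}" "t \<in> {t - r<..<t + r}"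
            using X(2)[of n] r by (simp_all add: abs_less_iff)
        qed simp
        then have "\<bar>f (t + X n) x - f t x\<bar> \<le> w x * \<bar>X n\<bar>" by simp
        moreover have "0 < \<bar>X n\<bar>" using X(1)[of n] by simp
        ultimately show ?case
          by (simp only: real_norm_def abs_divide pos_divide_le_eq)
      qed
    qed
    moreover have "(LINT x|M. (f (t + X n) x - f t x) / X n) =
        (integral\<^sup>L M (f (t + X n)) - integral\<^sup>L M (f t)) / X n" for n
      using int[of "t + X n"] int[of t] X(2)[of n] r by simp
    ultimately show ?thesis by (simp only:)
  qed
  show "((\<lambda>s. integral\<^sup>L M (f s)) has_real_derivative integral\<^sup>L M (f' t)) (at t)"
    unfolding DERIV_def tendsto_at_iff_sequentially o_def
  proof (intro allI impI)
    fix X :: "nat \<Rightarrow> real" assume X: "\<forall>i. X i \<in> UNIV - {0}" "X \<longlonglongrightarrow> 0"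
    \<comment> \<open>The sequence lies within distance \<open>r\<close> of the point only from some
      index on, so a shifted sequence is used.\<close>
    obtain k where k: "\<And>n. n \<ge> k \<Longrightarrow> \<bar>X n\<bar> < r"
      using LIMSEQ_D[OF X(2) r] by auto
    have "(\<lambda>n. (integral\<^sup>L M (f (t + X (n + k))) - integral\<^sup>L M (f t)) / X (n + k)) \<longlonglongrightarrow> integral\<^sup>L M (f' t)"
      by (rule *) (use X k in \<open>auto intro: LIMSEQ_ignore_initial_segment\<close>)
    then show "(\<lambda>n. (integral\<^sup>L M (f (t + X n)) - integral\<^sup>L M (f t)) / X n) \<longlonglongrightarrow> integral\<^sup>L M (f' t)"
      by (rule LIMSEQ_offset)
  qed
qed

section \<open>Gaussians and their Fourier transform\<close>

text \<open>The centred normal density with covariance \<open>e\<close> times the identity. The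
  kernel of \<open>U_t = a \<Delta>U\<close> at time \<open>t\<close> is
  \<open>gauss (2 * a * t)\<close>.\<close>

definition gauss :: "real \<Rightarrow> 'a::euclidean_space \<Rightarrow> real" where
  "gauss e x = (2 * pi * e) powr (- (real DIM('a) / 2)) * exp (- (norm x)\<^sup>2 / (2 * e))"

text \<open>By its definition \<open>lborel\<close> is the image of a product of one-dimensional
  measures under the coordinate map, so Fubini for finite products applies.\<close>

lemma has_bochner_integral_lborel_prod:
  fixes f :: "'a::euclidean_space \<Rightarrow> real \<Rightarrow> complex"
  assumes f: "\<And>b. b \<in> Basis \<Longrightarrow> integrable lborel (f b)"
  shows "has_bochner_integral lborel (\<lambda>x. \<Prod>b\<in>Basis. f b (x \<bullet> b)) (\<Prod>b\<in>Basis. integral\<^sup>L lborel (f b))"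
proof -
  interpret product_sigma_finite "\<lambda>b::'a. interval_measure (\<lambda>x. x)"
    by (intro product_sigma_finite.intro sigma_finite_interval_measure) auto
  have [measurable]: "f b \<in> borel_measurable borel" if "b \<in> Basis" for b using f[OF that] by auto
  have f': "integrable (interval_measure (\<lambda>x. x)) (f b)" if "b \<in> Basis" for b
    using f[OF that] by (simp add: lborel_eq_real)
  have eq: "(\<Prod>b\<in>Basis. f b ((\<Sum>c\<in>Basis. y c *\<^sub>R c) \<bullet> b)) = (\<Prod>b\<in>Basis. f b (y b))" for y
    by (intro prod.cong) auto
  have m: "(\<lambda>f. \<Sum>b\<in>Basis. f b *\<^sub>R b) \<in> (\<Pi>\<^sub>M b\<in>Basis. interval_measure (\<lambda>x. x)) \<rightarrow>\<^sub>M (borel :: 'a measure)"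
    by measurable
  have fm: "(\<lambda>x. \<Prod>b\<in>Basis. f b (x \<bullet> b)) \<in> borel_measurable (borel :: 'a measure)"
    by measurable
  have "integrable (\<Pi>\<^sub>M b\<in>Basis. interval_measure (\<lambda>x. x)) (\<lambda>y. \<Prod>b\<in>Basis. f b (y b))"
    by (rule product_integrable_prod) (use f' in auto)
  moreover have "integral\<^sup>L (\<Pi>\<^sub>M b\<in>Basis. interval_measure (\<lambda>x. x)) (\<lambda>y. \<Prod>b\<in>Basis. f b (y b))
      = (\<Prod>b\<in>Basis. integral\<^sup>L lborel (f b))"
    by (subst product_integral_prod) (use f' in \<open>auto simp: lborel_eq_real\<close>)
  ultimately show ?thesis
    unfolding lborel_def has_bochner_integral_iff
    by (simp add: integrable_distr_eq[OF m fm] integral_distr[OF m fm] eq)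
qed

text \<open>This is the characteristic function of the standard normal distribution, freed from the
  factor \<open>1 / sqrt (2 * pi)\<close>.\<close>

lemma gauss_fourier_1:
  shows "integrable lborel (\<lambda>x::real. complex_of_real (exp (- x\<^sup>2 / 2)) * cis (z * x))"
    and "(LINT x|lborel. complex_of_real (exp (- x\<^sup>2 / 2)) * cis (z * x)) = complex_of_real (sqrt (2 * pi) * exp (- z\<^sup>2 / 2))"
proof -
  have eq: "sqrt (2 * pi) * std_normal_density x = exp (- x\<^sup>2 / 2)" for x
    by (simp add: std_normal_density_def)
  have "integrable lborel (\<lambda>x. sqrt (2 * pi) * std_normal_density x)"
    by (intro integrable_mult_right) simp
  then have "integrable lborel (\<lambda>x::real. exp (- x\<^sup>2 / 2))" by (simp only: eq)
  then show "integrable lborel (\<lambda>x::real. complex_of_real (exp (- x\<^sup>2 / 2)) * cis (z * x))"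
  proof (rule Bochner_Integration.integrable_bound)
    have "continuous_on UNIV (\<lambda>x::real. complex_of_real (exp (- x\<^sup>2 / 2)) * cis (z * x))"
      by (intro continuous_intros) simp_all
    then show "(\<lambda>x::real. complex_of_real (exp (- x\<^sup>2 / 2)) * cis (z * x)) \<in> borel_measurable lborel"
      using borel_measurable_continuous_onI by simp
  qed (simp add: norm_mult)
  have "char std_normal_distribution z = (LINT x|lborel. std_normal_density x * cis (z * x))"
    unfolding char_def by (subst integral_density) (auto simp: scaleR_conv_of_real cis_conv_exp mult_ac)
  then have "complex_of_real (sqrt (2 * pi)) * complex_of_real (exp (- z\<^sup>2 / 2)) =
     (LINT x|lborel. complex_of_real (sqrt (2 * pi)) * (std_normal_density x * cis (z * x)))"
    by (simp only: char_std_normal_distribution integral_mult_right_zero)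
  also have "\<dots> = (LINT x|lborel. complex_of_real (exp (- x\<^sup>2 / 2)) * cis (z * x))"
    by (simp only: mult.assoc[symmetric] of_real_mult[symmetric] eq)
  finally show "(LINT x|lborel. complex_of_real (exp (- x\<^sup>2 / 2)) * cis (z * x)) = complex_of_real (sqrt (2 * pi) * exp (- z\<^sup>2 / 2))"
    by simp
qed

lemma prod_cis: "finite A \<Longrightarrow> (\<Prod>b\<in>A. cis (f b)) = cis (\<Sum>b\<in>A. f b)"
  by (induction A rule: finite_induct) (auto simp: cis_mult)

text \<open>Both factors split over the coordinates: \<open>exp\<close> turns the sum of squares
  into a product, and \<open>cis\<close> does the same to the inner product. The real part leaves
  the cosine.\<close>

lemma gauss_fourier_unit:
  fixes z :: "'a::euclidean_space"
  shows "has_bochner_integral lebesgue (\<lambda>x. exp (- (norm x)\<^sup>2 / 2) * cos (z \<bullet> x))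
     ((2 * pi) powr (real DIM('a) / 2) * exp (- (norm z)\<^sup>2 / 2))"
proof -
  let ?f = "\<lambda>b x. complex_of_real (exp (- x\<^sup>2 / 2)) * cis ((z \<bullet> b) * x)"
  have n: "(norm y)\<^sup>2 = (\<Sum>b\<in>Basis. (y \<bullet> b)\<^sup>2)" for y :: 'a
    unfolding power2_norm_eq_inner by (subst euclidean_inner) (simp add: power2_eq_square)
  have e: "(\<Prod>b\<in>Basis. exp (- (y \<bullet> b)\<^sup>2 / 2)) = exp (- (norm y)\<^sup>2 / 2)" for y :: 'a
    unfolding n by (simp add: exp_sum[symmetric] sum_negf sum_divide_distrib)
  have c: "(\<Prod>b\<in>Basis. cis ((z \<bullet> b) * (x \<bullet> b))) = cis (z \<bullet> x)" for x
    by (subst prod_cis) (simp_all add: euclidean_inner[of z x])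
  have 1: "(\<Prod>b\<in>Basis. ?f b (x \<bullet> b)) = complex_of_real (exp (- (norm x)\<^sup>2 / 2)) * cis (z \<bullet> x)" for x
    by (simp only: prod.distrib c e of_real_prod[symmetric])
  have 2: "(\<Prod>b\<in>Basis. integral\<^sup>L lborel (?f b)) = complex_of_real (sqrt (2 * pi) ^ DIM('a) * exp (- (norm z)\<^sup>2 / 2))"
    by (simp only: gauss_fourier_1(2) of_real_prod[symmetric] prod.distrib prod_constant e)
  have 3: "sqrt (2 * pi) ^ DIM('a) = (2 * pi) powr (real DIM('a) / 2)"
    by (simp add: powr_half_sqrt[symmetric] powr_powr powr_realpow[symmetric] del: powr_half_sqrt)
  have "has_bochner_integral lborel (\<lambda>x. complex_of_real (exp (- (norm x)\<^sup>2 / 2)) * cis (z \<bullet> x))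
     (complex_of_real (sqrt (2 * pi) ^ DIM('a) * exp (- (norm z)\<^sup>2 / 2)))"
    using has_bochner_integral_lborel_prod[of ?f] gauss_fourier_1(1) unfolding 1 2 by blast
  then have "has_bochner_integral lborel (\<lambda>x. Re (complex_of_real (exp (- (norm x)\<^sup>2 / 2)) * cis (z \<bullet> x)))
     (Re (complex_of_real (sqrt (2 * pi) ^ DIM('a) * exp (- (norm z)\<^sup>2 / 2))))"
    by (rule has_bochner_integral_Re)
  then have "has_bochner_integral lborel (\<lambda>x. exp (- (norm x)\<^sup>2 / 2) * cos (z \<bullet> x))
     ((2 * pi) powr (real DIM('a) / 2) * exp (- (norm z)\<^sup>2 / 2))" by (simp add: 3)
  then show ?thesis
    by (simp add: has_bochner_integral_iff integrable_completion integral_completion)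
qed

lemma power_eq_powr_half: "0 < c \<Longrightarrow> c ^ n = c powr (real n / 2) * c powr (real n / 2)"
  by (simp add: powr_add[symmetric] powr_realpow)

lemma gauss_fourier:
  fixes z :: "'a::euclidean_space"
  assumes e: "0 < e"
  shows "has_bochner_integral lebesgue (\<lambda>x. exp (- (e * (norm x)\<^sup>2 / 2)) * cos (z \<bullet> x))
     ((2 * pi) ^ DIM('a) * gauss e z)"
proof -
  have "has_bochner_integral lebesgue
     (\<lambda>x. exp (- (norm (0 + sqrt e *\<^sub>R x))\<^sup>2 / 2) * cos (((1 / sqrt e) *\<^sub>R z) \<bullet> (0 + sqrt e *\<^sub>R x)))
     ((2 * pi) powr (real DIM('a) / 2) * exp (- (norm ((1 / sqrt e) *\<^sub>R z))\<^sup>2 / 2) / \<bar>sqrt e\<bar> ^ DIM('a))"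
    by (rule has_bochner_integral_affine[OF _ gauss_fourier_unit]) (use e in simp)
  moreover have "(2 * pi) powr (real DIM('a) / 2) * exp (- (norm ((1 / sqrt e) *\<^sub>R z))\<^sup>2 / 2) / \<bar>sqrt e\<bar> ^ DIM('a)
     = (2 * pi) ^ DIM('a) * gauss e z"
  proof -
    have "\<bar>sqrt e\<bar> ^ DIM('a) = e powr (real DIM('a) / 2)"
      using e by (simp add: powr_half_sqrt[symmetric] powr_powr powr_realpow[symmetric] del: powr_half_sqrt)
    moreover have "(2 * pi) ^ DIM('a) * (2 * pi * e) powr (- (real DIM('a) / 2)) = (2 * pi) powr (real DIM('a) / 2) / e powr (real DIM('a) / 2)"
      using e by (simp add: power_eq_powr_half powr_mult powr_minus divide_simps)
    moreover have "(norm ((1 / sqrt e) *\<^sub>R z))\<^sup>2 / 2 = (norm z)\<^sup>2 / (2 * e)"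
      using e by (simp add: power_divide)
    ultimately show ?thesis unfolding gauss_def minus_divide_left[symmetric] by (simp add: mult.assoc[symmetric])
  qed
  ultimately show ?thesis using e by (simp add: power_mult_distrib)
qed

text \<open>Up to a constant, the Gaussian is the integrand of \<open>gauss_fourier\<close> with
  parameter \<open>1 / e\<close> at frequency \<open>0\<close>.\<close>

lemma gauss_integral:
  assumes e: "0 < e"
  shows "has_bochner_integral lebesgue (gauss e :: 'a::euclidean_space \<Rightarrow> real) 1"
proof -
  have "has_bochner_integral lebesgue (\<lambda>x::'a. exp (- (norm x)\<^sup>2 / (2 * e))) ((2 * pi * e) powr (real DIM('a) / 2))"
  proof -
    have "(2 * pi) ^ DIM('a) * (2 * pi / e) powr - (real DIM('a) / 2) = (2 * pi * e) powr (real DIM('a) / 2)"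
      using e by (simp add: power_eq_powr_half powr_mult powr_divide powr_minus divide_simps)
    then show ?thesis
      using gauss_fourier[of "1 / e" "0 :: 'a"] e by (simp add: gauss_def divide_simps mult.commute[of e])
  qed
  then have "has_bochner_integral lebesgue (\<lambda>x::'a. (2 * pi * e) powr (- (real DIM('a) / 2)) * exp (- (norm x)\<^sup>2 / (2 * e)))
     ((2 * pi * e) powr (- (real DIM('a) / 2)) * (2 * pi * e) powr (real DIM('a) / 2))"
    by (rule has_bochner_integral_mult_right)
  then show ?thesis using e by (simp add: gauss_def[abs_def] powr_add[symmetric])
qed

lemma continuous_on_gauss [continuous_intros]: "continuous_on S (gauss e)"
  unfolding gauss_def[abs_def] divide_inverse by (intro continuous_intros)

lemma gauss_measurable [measurable]: "gauss e \<in> borel_measurable borel"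
  by (intro borel_measurable_continuous_onI continuous_on_gauss)

lemma gauss_nonneg [simp]: "0 \<le> gauss e x" by (simp add: gauss_def)

lemma gauss_minus [simp]: "gauss e (- x) = gauss e x" by (simp add: gauss_def)

lemma gauss_scale:
  fixes x :: "'a::euclidean_space"
  assumes "0 < c" "0 < e"
  shows "gauss (c\<^sup>2 * e) (c *\<^sub>R x) * c ^ DIM('a) = gauss e x"
  using assms
  by (simp add: gauss_def power_mult_distrib powr_mult powr_power powr_minus powr_powr powr_realpow[symmetric]
     field_simps flip: powr_numeral)

text \<open>The variance runs through \<open>(1 / (n + 1))\<^sup>2\<close>, so that the substitution \<open>y = x - z / (n + 1)\<close>
  turns every Gaussian into the standard one.\<close>

lemma gauss_approximate_identity:
  fixes f :: "'a::euclidean_space \<Rightarrow> real"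
  assumes f: "f \<in> borel_measurable lebesgue" and B: "\<And>x. \<bar>f x\<bar> \<le> B" and c: "isCont f x"
  shows "(\<lambda>n. LINT y|lebesgue. f y * gauss ((1 / (real n + 1))\<^sup>2) (x - y)) \<longlonglongrightarrow> f x"
proof -
  have gi: "integrable lebesgue (gauss e :: 'a \<Rightarrow> real)" "integral\<^sup>L lebesgue (gauss e :: 'a \<Rightarrow> real) = 1"
    if "0 < e" for e using gauss_integral[OF that, where 'a='a] by (auto simp: has_bochner_integral_iff)
  have eq: "(LINT y|lebesgue. f y * gauss ((1 / (real n + 1))\<^sup>2) (x - y)) =
     (LINT z|lebesgue. f (x - (1 / (real n + 1)) *\<^sub>R z) * gauss 1 z)" for n
  proof -
    let ?h = "1 / (real n + 1)"
    have "integrable lebesgue (\<lambda>y. f y * gauss (?h\<^sup>2) (x - y))"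
    proof (rule Bochner_Integration.integrable_bound)
      show "integrable lebesgue (\<lambda>y. B * gauss (?h\<^sup>2) (x - y))"
        by (intro integrable_mult_right integrable_lebesgue_reflect gi) simp
      show "(\<lambda>y. f y * gauss (?h\<^sup>2) (x - y)) \<in> borel_measurable lebesgue"
        by (intro borel_measurable_times[OF f] measurable_completion) measurable
    qed (use B in \<open>auto simp: abs_mult intro!: AE_I2 mult_right_mono order.trans[OF B]\<close>)
    then have "has_bochner_integral lebesgue (\<lambda>y. f y * gauss (?h\<^sup>2) (x - y))
       (LINT y|lebesgue. f y * gauss (?h\<^sup>2) (x - y))" by (simp add: has_bochner_integral_iff)
    from has_bochner_integral_affine[OF _ this, of "- ?h" x]
    have "has_bochner_integral lebesgue (\<lambda>z. f (x - ?h *\<^sub>R z) * gauss (?h\<^sup>2) (?h *\<^sub>R z))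
       ((LINT y|lebesgue. f y * gauss (?h\<^sup>2) (x - y)) / ?h ^ DIM('a))" by simp
    from has_bochner_integral_mult_right[OF this, of "?h ^ DIM('a)"]
    have "has_bochner_integral lebesgue (\<lambda>z. ?h ^ DIM('a) * (f (x - ?h *\<^sub>R z) * gauss (?h\<^sup>2) (?h *\<^sub>R z)))
       (LINT y|lebesgue. f y * gauss (?h\<^sup>2) (x - y))" by simp
    moreover have "?h ^ DIM('a) * (f (x - ?h *\<^sub>R z) * gauss (?h\<^sup>2) (?h *\<^sub>R z)) = f (x - ?h *\<^sub>R z) * gauss 1 z" for z
      using gauss_scale[of ?h 1 z] by (simp add: mult_ac)
    ultimately show ?thesis by (simp add: has_bochner_integral_iff)
  qed
  have "(\<lambda>n. LINT z|lebesgue. f (x - (1 / (real n + 1)) *\<^sub>R z) * gauss 1 z) \<longlonglongrightarrow> (LINT z|lebesgue. f x * gauss 1 (z::'a))"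
  proof (rule integral_dominated_convergence[where w="\<lambda>z. B * gauss 1 z"])
    show "integrable lebesgue (\<lambda>z::'a. B * gauss 1 z)" by (intro integrable_mult_right gi) simp
    show "(\<lambda>z. f x * gauss 1 z) \<in> borel_measurable (lebesgue :: 'a measure)"
      by (intro measurable_completion) measurable
    show "(\<lambda>z. f (x - (1 / (real n + 1)) *\<^sub>R z) * gauss 1 z) \<in> borel_measurable lebesgue" for n
    proof (intro borel_measurable_times)
      have "(\<lambda>z. f (x + (- (1 / (real n + 1))) *\<^sub>R z)) \<in> borel_measurable lebesgue"
        using f by (intro measurable_compose[OF lebesgue_affine_map_measurable f]) simp
      then show "(\<lambda>z. f (x - (1 / (real n + 1)) *\<^sub>R z)) \<in> borel_measurable lebesgue" by simp
    qed (intro measurable_completion, measurable)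
    show "AE z in lebesgue. (\<lambda>n. f (x - (1 / (real n + 1)) *\<^sub>R z) * gauss 1 z) \<longlonglongrightarrow> f x * gauss 1 z"
    proof (intro AE_I2 tendsto_mult tendsto_const isCont_tendsto_compose[OF c])
      fix z :: 'a
      have "(\<lambda>n. 1 / (real n + 1)) \<longlonglongrightarrow> 0"
        using LIMSEQ_inverse_real_of_nat by (simp add: inverse_eq_divide add.commute)
      then have "(\<lambda>n. x - (1 / (real n + 1)) *\<^sub>R z) \<longlonglongrightarrow> x - 0 *\<^sub>R z" by (intro tendsto_intros)
      then show "(\<lambda>n. x - (1 / (real n + 1)) *\<^sub>R z) \<longlonglongrightarrow> x" by simp
    qed
  qed (use B in \<open>auto simp: abs_mult intro!: AE_I2 mult_right_mono order.trans[OF B]\<close>)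
  then show ?thesis unfolding eq using gi[of 1] by simp
qed

section \<open>Measurability and integrability on products\<close>

lemma continuous_imp_lebesgue_measurable:
  fixes g :: "'a::euclidean_space \<Rightarrow> real"
  assumes "continuous_on UNIV g" shows "g \<in> borel_measurable lebesgue"
  using borel_measurable_continuous_onI[OF assms] by (simp add: measurable_completion)

lemma continuous_imp_pair_measurable:
  fixes g :: "'a::euclidean_space \<times> 'b::euclidean_space \<Rightarrow> real"
  assumes "continuous_on UNIV g" shows "g \<in> borel_measurable (lebesgue \<Otimes>\<^sub>M lebesgue)"
proof -
  have i: "(\<lambda>x::'c::euclidean_space. x) \<in> lebesgue \<rightarrow>\<^sub>M borel"
    by (simp add: measurable_completion)
  have "(\<lambda>p. (fst p, snd p)) \<in> (lebesgue :: 'a measure) \<Otimes>\<^sub>M (lebesgue :: 'b measure) \<rightarrow>\<^sub>M borel \<Otimes>\<^sub>M borel"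
    by (intro measurable_Pair measurable_compose[OF measurable_fst i] measurable_compose[OF measurable_snd i])
  then have "(\<lambda>p. p) \<in> (lebesgue :: 'a measure) \<Otimes>\<^sub>M (lebesgue :: 'b measure) \<rightarrow>\<^sub>M borel"
    by (simp add: borel_prod)
  from measurable_compose[OF this borel_measurable_continuous_onI[OF assms]] show ?thesis by simp
qed

lemma integrable_mult_bounded:
  fixes f g :: "'b \<Rightarrow> real"
  assumes "integrable M f" "g \<in> borel_measurable M" "\<And>x. \<bar>g x\<bar> \<le> K"
  shows "integrable M (\<lambda>x. f x * g x)"
proof (rule Bochner_Integration.integrable_bound)
  show "integrable M (\<lambda>x. K * f x)" using assms(1) by simp
  show "(\<lambda>x. f x * g x) \<in> borel_measurable M" using assms by measurable
  have "\<bar>f x * g x\<bar> \<le> \<bar>K * f x\<bar>" for x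
    using mult_left_mono[OF order.trans[OF assms(3)[of x] abs_ge_self], of "\<bar>f x\<bar>"] by (simp add: abs_mult mult.commute)
  then show "AE x in M. norm (f x * g x) \<le> norm (K * f x)" by simp
qed

text \<open>The shape of most Fubini exchanges: two integrable factors in separate variables,
  coupled by a bounded kernel such as a cosine.\<close>

lemma pair_integrable_mult:
  fixes f :: "'a::euclidean_space \<Rightarrow> real" and g :: "'b::euclidean_space \<Rightarrow> real"
  assumes f: "integrable lebesgue f" and g: "integrable lebesgue g"
    and c: "c \<in> borel_measurable (lebesgue \<Otimes>\<^sub>M lebesgue)" "\<And>p. \<bar>c p\<bar> \<le> K"
  shows "integrable (lebesgue \<Otimes>\<^sub>M lebesgue) (\<lambda>p. f (fst p) * g (snd p) * c p)"
proof (rule integrable_mult_bounded[OF _ c])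
  have [measurable]: "f \<in> borel_measurable lebesgue" "g \<in> borel_measurable lebesgue" using f g by auto
  show "integrable (lebesgue \<Otimes>\<^sub>M lebesgue) (\<lambda>p. f (fst p) * g (snd p))"
    by (rule lebesgue_pair.Fubini_integrable) (use f g in \<open>auto simp: abs_mult\<close>)
qed

section \<open>The cosine transform\<close>

text \<open>The base point \<open>x\<close> is built in: this is the real part of
  \<open>exp (i (x \<bullet> \<xi>))\<close> times the Fourier transform of \<open>f\<close> at
  \<open>\<xi>\<close>, that is, the integrand of the inversion formula at \<open>x\<close>. Real
  multipliers can be applied without splitting into sines and cosines.\<close>

definition cosine_transform :: "('a::euclidean_space \<Rightarrow> real) \<Rightarrow> 'a \<Rightarrow> 'a \<Rightarrow> real" where
  "cosine_transform f x \<xi> = (LINT y|lebesgue. f y * cos ((x - y) \<bullet> \<xi>))"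

lemma cos_inner_measurable:
  "(\<lambda>y. cos ((x - y) \<bullet> (\<xi>::'a::euclidean_space))) \<in> borel_measurable lebesgue"
  by (intro continuous_imp_lebesgue_measurable continuous_intros)

lemma integrable_mult_cos:
  fixes f :: "'a::euclidean_space \<Rightarrow> real"
  shows "integrable lebesgue f \<Longrightarrow> integrable lebesgue (\<lambda>y. f y * cos ((x - y) \<bullet> \<xi>))"
  by (rule integrable_mult_bounded[where K=1]) (auto intro: cos_inner_measurable)

lemma cosine_transform_bound:
  fixes f :: "'a::euclidean_space \<Rightarrow> real"
  assumes f: "integrable lebesgue f"
  shows "\<bar>cosine_transform f x \<xi>\<bar> \<le> (LINT y|lebesgue. \<bar>f y\<bar>)"
  unfolding cosine_transform_def
proof (rule order.trans[OF integral_abs_bound integral_mono])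
  show "\<bar>f y * cos ((x - y) \<bullet> \<xi>)\<bar> \<le> \<bar>f y\<bar>" for y
    by (simp add: abs_mult mult_left_le)
qed (use f integrable_mult_cos[OF f] in auto)

lemma continuous_on_cosine_transform:
  fixes f :: "'a::euclidean_space \<Rightarrow> real"
  assumes f: "integrable lebesgue f"
  shows "continuous_on UNIV (\<lambda>p. cosine_transform f (fst p) (snd p))"
  unfolding cosine_transform_def continuous_on_sequentially
proof (intro allI ballI impI, unfold comp_def, elim conjE)
  fix X :: "nat \<Rightarrow> 'a \<times> 'a" and p assume X: "X \<longlonglongrightarrow> p"
  show "(\<lambda>n. LINT y|lebesgue. f y * cos ((fst (X n) - y) \<bullet> snd (X n))) \<longlonglongrightarrow> (LINT y|lebesgue. f y * cos ((fst p - y) \<bullet> snd p))"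
  proof (rule integral_dominated_convergence[where w="\<lambda>y. \<bar>f y\<bar>"])
    show "AE y in lebesgue. (\<lambda>n. f y * cos ((fst (X n) - y) \<bullet> snd (X n))) \<longlonglongrightarrow> f y * cos ((fst p - y) \<bullet> snd p)"
      using X by (intro AE_I2 tendsto_intros)
    show "AE y in lebesgue. norm (f y * cos ((fst (X n) - y) \<bullet> snd (X n))) \<le> \<bar>f y\<bar>" for n
      by (simp add: abs_mult mult_left_le)
  qed (use f integrable_mult_cos[OF f] in \<open>auto intro: borel_measurable_integrable\<close>)
qed

lemma continuous_on_cosine_transform_snd:
  fixes f :: "'a::euclidean_space \<Rightarrow> real"
  assumes f: "integrable lebesgue f"
  shows "continuous_on UNIV (cosine_transform f x)"
proof -
  have "continuous_on UNIV (\<lambda>\<xi>::'a. (x, \<xi>))" by (intro continuous_intros)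
  from continuous_on_compose2[OF continuous_on_cosine_transform[OF f] this] show ?thesis by simp
qed

text \<open>The multiplication formula behind Fourier inversion: the Gaussian is written as the
  transform of a Gaussian and the integrals are exchanged.\<close>

lemma cosine_transform_gauss:
  fixes f :: "'a::euclidean_space \<Rightarrow> real"
  assumes f: "integrable lebesgue f" and e: "0 < e"
  shows "(2 * pi) ^ DIM('a) * (LINT y|lebesgue. f y * gauss e (x - y)) =
    (LINT \<xi>|lebesgue. exp (- (e * (norm \<xi>)\<^sup>2 / 2)) * cosine_transform f x \<xi>)"
proof -
  let ?g = "\<lambda>\<xi>::'a. exp (- (e * (norm \<xi>)\<^sup>2 / 2))"
  have g: "integrable lebesgue ?g"
    using gauss_fourier[OF e, of "0 :: 'a"] by (simp add: has_bochner_integral_iff)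
  have "integrable (lebesgue \<Otimes>\<^sub>M lebesgue) (\<lambda>p. f (fst p) * ?g (snd p) * cos ((x - fst p) \<bullet> snd p))"
    by (rule pair_integrable_mult[OF f g, where K=1])
      (auto intro!: continuous_imp_pair_measurable continuous_intros)
  then have i: "integrable (lebesgue \<Otimes>\<^sub>M lebesgue) (\<lambda>(y, \<xi>). f y * ?g \<xi> * cos ((x - y) \<bullet> \<xi>))"
    by (simp add: case_prod_unfold)
  have "(2 * pi) ^ DIM('a) * (LINT y|lebesgue. f y * gauss e (x - y)) =
      (LINT y|lebesgue. f y * ((2 * pi) ^ DIM('a) * gauss e (x - y)))"
    by (subst integral_mult_right_zero[symmetric]) (simp add: mult_ac)
  also have "\<dots> = (LINT y|lebesgue. f y * (LINT \<xi>|lebesgue. ?g \<xi> * cos ((x - y) \<bullet> \<xi>)))"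
    using gauss_fourier[OF e, where 'a='a, THEN has_bochner_integral_integral_eq] by simp
  also have "\<dots> = (LINT y|lebesgue. LINT \<xi>|lebesgue. f y * ?g \<xi> * cos ((x - y) \<bullet> \<xi>))"
    by (simp add: mult.assoc)
  also have "\<dots> = (LINT \<xi>|lebesgue. LINT y|lebesgue. f y * ?g \<xi> * cos ((x - y) \<bullet> \<xi>))"
    by (rule lebesgue_pair.Fubini_integral[OF i, symmetric])
  also have "\<dots> = (LINT \<xi>|lebesgue. ?g \<xi> * cosine_transform f x \<xi>)"
    unfolding cosine_transform_def
    by (subst integral_mult_right_zero[symmetric]) (simp add: mult_ac)
  finally show ?thesis .
qed

text \<open>The same Gaussian means have two limits: the value of \<open>f\<close> by the
  approximate identity at a point of continuity, and the undamped integral by dominated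
  convergence.\<close>

lemma cosine_transform_inversion:
  fixes f :: "'a::euclidean_space \<Rightarrow> real"
  assumes f: "integrable lebesgue f" and B: "\<And>x. \<bar>f x\<bar> \<le> B" and c: "isCont f x"
    and i: "integrable lebesgue (cosine_transform f x)"
  shows "(2 * pi) ^ DIM('a) * f x = (LINT \<xi>|lebesgue. cosine_transform f x \<xi>)"
proof (rule LIMSEQ_unique)
  let ?e = "\<lambda>n. (1 / (real n + 1))\<^sup>2"
  have fm: "f \<in> borel_measurable lebesgue" using f by auto
  show "(\<lambda>n. (2 * pi) ^ DIM('a) * (LINT y|lebesgue. f y * gauss (?e n) (x - y))) \<longlonglongrightarrow> (2 * pi) ^ DIM('a) * f x"
    by (intro tendsto_intros gauss_approximate_identity[OF fm B c])
  have "(\<lambda>n. LINT \<xi>|lebesgue. exp (- (?e n * (norm \<xi>)\<^sup>2 / 2)) * cosine_transform f x \<xi>) \<longlonglongrightarrow> (LINT \<xi>|lebesgue. cosine_transform f x \<xi>)"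
  proof (rule integral_dominated_convergence[where w="\<lambda>\<xi>. \<bar>cosine_transform f x \<xi>\<bar>"])
    show "AE \<xi> in lebesgue. (\<lambda>n. exp (- (?e n * (norm \<xi>)\<^sup>2 / 2)) * cosine_transform f x \<xi>) \<longlonglongrightarrow> cosine_transform f x \<xi>"
    proof (intro AE_I2)
      fix \<xi> :: 'a
      have "?e \<longlonglongrightarrow> 0" by real_asymp
      then have "(\<lambda>n. exp (- (?e n * (norm \<xi>)\<^sup>2 / 2)) * cosine_transform f x \<xi>) \<longlonglongrightarrow> exp (- (0 * (norm \<xi>)\<^sup>2 / 2)) * cosine_transform f x \<xi>"
        by (intro tendsto_intros) auto
      then show "(\<lambda>n. exp (- (?e n * (norm \<xi>)\<^sup>2 / 2)) * cosine_transform f x \<xi>) \<longlonglongrightarrow> cosine_transform f x \<xi>" by simp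
    qed
    show "(\<lambda>\<xi>. exp (- (?e n * (norm \<xi>)\<^sup>2 / 2)) * cosine_transform f x \<xi>) \<in> borel_measurable lebesgue" for n
      by (intro continuous_imp_lebesgue_measurable continuous_intros continuous_on_cosine_transform_snd f) auto
    show "AE \<xi> in lebesgue. norm (exp (- (?e n * (norm \<xi>)\<^sup>2 / 2)) * cosine_transform f x \<xi>) \<le> \<bar>cosine_transform f x \<xi>\<bar>" for n
      by (simp add: abs_mult mult_left_le_one_le)
  qed (use i in auto)
  then show "(\<lambda>n. (2 * pi) ^ DIM('a) * (LINT y|lebesgue. f y * gauss (?e n) (x - y))) \<longlonglongrightarrow> (LINT \<xi>|lebesgue. cosine_transform f x \<xi>)"
    by (subst cosine_transform_gauss[OF f]) auto
qed

lemma exp_minus_linear_bound: "\<bar>exp z - 1 - z\<bar> \<le> z\<^sup>2 / 2 * exp \<bar>z :: real\<bar>"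
proof -
  obtain t where t: "\<bar>t\<bar> \<le> \<bar>z\<bar>" "exp z = (\<Sum>m<2. z ^ m / fact m) + exp t / fact 2 * z ^ 2"
    using Maclaurin_exp_le[of z 2] by auto
  then have "exp z - 1 - z = z\<^sup>2 / 2 * exp t" by (simp add: numeral_2_eq_2)
  then have "\<bar>exp z - 1 - z\<bar> = z\<^sup>2 / 2 * exp t" by (simp only: abs_mult) simp
  also have "\<dots> \<le> z\<^sup>2 / 2 * exp \<bar>z\<bar>" using t by (intro mult_left_mono) auto
  finally show ?thesis .
qed

section \<open>The semigroup of the dispersal operator\<close>

text \<open>The semigroup is \<open>exp (t (A - 1))\<close> for the convolution operator \<open>A\<close> with kernel \<open>J\<close>.  Its
  terms of order \<open>0\<close> and \<open>1\<close> in \<open>A\<close> do not regularise and are split off; what remains has the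
  integrable symbol \<open>duhamel_symbol t (symbol \<xi>)\<close>.\<close>

definition duhamel_symbol :: "real \<Rightarrow> real \<Rightarrow> real" where
  "duhamel_symbol t y = exp (- t) * (exp (t * y) - 1 - t * y)"

lemma duhamel_symbol_0 [simp]: "duhamel_symbol 0 y = 0" by (simp add: duhamel_symbol_def)

text \<open>Removing the terms of order 0 and 1 leaves the source
  \<open>t * exp (- t) * y\<^sup>2\<close>. It is the multiplier of
  \<open>t * exp (- t) * conv (conv f)\<close>, by which the first-order term fails to solve the
  equation.\<close>

lemma has_real_derivative_duhamel_symbol:
  "((\<lambda>t. duhamel_symbol t y) has_real_derivative (y - 1) * duhamel_symbol t y + t * exp (- t) * y\<^sup>2) (at t)"
  unfolding duhamel_symbol_def
  by (auto intro!: derivative_eq_intros simp: algebra_simps power2_eq_square)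

lemma duhamel_symbol_bound:
  assumes "\<bar>y\<bar> \<le> 1"
  shows "\<bar>duhamel_symbol t y\<bar> \<le> exp (2 * \<bar>t\<bar>) * t\<^sup>2 * y\<^sup>2"
proof -
  have "\<bar>t * y\<bar> \<le> \<bar>t\<bar>" using assms by (simp add: abs_mult mult_left_le)
  then have "\<bar>exp (t * y) - 1 - t * y\<bar> \<le> (t * y)\<^sup>2 / 2 * exp \<bar>t\<bar>"
    by (intro order.trans[OF exp_minus_linear_bound] mult_left_mono) auto
  then have "exp (- t) * \<bar>exp (t * y) - 1 - t * y\<bar> \<le> exp \<bar>t\<bar> * ((t * y)\<^sup>2 / 2 * exp \<bar>t\<bar>)"
    by (intro mult_mono) auto
  also have "\<dots> = exp (2 * \<bar>t\<bar>) * t\<^sup>2 * y\<^sup>2 / 2"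
    by (simp add: power_mult_distrib exp_add[symmetric] mult_ac)
  also have "\<dots> \<le> exp (2 * \<bar>t\<bar>) * t\<^sup>2 * y\<^sup>2" by simp
  finally show ?thesis by (simp add: duhamel_symbol_def abs_mult)
qed

section \<open>The kernel and its convolution operator\<close>

text \<open>Radial symmetry enters as evenness and as an isotropic second moment. The factor
  \<open>2 * \<a>\<close> is chosen so that \<open>1 - symbol \<xi>\<close> behaves like
  \<open>\<a> * (norm \<xi>)\<^sup>2\<close>.\<close>

locale dispersal_kernel =
  fixes J :: "'a::euclidean_space \<Rightarrow> real" and \<a> :: real
  assumes continuous_J: "continuous_on UNIV J"
    and bounded_support_J: "\<exists>\<rho>. \<forall>x. J x \<noteq> 0 \<longrightarrow> norm x \<le> \<rho>"
    and J_nonneg [simp]: "0 \<le> J x"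
    and J_even: "J (- x) = J x"
    and integral_J: "(LINT x|lebesgue. J x) = 1"
    and second_moment: "(LINT x|lebesgue. J x * (x \<bullet> \<eta>)\<^sup>2) = 2 * \<a> * (norm \<eta>)\<^sup>2"
begin

text \<open>The integral of a nonintegrable function is \<open>0\<close> by convention, so the value
  \<open>1\<close> forces integrability.\<close>

lemma integrable_J: "integrable lebesgue J"
  using integral_J not_integrable_integral_eq by fastforce

lemma J_bounded: "\<exists>B>0. \<forall>x. J x \<le> B"
proof -
  obtain \<rho> where \<rho>: "\<And>x. J x \<noteq> 0 \<Longrightarrow> norm x \<le> \<rho>" using bounded_support_J by auto
  have "compact (J ` cball 0 \<rho>)"
    using continuous_J by (intro compact_continuous_image) (auto intro: continuous_on_subset)
  then obtain b where b: "\<And>y. y \<in> J ` cball 0 \<rho> \<Longrightarrow> \<bar>y\<bar> \<le> b"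
    using compact_imp_bounded bounded_iff by (metis real_norm_def)
  have "J x \<le> \<bar>b\<bar> + 1" for x
  proof (cases "J x = 0")
    case False
    then have "J x \<in> J ` cball 0 \<rho>" using \<rho> by auto
    then show ?thesis using b by fastforce
  qed simp
  then show ?thesis by (intro exI[of _ "\<bar>b\<bar> + 1"]) auto
qed

lemma J_shift_measurable: "(\<lambda>y. J (x - y)) \<in> borel_measurable lebesgue"
  by (intro continuous_imp_lebesgue_measurable continuous_on_compose2[OF continuous_J] continuous_intros) auto

lemma integrable_J_shift: "integrable lebesgue (\<lambda>y. J (x - y))"
  by (rule integrable_lebesgue_reflect[OF integrable_J])

lemma integral_J_shift: "(LINT y|lebesgue. J (x - y)) = 1"
  using integral_lebesgue_reflect[OF integrable_J, of x] integral_J by simp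

lemma J_pair_measurable: "(\<lambda>p. J (snd p - fst p)) \<in> borel_measurable (lebesgue \<Otimes>\<^sub>M lebesgue)"
  "(\<lambda>p. J (fst p - snd p)) \<in> borel_measurable (lebesgue \<Otimes>\<^sub>M lebesgue)"
  by (intro continuous_imp_pair_measurable continuous_on_compose2[OF continuous_J] continuous_intros, auto)+

definition conv :: "('a \<Rightarrow> real) \<Rightarrow> 'a \<Rightarrow> real" where
  "conv f x = (LINT y|lebesgue. J (x - y) * f y)"

lemma integrable_conv_bounded:
  assumes "f \<in> borel_measurable lebesgue" "\<And>y. \<bar>f y\<bar> \<le> B"
  shows "integrable lebesgue (\<lambda>y. J (x - y) * f y)"
  by (rule integrable_mult_bounded[OF integrable_J_shift assms])

lemma integrable_conv_integrable:
  assumes f: "integrable lebesgue f"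
  shows "integrable lebesgue (\<lambda>y. J (x - y) * f y)"
proof -
  obtain B where "0 < B" "\<And>x. J x \<le> B" using J_bounded by auto
  then have "integrable lebesgue (\<lambda>y. f y * J (x - y))"
    by (intro integrable_mult_bounded[OF f J_shift_measurable, where K=B]) simp
  then show ?thesis by (simp add: mult.commute)
qed

lemma conv_measurable:
  assumes [measurable]: "f \<in> borel_measurable lebesgue"
  shows "conv f \<in> borel_measurable lebesgue"
  unfolding conv_def[abs_def]
proof (rule lebesgue.borel_measurable_lebesgue_integral)
  have "(\<lambda>p. J (fst p - snd p) * f (snd p)) \<in> borel_measurable (lebesgue \<Otimes>\<^sub>M lebesgue)"
    using J_pair_measurable(2) by measurable
  then show "(\<lambda>(x, y). J (x - y) * f y) \<in> borel_measurable (lebesgue \<Otimes>\<^sub>M lebesgue)"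
    by (simp add: case_prod_unfold)
qed

lemma conv_const [simp]: "conv (\<lambda>y. c) x = c"
  by (simp add: conv_def integral_J_shift)

lemma conv_mono_AE:
  assumes "integrable lebesgue (\<lambda>y. J (x - y) * f y)" "integrable lebesgue (\<lambda>y. J (x - y) * g y)"
    and "AE y in lebesgue. f y \<le> g y"
  shows "conv f x \<le> conv g x"
  unfolding conv_def by (rule integral_mono_AE) (use assms in \<open>auto elim!: eventually_mono intro: mult_left_mono\<close>)

lemma conv_bound:
  assumes "f \<in> borel_measurable lebesgue" "\<And>y. \<bar>f y\<bar> \<le> B"
  shows "\<bar>conv f x\<bar> \<le> B"
proof -
  have i: "integrable lebesgue (\<lambda>y. J (x - y) * c)" for c using integrable_J_shift by simp
  have "f y \<le> B" "- B \<le> f y" for y using assms(2)[of y] by auto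
  then have "conv f x \<le> conv (\<lambda>y. B) x" "conv (\<lambda>y. - B) x \<le> conv f x"
    by (intro conv_mono_AE integrable_conv_bounded[OF assms] i AE_I2; simp)+
  then show ?thesis by auto
qed

lemma continuous_on_conv:
  assumes f: "integrable lebesgue f"
  shows "continuous_on UNIV (conv f)"
  unfolding conv_def[abs_def] continuous_on_sequentially
proof (intro allI ballI impI, unfold comp_def, elim conjE)
  obtain B where B: "0 < B" "\<And>x. J x \<le> B" using J_bounded by auto
  fix X :: "nat \<Rightarrow> 'a" and x assume X: "X \<longlonglongrightarrow> x"
  show "(\<lambda>n. LINT y|lebesgue. J (X n - y) * f y) \<longlonglongrightarrow> (LINT y|lebesgue. J (x - y) * f y)"
  proof (rule integral_dominated_convergence[where w="\<lambda>y. B * \<bar>f y\<bar>"])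
    show "AE y in lebesgue. (\<lambda>n. J (X n - y) * f y) \<longlonglongrightarrow> J (x - y) * f y"
      using X continuous_J
      by (intro AE_I2 tendsto_mult tendsto_const continuous_on_tendsto_compose[OF continuous_J] tendsto_diff) auto
    show "AE y in lebesgue. norm (J (X n - y) * f y) \<le> B * \<bar>f y\<bar>" for n
      using B by (simp add: abs_mult mult_right_mono)
  qed (use f integrable_conv_integrable[OF f] in \<open>auto intro: borel_measurable_integrable\<close>)
qed

lemma pair_integrable_conv:
  assumes f: "integrable lebesgue f"
    and c: "c \<in> borel_measurable (lebesgue \<Otimes>\<^sub>M lebesgue)" "\<And>p. \<bar>c p\<bar> \<le> K"
  shows "integrable (lebesgue \<Otimes>\<^sub>M lebesgue) (\<lambda>p. f (fst p) * J (snd p - fst p) * c p)"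
proof (rule integrable_mult_bounded[OF _ c])
  have [measurable]: "f \<in> borel_measurable lebesgue" using f by auto
  have J: "has_bochner_integral lebesgue (\<lambda>y. J (y - z)) 1" for z
    using integrable_lebesgue_translate[OF integrable_J, of "- z"] integral_lebesgue_translate[OF integrable_J, of "- z"]
    by (simp add: has_bochner_integral_iff integral_J)
  show "integrable (lebesgue \<Otimes>\<^sub>M lebesgue) (\<lambda>p. f (fst p) * J (snd p - fst p))"
  proof (rule lebesgue_pair.Fubini_integrable)
    show "(\<lambda>p. f (fst p) * J (snd p - fst p)) \<in> borel_measurable (lebesgue \<Otimes>\<^sub>M lebesgue)"
      using J_pair_measurable(1) by measurable
    show "integrable lebesgue (\<lambda>x. LINT y|lebesgue. norm (f (fst (x, y)) * J (snd (x, y) - fst (x, y))))"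
      using f J by (simp add: abs_mult has_bochner_integral_iff)
    show "AE x in lebesgue. integrable lebesgue (\<lambda>y. f (fst (x, y)) * J (snd (x, y) - fst (x, y)))"
      using J by (simp add: has_bochner_integral_iff)
  qed
qed

lemma
  assumes f: "integrable lebesgue f"
  shows integrable_conv: "integrable lebesgue (conv f)"
    and integral_conv: "(LINT x|lebesgue. conv f x) = (LINT x|lebesgue. f x)"
proof -
  have "integrable (lebesgue \<Otimes>\<^sub>M lebesgue) (\<lambda>p. f (fst p) * J (snd p - fst p) * 1)"
    by (rule pair_integrable_conv[OF f, where K=1]) auto
  then have i: "integrable (lebesgue \<Otimes>\<^sub>M lebesgue) (\<lambda>(z, y). f z * J (y - z))"
    by (simp add: case_prod_unfold)
  have c: "conv f = (\<lambda>y. LINT z|lebesgue. f z * J (y - z))" by (simp add: conv_def fun_eq_iff mult.commute)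
  show "integrable lebesgue (conv f)" unfolding c by (rule lebesgue_pair.integrable_snd[OF i])
  have J: "(LINT y|lebesgue. J (y - z)) = 1" for z
    using integral_lebesgue_translate[OF integrable_J, of "- z"] by (simp add: integral_J)
  show "(LINT x|lebesgue. conv f x) = (LINT x|lebesgue. f x)"
    unfolding c by (subst lebesgue_pair.Fubini_integral[OF i]) (simp add: J)
qed

section \<open>The symbol and Plancherel for the kernel\<close>

definition symbol :: "'a \<Rightarrow> real" where "symbol \<xi> = (LINT x|lebesgue. J x * cos (x \<bullet> \<xi>))"

lemma symbol_eq: "symbol = cosine_transform J 0"
  by (simp add: symbol_def cosine_transform_def fun_eq_iff)

lemma abs_symbol_le: "\<bar>symbol \<xi>\<bar> \<le> 1"
  using cosine_transform_bound[OF integrable_J, of 0 \<xi>] integral_J by (simp add: symbol_eq)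

lemma continuous_on_symbol: "continuous_on UNIV symbol"
  unfolding symbol_eq by (rule continuous_on_cosine_transform_snd[OF integrable_J])

lemma symbol_measurable: "symbol \<in> borel_measurable lebesgue"
  by (intro continuous_imp_lebesgue_measurable continuous_on_symbol)

lemma integrable_J_cos: "integrable lebesgue (\<lambda>y. J y * cos (y \<bullet> \<xi>))"
  using integrable_mult_cos[OF integrable_J, of 0 \<xi>] by simp

text \<open>The sine part of the addition theorem integrates to zero because \<open>J\<close> is even.\<close>

lemma conv_cos: "(LINT y|lebesgue. J (x - y) * cos ((y - z) \<bullet> \<xi>)) = symbol \<xi> * cos ((x - z) \<bullet> \<xi>)"
proof -
  have s: "integrable lebesgue (\<lambda>w. J w * sin (w \<bullet> \<xi>))"
    by (rule integrable_mult_bounded[OF integrable_J, where K=1])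
      (auto intro!: continuous_imp_lebesgue_measurable continuous_intros)
  have "(LINT w|lebesgue. J w * sin (w \<bullet> \<xi>)) = (LINT w|lebesgue. J (0 - w) * sin ((0 - w) \<bullet> \<xi>))"
    by (rule integral_lebesgue_reflect[OF s, symmetric])
  then have s0: "(LINT w|lebesgue. J w * sin (w \<bullet> \<xi>)) = 0" by (simp add: J_even)
  have i: "integrable lebesgue (\<lambda>w. J w * cos ((x - w - z) \<bullet> \<xi>))"
    using integrable_mult_cos[OF integrable_J, of "x - z" \<xi>] by (simp add: algebra_simps)
  have "(LINT y|lebesgue. J (x - y) * cos ((y - z) \<bullet> \<xi>)) = (LINT w|lebesgue. J w * cos ((x - w - z) \<bullet> \<xi>))"
    using integral_lebesgue_reflect[OF i, of x] by simp
  also have "\<dots> = (LINT w|lebesgue. cos ((x - z) \<bullet> \<xi>) * (J w * cos (w \<bullet> \<xi>)) + sin ((x - z) \<bullet> \<xi>) * (J w * sin (w \<bullet> \<xi>)))"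
  proof (rule Bochner_Integration.integral_cong[OF refl])
    fix w
    have "(x - w - z) \<bullet> \<xi> = (x - z) \<bullet> \<xi> - w \<bullet> \<xi>" by (simp add: inner_diff_left)
    then show "J w * cos ((x - w - z) \<bullet> \<xi>) = cos ((x - z) \<bullet> \<xi>) * (J w * cos (w \<bullet> \<xi>)) + sin ((x - z) \<bullet> \<xi>) * (J w * sin (w \<bullet> \<xi>))"
      by (simp only: cos_diff ring_distribs mult_ac)
  qed
  also have "\<dots> = cos ((x - z) \<bullet> \<xi>) * symbol \<xi>"
    using s integrable_J_cos[of \<xi>] by (simp add: s0 symbol_def)
  finally show ?thesis by (simp add: mult.commute)
qed

text \<open>As a function of the base point the transform is a superposition of cosines of frequency
  \<open>\<xi>\<close>, each an eigenfunction of \<open>conv\<close> by \<open>conv_cos\<close>. In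
  \<open>cosine_transform_conv\<close> the operator acts on the transformed function
  instead.\<close>

lemma conv_cosine_transform:
  assumes f: "integrable lebesgue f"
  shows "conv (\<lambda>y. cosine_transform f y \<xi>) x = symbol \<xi> * cosine_transform f x \<xi>"
proof -
  have "integrable (lebesgue \<Otimes>\<^sub>M lebesgue) (\<lambda>p. J (x - fst p) * f (snd p) * cos ((fst p - snd p) \<bullet> \<xi>))"
    by (rule pair_integrable_mult[OF integrable_J_shift f, where K=1])
      (auto intro!: continuous_imp_pair_measurable continuous_intros)
  then have i: "integrable (lebesgue \<Otimes>\<^sub>M lebesgue) (\<lambda>(y, z). J (x - y) * f z * cos ((y - z) \<bullet> \<xi>))"
    by (simp add: case_prod_unfold)
  have "conv (\<lambda>y. cosine_transform f y \<xi>) x = (LINT y|lebesgue. LINT z|lebesgue. J (x - y) * f z * cos ((y - z) \<bullet> \<xi>))"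
    by (simp add: conv_def cosine_transform_def mult.assoc)
  also have "\<dots> = (LINT z|lebesgue. LINT y|lebesgue. J (x - y) * f z * cos ((y - z) \<bullet> \<xi>))"
    by (rule lebesgue_pair.Fubini_integral[OF i, symmetric])
  also have "\<dots> = (LINT z|lebesgue. LINT y|lebesgue. f z * (J (x - y) * cos ((y - z) \<bullet> \<xi>)))"
    by (simp add: mult_ac)
  also have "\<dots> = (LINT z|lebesgue. symbol \<xi> * (f z * cos ((x - z) \<bullet> \<xi>)))"
    by (simp add: conv_cos mult_ac)
  finally show ?thesis by (simp add: cosine_transform_def)
qed

lemma cosine_transform_conv:
  assumes f: "integrable lebesgue f"
  shows "cosine_transform (conv f) x \<xi> = symbol \<xi> * cosine_transform f x \<xi>"
proof -
  have "integrable (lebesgue \<Otimes>\<^sub>M lebesgue) (\<lambda>p. f (fst p) * J (snd p - fst p) * cos ((x - snd p) \<bullet> \<xi>))"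
    by (rule pair_integrable_conv[OF f, where K=1])
      (auto intro!: continuous_imp_pair_measurable continuous_intros)
  then have i: "integrable (lebesgue \<Otimes>\<^sub>M lebesgue) (\<lambda>(z, y). f z * J (y - z) * cos ((x - y) \<bullet> \<xi>))"
    by (simp add: case_prod_unfold)
  have e: "J (y - z) * cos ((x - y) \<bullet> \<xi>) = J (z - y) * cos ((y - x) \<bullet> \<xi>)" for y z
    using J_even[of "z - y"] cos_minus[of "(x - y) \<bullet> \<xi>"] by (simp add: inner_diff_left)
  have "cosine_transform (conv f) x \<xi> = (LINT y|lebesgue. LINT z|lebesgue. cos ((x - y) \<bullet> \<xi>) * (J (y - z) * f z))"
    by (simp add: conv_def cosine_transform_def mult.commute)
  also have "\<dots> = (LINT y|lebesgue. LINT z|lebesgue. f z * J (y - z) * cos ((x - y) \<bullet> \<xi>))"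
    by (simp only: mult_ac)
  also have "\<dots> = (LINT z|lebesgue. LINT y|lebesgue. f z * J (y - z) * cos ((x - y) \<bullet> \<xi>))"
    by (rule lebesgue_pair.Fubini_integral[OF i])
  also have "\<dots> = (LINT z|lebesgue. f z * (LINT y|lebesgue. J (z - y) * cos ((y - x) \<bullet> \<xi>)))"
    by (simp add: mult.assoc e)
  also have "\<dots> = (LINT z|lebesgue. symbol \<xi> * (f z * cos ((x - z) \<bullet> \<xi>)))"
  proof (rule Bochner_Integration.integral_cong[OF refl])
    fix z
    have "cos ((z - x) \<bullet> \<xi>) = cos ((x - z) \<bullet> \<xi>)"
      using cos_minus[of "(x - z) \<bullet> \<xi>"] by (simp add: inner_diff_left)
    then show "f z * (LINT y|lebesgue. J (z - y) * cos ((y - x) \<bullet> \<xi>)) = symbol \<xi> * (f z * cos ((x - z) \<bullet> \<xi>))"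
      by (simp add: conv_cos)
  qed
  finally show ?thesis by (simp add: cosine_transform_def)
qed

text \<open>The square of the symbol is the transform of \<open>conv J\<close> at \<open>0\<close>.
  Its Gaussian-damped integrals converge to a value of \<open>conv J\<close>, and the damping factor
  increases to \<open>1\<close>; monotone convergence then yields integrability without presupposing
  it.\<close>

lemma integrable_symbol_sq: "integrable lebesgue (\<lambda>\<xi>. (symbol \<xi>)\<^sup>2)"
proof (rule integrable_monotone_convergence)
  let ?e = "\<lambda>n. (1 / (real n + 1))\<^sup>2"
  obtain B where B: "0 < B" "\<And>x. J x \<le> B" using J_bounded by auto
  have Jm: "J \<in> borel_measurable lebesgue" using integrable_J by auto
  have Bc: "\<bar>conv J x\<bar> \<le> B" for x by (rule conv_bound[OF Jm]) (use B in auto)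
  have cm: "conv J \<in> borel_measurable lebesgue" by (rule conv_measurable[OF Jm])
  have cc: "isCont (conv J) 0" using continuous_on_conv[OF integrable_J] by (simp add: continuous_on_eq_continuous_at)
  have sq: "cosine_transform (conv J) 0 \<xi> = (symbol \<xi>)\<^sup>2" for \<xi>
    by (subst cosine_transform_conv[OF integrable_J]) (simp add: symbol_eq power2_eq_square)
  show "integrable lebesgue (\<lambda>\<xi>. exp (- (?e n * (norm \<xi>)\<^sup>2 / 2)) * (symbol \<xi>)\<^sup>2)" for n
  proof (rule integrable_mult_bounded[where K=1])
    show "integrable lebesgue (\<lambda>\<xi>::'a. exp (- (?e n * (norm \<xi>)\<^sup>2 / 2)))"
      using gauss_fourier[of "?e n" "0 :: 'a"] by (simp add: has_bochner_integral_iff)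
    show "\<bar>(symbol \<xi>)\<^sup>2\<bar> \<le> 1" for \<xi>
      using abs_symbol_le[of \<xi>] by (simp add: abs_square_le_1)
  qed (use symbol_measurable in measurable)
  show "(\<lambda>n. LINT \<xi>|lebesgue. exp (- (?e n * (norm \<xi>)\<^sup>2 / 2)) * (symbol \<xi>)\<^sup>2) \<longlonglongrightarrow> (2 * pi) ^ DIM('a) * conv J 0"
    using tendsto_mult[OF tendsto_const gauss_approximate_identity[OF cm Bc cc], of "(2 * pi) ^ DIM('a)"]
    by (subst (asm) cosine_transform_gauss[OF integrable_conv[OF integrable_J]]) (auto simp: sq)
  show "AE \<xi> in lebesgue. mono (\<lambda>n. exp (- (?e n * (norm \<xi>)\<^sup>2 / 2)) * (symbol \<xi>)\<^sup>2)"
  proof (intro AE_I2 monoI)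
    fix \<xi> :: 'a and m n :: nat assume "m \<le> n"
    then have "?e n \<le> ?e m" by (intro power_mono) (auto simp: frac_le)
    then have "?e n * (norm \<xi>)\<^sup>2 \<le> ?e m * (norm \<xi>)\<^sup>2" by (rule mult_right_mono) simp
    then show "exp (- (?e m * (norm \<xi>)\<^sup>2 / 2)) * (symbol \<xi>)\<^sup>2 \<le> exp (- (?e n * (norm \<xi>)\<^sup>2 / 2)) * (symbol \<xi>)\<^sup>2"
      by (intro mult_right_mono) auto
  qed
  show "AE \<xi> in lebesgue. (\<lambda>n. exp (- (?e n * (norm \<xi>)\<^sup>2 / 2)) * (symbol \<xi>)\<^sup>2) \<longlonglongrightarrow> (symbol \<xi>)\<^sup>2"
  proof (intro AE_I2)
    fix \<xi> :: 'a
    have "?e \<longlonglongrightarrow> 0" by real_asymp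
    then have "(\<lambda>n. exp (- (?e n * (norm \<xi>)\<^sup>2 / 2)) * (symbol \<xi>)\<^sup>2) \<longlonglongrightarrow> exp (- (0 * (norm \<xi>)\<^sup>2 / 2)) * (symbol \<xi>)\<^sup>2"
      by (intro tendsto_intros) auto
    then show "(\<lambda>n. exp (- (?e n * (norm \<xi>)\<^sup>2 / 2)) * (symbol \<xi>)\<^sup>2) \<longlonglongrightarrow> (symbol \<xi>)\<^sup>2" by simp
  qed
  show "(\<lambda>\<xi>. (symbol \<xi>)\<^sup>2) \<in> borel_measurable lebesgue" using symbol_measurable by measurable
qed

text \<open>Two convolutions supply the factor \<open>(symbol \<xi>)\<^sup>2\<close>, so the
  transform is integrable and inversion applies with no regularity of \<open>f\<close>.\<close>

lemma conv_conv_eq: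
  assumes f: "integrable lebesgue f" and B: "\<And>x. \<bar>f x\<bar> \<le> B"
  shows "(2 * pi) ^ DIM('a) * conv (conv f) x = (LINT \<xi>|lebesgue. (symbol \<xi>)\<^sup>2 * cosine_transform f x \<xi>)"
proof -
  have eq: "cosine_transform (conv (conv f)) x \<xi> = (symbol \<xi>)\<^sup>2 * cosine_transform f x \<xi>" for \<xi>
    by (simp add: cosine_transform_conv f integrable_conv power2_eq_square)
  have fm: "f \<in> borel_measurable lebesgue" using f by auto
  have "integrable lebesgue (\<lambda>\<xi>. (symbol \<xi>)\<^sup>2 * cosine_transform f x \<xi>)"
    by (rule integrable_mult_bounded[OF integrable_symbol_sq _ cosine_transform_bound[OF f]])
      (intro continuous_imp_lebesgue_measurable continuous_on_cosine_transform_snd f)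
  then have i: "integrable lebesgue (cosine_transform (conv (conv f)) x)" by (simp add: eq[abs_def])
  have c: "isCont (conv (conv f)) x"
    using continuous_on_conv[OF integrable_conv[OF f]] by (simp add: continuous_on_eq_continuous_at)
  show ?thesis
    using cosine_transform_inversion[OF integrable_conv[OF integrable_conv[OF f]] conv_bound[OF conv_measurable[OF fm] conv_bound[OF fm B]] c i]
    by (simp add: eq)
qed

end

lemma integrable_continuous_bounded_support:
  fixes f :: "'a::euclidean_space \<Rightarrow> real"
  assumes "continuous_on UNIV f" "\<And>x. f x \<noteq> 0 \<Longrightarrow> norm x \<le> \<rho>"
  shows "integrable lebesgue f"
proof -
  have "integrable lborel (\<lambda>x. indicator (cball 0 \<rho>) x *\<^sub>R f x)"
    using assms(1) by (intro borel_integrable_compact) (auto intro: continuous_on_subset)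
  moreover have "(\<lambda>x. indicator (cball 0 \<rho>) x *\<^sub>R f x) = f"
    using assms(2) by (force simp: indicator_def fun_eq_iff)
  ultimately show ?thesis
    by (simp add: integrable_completion borel_measurable_continuous_onI[OF assms(1)])
qed

text \<open>The general bound carries \<open>exp \<bar>z\<bar>\<close>, which at symbol
  \<open>- 1\<close> would cancel all the decay of \<open>exp (- t)\<close>. With
  \<open>w = - z\<close> the factor disappears by \<open>1 + w + w^2 / 2 \<le> exp w\<close> and the
  identity \<open>(1 + w + w^2 / 2) * (1 - w + w^2 / 2) = 1 + (w^2 / 2)^2\<close>.\<close>

lemma exp_minus_linear_bound_nonpos:
  assumes "z \<le> (0::real)" shows "0 \<le> exp z - 1 - z" "exp z - 1 - z \<le> z\<^sup>2 / 2"
proof -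
  show "0 \<le> exp z - 1 - z" using exp_ge_add_one_self[of z] by linarith
  define w where "w = - z"
  have w: "0 \<le> w" using assms by (simp add: w_def)
  have "1 + w + w\<^sup>2 / 2 \<le> exp w" by (rule exp_lower_Taylor_quadratic[OF w])
  moreover have "0 < 1 + w + w\<^sup>2 / 2" using w by (auto intro: add_pos_nonneg)
  moreover have "1 \<le> (1 + w + w\<^sup>2 / 2) * (1 - w + w\<^sup>2 / 2)"
  proof -
    have "(1 + w + w\<^sup>2 / 2) * (1 - w + w\<^sup>2 / 2) = 1 + (w\<^sup>2 / 2)\<^sup>2" by (simp add: power2_eq_square field_simps)
    then show ?thesis by simp
  qed
  moreover have "0 \<le> 1 - w + w\<^sup>2 / 2"
  proof -
    have "1 - w + w\<^sup>2 / 2 = 1 / 2 + (w - 1)\<^sup>2 / 2" by (simp add: power2_eq_square field_simps)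
    then show ?thesis by simp
  qed
  ultimately have "1 \<le> exp w * (1 - w + w\<^sup>2 / 2)"
    by (meson mult_right_mono order.trans)
  then have "exp (- w) * 1 \<le> exp (- w) * (exp w * (1 - w + w\<^sup>2 / 2))" by (intro mult_left_mono) auto
  then have "exp (- w) \<le> 1 - w + w\<^sup>2 / 2" by (simp add: mult.assoc[symmetric] exp_add[symmetric])
  then show "exp z - 1 - z \<le> z\<^sup>2 / 2" by (simp add: w_def)
qed

lemma powr_times_exp_bounded:
  assumes "0 \<le> (p::real)" obtains C where "0 < C" "\<And>t. 0 < t \<Longrightarrow> t powr p * exp (- (t / 2)) \<le> C"
proof -
  have "((\<lambda>t::real. t powr p * exp (- (t / 2))) \<longlongrightarrow> 0) at_top" by real_asymp
  then have "\<forall>\<^sub>F t in at_top. t powr p * exp (- (t / 2)) < 1" by (rule order_tendstoD) simp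
  then obtain t0 where t0: "\<And>t. t \<ge> t0 \<Longrightarrow> t powr p * exp (- (t / 2)) < 1"
    by (auto simp: eventually_at_top_linorder)
  have "t powr p * exp (- (t / 2)) \<le> 1 + \<bar>t0\<bar> powr p" if "0 < t" for t
  proof (cases "t \<ge> t0")
    case True then show ?thesis using t0[OF True] by (smt (verit) powr_ge_zero)
  next
    case False
    then have "t powr p \<le> \<bar>t0\<bar> powr p" using that assms by (intro powr_mono2) auto
    moreover have "t powr p * exp (- (t / 2)) \<le> t powr p" using that by (simp add: mult_left_le)
    ultimately show ?thesis by simp
  qed
  moreover have "0 < 1 + \<bar>t0\<bar> powr p" by (simp add: add_pos_nonneg)
  ultimately show ?thesis using that by blast
qed

lemma gauss_0: "gauss e (0 :: 'a::euclidean_space) = (2 * pi * e) powr (- (real DIM('a) / 2))"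
  by (simp add: gauss_def)

lemma gauss_le_gauss_0:
  assumes "0 < e" shows "gauss e (x :: 'a::euclidean_space) \<le> gauss e (0 :: 'a)"
  using assms by (simp add: gauss_def mult_left_le)

lemma one_minus_cos_le: "1 - cos x \<le> (x::real)\<^sup>2 / 2"
proof -
  have "\<bar>sin (x / 2)\<bar> \<le> \<bar>x / 2\<bar>" by (rule abs_sin_x_le_abs_x)
  then have "(sin (x / 2))\<^sup>2 \<le> (x / 2)\<^sup>2" using abs_le_square_iff by blast
  moreover have "cos x = 1 - 2 * (sin (x / 2))\<^sup>2" using cos_double_sin[of "x / 2"] by simp
  ultimately show ?thesis by (simp add: power_divide)
qed

section \<open>Size of the symbol at high and low frequencies\<close>

context dispersal_kernel begin

text \<open>Riemann-Lebesgue: translating by \<open>h = (\<pi> / |\<xi>|\<^sup>2) \<xi>\<close> changes the sign of the integral.\<close>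

lemma symbol_small:
  assumes "0 < \<epsilon>" shows "\<exists>R>0. \<forall>\<xi>. R \<le> norm \<xi> \<longrightarrow> \<bar>symbol \<xi>\<bar> \<le> \<epsilon>"
proof -
  obtain \<rho>0 where \<rho>0: "\<And>x. J x \<noteq> 0 \<Longrightarrow> norm x \<le> \<rho>0" using bounded_support_J by auto
  define \<rho> where "\<rho> = \<bar>\<rho>0\<bar>"
  have \<rho>: "J x \<noteq> 0 \<Longrightarrow> norm x \<le> \<rho>" "0 \<le> \<rho>" for x using \<rho>0[of x] by (auto simp: \<rho>_def)
  define V where "V = measure lebesgue (cball (0::'a) (\<rho> + 1))"
  have V: "0 \<le> V" by (simp add: V_def)
  \<comment> \<open>The shift \<open>h\<close> will be shorter than \<open>1\<close>. So the
    difference of \<open>J\<close> and its translate lives in the ball of radius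
    \<open>\<rho> + 1\<close>, and both arguments stay in the ball of radius
    \<open>\<rho> + 2\<close>.\<close>
  have "uniformly_continuous_on (cball 0 (\<rho> + 2)) J"
    using continuous_J by (intro compact_uniformly_continuous) (auto intro: continuous_on_subset)
  then obtain d where d: "0 < d" "\<And>x y. x \<in> cball 0 (\<rho> + 2) \<Longrightarrow> y \<in> cball 0 (\<rho> + 2) \<Longrightarrow> dist y x < d \<Longrightarrow> dist (J y) (J x) < \<epsilon> / (V + 1)"
    using V assms unfolding uniformly_continuous_on_def by (metis add_nonneg_pos divide_pos_pos zero_less_one)
  define h where "h \<xi> = (pi / (norm \<xi>)\<^sup>2) *\<^sub>R \<xi>" for \<xi> :: 'a
  \<comment> \<open>Beyond this frequency the shift has norm \<open>pi / norm \<xi>\<close>, which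
    is below both \<open>1\<close> and \<open>d\<close>.\<close>
  define R where "R = pi / min 1 d + 1"
  have R: "0 < R" using d by (simp add: R_def add_pos_pos)
  have "\<bar>symbol \<xi>\<bar> \<le> \<epsilon>" if \<xi>: "R \<le> norm \<xi>" for \<xi>
  proof -
    have n: "0 < norm \<xi>" using R \<xi> by linarith
    have nh: "norm (h \<xi>) = pi / norm \<xi>" using n by (simp add: h_def power2_eq_square)
    have "pi / min 1 d < norm \<xi>" using \<xi> by (simp add: R_def)
    then have "pi / norm \<xi> < min 1 d" using n d(1) by (simp add: field_simps min_def split: if_splits)
    then have h1: "norm (h \<xi>) < 1" "norm (h \<xi>) < d" using nh by auto
    have hx: "h \<xi> \<bullet> \<xi> = pi" using n by (simp add: h_def power2_norm_eq_inner[symmetric])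
    have i1: "integrable lebesgue (\<lambda>x. J (h \<xi> + x) * cos (x \<bullet> \<xi>))"
      by (rule integrable_mult_bounded[OF integrable_lebesgue_translate[OF integrable_J], where K=1])
        (auto intro!: continuous_imp_lebesgue_measurable continuous_intros)
    have "symbol \<xi> = (LINT x|lebesgue. J (h \<xi> + x) * cos ((h \<xi> + x) \<bullet> \<xi>))"
      unfolding symbol_def by (rule integral_lebesgue_translate[OF integrable_J_cos, symmetric])
    also have "\<dots> = - (LINT x|lebesgue. J (h \<xi> + x) * cos (x \<bullet> \<xi>))"
      by (simp add: inner_add_left hx)
    finally have "2 * symbol \<xi> = (LINT x|lebesgue. J x * cos (x \<bullet> \<xi>)) - (LINT x|lebesgue. J (h \<xi> + x) * cos (x \<bullet> \<xi>))"
      by (simp add: symbol_def)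
    also have "\<dots> = (LINT x|lebesgue. (J x - J (h \<xi> + x)) * cos (x \<bullet> \<xi>))"
      using i1 integrable_J_cos by (simp add: left_diff_distrib)
    finally have eq: "2 * symbol \<xi> = \<dots>" .
    have "\<bar>2 * symbol \<xi>\<bar> \<le> (LINT x|lebesgue. \<epsilon> / (V + 1) * indicat_real (cball (0::'a) (\<rho> + 1)) x)"
      unfolding eq
    proof (rule order.trans[OF integral_abs_bound integral_mono])
      show "integrable lebesgue (\<lambda>x. \<bar>(J x - J (h \<xi> + x)) * cos (x \<bullet> \<xi>)\<bar>)"
        using i1 integrable_J_cos by (simp add: left_diff_distrib)
      show "integrable lebesgue (\<lambda>x. \<epsilon> / (V + 1) * indicat_real (cball (0::'a) (\<rho> + 1)) x)"
        using lmeasurable_cball lmeasurable_iff_integrable by (intro integrable_mult_right) blast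
      show "\<bar>(J x - J (h \<xi> + x)) * cos (x \<bullet> \<xi>)\<bar> \<le> \<epsilon> / (V + 1) * indicat_real (cball 0 (\<rho> + 1)) x" for x
      proof -
        have t: "norm (h \<xi> + x) \<le> norm x + 1" "norm x \<le> norm (h \<xi> + x) + 1"
          using norm_triangle_ineq[of "h \<xi>" x] norm_triangle_ineq4[of "h \<xi> + x" "h \<xi>"] h1 by auto
        have "\<bar>J x - J (h \<xi> + x)\<bar> \<le> \<epsilon> / (V + 1) * indicat_real (cball 0 (\<rho> + 1)) x"
        proof (cases "norm x \<le> \<rho> + 1")
          case True
          then have "dist (J (h \<xi> + x)) (J x) < \<epsilon> / (V + 1)"
            using t h1 \<rho>(2) by (intro d(2)) (simp, simp, simp add: dist_norm)
          then show ?thesis using True by (simp add: dist_real_def abs_minus_commute)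
        next
          case False
          then have "J x = 0" "J (h \<xi> + x) = 0" using \<rho>(1)[of x] \<rho>(1)[of "h \<xi> + x"] t by auto
          then show ?thesis using assms V by simp
        qed
        then show ?thesis
          by (simp add: abs_mult) (smt (verit, best) abs_cos_le_one abs_ge_zero mult_left_le)
      qed
    qed
    also have "\<dots> = \<epsilon> / (V + 1) * V" by (simp add: V_def)
    also have "\<dots> \<le> \<epsilon>" using V assms by (simp add: field_simps)
    finally show ?thesis using assms by (simp add: abs_mult)
  qed
  then show ?thesis using R by blast
qed

lemma one_minus_symbol:
  "integrable lebesgue (\<lambda>x. J x * (1 - cos (x \<bullet> \<xi>)))"
  "1 - symbol \<xi> = (LINT x|lebesgue. J x * (1 - cos (x \<bullet> \<xi>)))"
  using integrable_J integrable_J_cos[of \<xi>] integral_J by (auto simp: right_diff_distrib symbol_def)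

text \<open>Pointwise, \<open>1 - cos (2 * s) = 2 * (1 - cos s) * (1 + cos s)\<close> is at most
  \<open>4 * (1 - cos s)\<close>, and \<open>J\<close> is nonnegative.\<close>

lemma one_minus_symbol_double: "1 - symbol (2 *\<^sub>R \<xi>) \<le> 4 * (1 - symbol \<xi>)"
proof -
  have "1 - symbol (2 *\<^sub>R \<xi>) \<le> (LINT x|lebesgue. 4 * (J x * (1 - cos (x \<bullet> \<xi>))))"
    unfolding one_minus_symbol(2)[of "2 *\<^sub>R \<xi>"]
  proof (rule integral_mono)
    fix x
    have "1 - cos (2 * (x \<bullet> \<xi>)) = 2 * ((1 - cos (x \<bullet> \<xi>)) * (1 + cos (x \<bullet> \<xi>)))"
      unfolding cos_double_cos by (simp add: power2_eq_square algebra_simps)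
    also have "\<dots> \<le> 2 * ((1 - cos (x \<bullet> \<xi>)) * 2)"
      by (intro mult_left_mono) auto
    finally show "J x * (1 - cos (x \<bullet> 2 *\<^sub>R \<xi>)) \<le> 4 * (J x * (1 - cos (x \<bullet> \<xi>)))"
      using mult_left_mono[of "1 - cos (2 * (x \<bullet> \<xi>))" "4 * (1 - cos (x \<bullet> \<xi>))" "J x"] by (simp add: algebra_simps)
  qed (use one_minus_symbol(1)[of "2 *\<^sub>R \<xi>"] one_minus_symbol(1)[of \<xi>] in auto)
  then show ?thesis by (simp add: one_minus_symbol)
qed

text \<open>Doubling carries the bound \<open>1 - symbol \<ge> 1 / 2\<close> at large frequencies down to a quadratic bound at
  small ones.\<close>

lemma symbol_gap:
  obtains k R where "0 < k" "0 < R" "\<And>\<xi>. norm \<xi> \<le> R \<Longrightarrow> k * (norm \<xi>)\<^sup>2 \<le> 1 - symbol \<xi>"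
    "\<And>\<xi>. R \<le> norm \<xi> \<Longrightarrow> \<bar>symbol \<xi>\<bar> \<le> 1 / 2"
proof -
  obtain R where R: "0 < R" "\<And>\<xi>. R \<le> norm \<xi> \<Longrightarrow> \<bar>symbol \<xi>\<bar> \<le> 1 / 2"
    using symbol_small[of "1 / 2"] by auto
  \<comment> \<open>For \<open>norm \<xi> \<le> R\<close> the bound asked for is at most
    \<open>1 / 8\<close>, which is what one doubling leaves of the gap \<open>1 / 2\<close>. Further
    doublings cost nothing, since the factor 4 of \<open>one_minus_symbol_double\<close> is also
    that of the squared norm.\<close>
  define k where "k = 1 / (8 * R\<^sup>2)"
  have *: "k * (norm \<xi>)\<^sup>2 \<le> 1 - symbol \<xi>" if "R / 2 ^ n \<le> norm \<xi>" "norm \<xi> \<le> R" for n \<xi>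
    using that
  proof (induction n arbitrary: \<xi>)
    case 0
    then have "norm \<xi> = R" by simp
    moreover have "1 / 8 \<le> 1 - symbol \<xi>" using R(2)[of \<xi>] 0 by auto
    ultimately show ?case using R(1) by (simp add: k_def)
  next
    case (Suc n)
    show ?case
    proof (cases "norm (2 *\<^sub>R \<xi>) \<le> R")
      case True
      have "k * (norm (2 *\<^sub>R \<xi>))\<^sup>2 \<le> 1 - symbol (2 *\<^sub>R \<xi>)"
        using Suc.prems True by (intro Suc.IH) (auto simp: field_simps)
      then show ?thesis using one_minus_symbol_double[of \<xi>] by (simp add: power_mult_distrib)
    next
      case False
      then have "1 / 2 \<le> 1 - symbol (2 *\<^sub>R \<xi>)" using R(2)[of "2 *\<^sub>R \<xi>"] by linarith
      then have "1 / 2 \<le> 4 * (1 - symbol \<xi>)" by (rule order.trans[OF _ one_minus_symbol_double])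
      then have "1 / 8 \<le> 1 - symbol \<xi>" by simp
      moreover have "(norm \<xi>)\<^sup>2 \<le> R\<^sup>2" using Suc.prems by (intro power_mono) auto
      then have "k * (norm \<xi>)\<^sup>2 \<le> 1 / 8" using R(1) by (simp add: k_def field_simps)
      ultimately show ?thesis by linarith
    qed
  qed
  have "k * (norm \<xi>)\<^sup>2 \<le> 1 - symbol \<xi>" if "norm \<xi> \<le> R" for \<xi>
  proof (cases "\<xi> = 0")
    case True then show ?thesis using abs_symbol_le[of \<xi>] by auto
  next
    case False
    obtain n where "R / norm \<xi> < 2 ^ n" using real_arch_pow[of 2 "R / norm \<xi>"] by auto
    then show ?thesis using False that by (intro *[of n]) (auto simp: field_simps)
  qed
  then show ?thesis using that[of k R] R by (auto simp: k_def)
qed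

text \<open>Pointwise \<open>t * (1 - cos (c / sqrt t))\<close> tends to \<open>c^2 / 2\<close> and
  is dominated by this limit, so the second moment can be taken in the limit.\<close>

lemma symbol_second_order:
  "((\<lambda>t. t * (1 - symbol ((1 / sqrt t) *\<^sub>R \<eta>))) \<longlongrightarrow> \<a> * (norm \<eta>)\<^sup>2) at_top"
proof -
  obtain \<rho> where \<rho>: "\<And>x. J x \<noteq> 0 \<Longrightarrow> norm x \<le> \<rho>" using bounded_support_J by auto
  have i: "integrable lebesgue (\<lambda>x. J x * ((x \<bullet> \<eta>)\<^sup>2 / 2))"
    by (rule integrable_continuous_bounded_support[where \<rho>=\<rho>]) (auto intro!: continuous_intros continuous_J \<rho>)
  have "((\<lambda>t. LINT x|lebesgue. J x * (t * (1 - cos (x \<bullet> ((1 / sqrt t) *\<^sub>R \<eta>))))) \<longlongrightarrow> (LINT x|lebesgue. J x * ((x \<bullet> \<eta>)\<^sup>2 / 2))) at_top"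
  proof (rule integral_dominated_convergence_at_top[where w="\<lambda>x. J x * ((x \<bullet> \<eta>)\<^sup>2 / 2)"])
    show "\<forall>\<^sub>F t in at_top. AE x in lebesgue. norm (J x * (t * (1 - cos (x \<bullet> ((1 / sqrt t) *\<^sub>R \<eta>))))) \<le> J x * ((x \<bullet> \<eta>)\<^sup>2 / 2)"
      using eventually_gt_at_top[of 0]
    proof eventually_elim
      case (elim t)
      have "\<bar>t * (1 - cos (x \<bullet> \<eta> / sqrt t))\<bar> \<le> (x \<bullet> \<eta>)\<^sup>2 / 2" for x
        using mult_left_mono[OF one_minus_cos_le[of "x \<bullet> \<eta> / sqrt t"], of t] elim
        by (simp add: abs_mult power_divide)
      then have "J x * \<bar>t * (1 - cos (x \<bullet> \<eta> / sqrt t))\<bar> \<le> J x * ((x \<bullet> \<eta>)\<^sup>2 / 2)" for x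
        by (intro mult_left_mono) auto
      then show ?case by (intro AE_I2) (simp only: real_norm_def abs_mult[of "J _"] abs_of_nonneg[OF J_nonneg] inner_scaleR_right
          times_divide_eq_left mult_1_left)
    qed
    show "AE x in lebesgue. ((\<lambda>t. J x * (t * (1 - cos (x \<bullet> ((1 / sqrt t) *\<^sub>R \<eta>))))) \<longlongrightarrow> J x * ((x \<bullet> \<eta>)\<^sup>2 / 2)) at_top"
    proof (intro AE_I2 tendsto_mult tendsto_const)
      fix x
      have "((\<lambda>t. t * (1 - cos (c / sqrt t))) \<longlongrightarrow> c * c / 2) at_top" for c :: real
        by real_asymp
      from this[of "x \<bullet> \<eta>"] show "((\<lambda>t. t * (1 - cos (x \<bullet> ((1 / sqrt t) *\<^sub>R \<eta>)))) \<longlongrightarrow> (x \<bullet> \<eta>)\<^sup>2 / 2) at_top"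
        by (simp add: power2_eq_square)
    qed
    show "(\<lambda>x. J x * (t * (1 - cos (x \<bullet> ((1 / sqrt t) *\<^sub>R \<eta>))))) \<in> borel_measurable lebesgue" for t
      by (intro continuous_imp_lebesgue_measurable continuous_intros continuous_J)
    show "(\<lambda>x. J x * ((x \<bullet> \<eta>)\<^sup>2 / 2)) \<in> borel_measurable lebesgue" using i by auto
  qed (rule i)
  moreover have "(LINT x|lebesgue. J x * (t * (1 - cos (x \<bullet> \<xi>)))) = t * (1 - symbol \<xi>)" for t \<xi>
    unfolding one_minus_symbol by (subst integral_mult_right_zero[symmetric]) (simp add: mult_ac)
  moreover have "(LINT x|lebesgue. J x * ((x \<bullet> \<eta>)\<^sup>2 / 2)) = \<a> * (norm \<eta>)\<^sup>2"
    using second_moment[of \<eta>] by simp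
  ultimately show ?thesis by (simp only:)
qed

text \<open>The quadratic gap survives the limit in \<open>symbol_second_order\<close>, so
  \<open>\<a>\<close> is at least the \<open>k\<close> of \<open>symbol_gap\<close>.\<close>

lemma a_pos: "0 < \<a>"
proof -
  obtain k R where kR: "0 < k" "0 < R" "\<And>\<xi>. norm \<xi> \<le> R \<Longrightarrow> k * (norm \<xi>)\<^sup>2 \<le> 1 - symbol \<xi>" by (rule symbol_gap) blast
  obtain \<eta> :: 'a where "\<eta> \<in> Basis" using nonempty_Basis[where 'a='a] by blast
  then have n: "norm \<eta> = 1" by simp
  have "((\<lambda>t. 1 / sqrt t) \<longlongrightarrow> 0) at_top" by real_asymp
  then have "\<forall>\<^sub>F t in at_top. 1 / sqrt t < R" using kR by (intro order_tendstoD)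
  then have "\<forall>\<^sub>F t in at_top. k \<le> t * (1 - symbol ((1 / sqrt t) *\<^sub>R \<eta>))"
    using eventually_gt_at_top[of 0]
  proof eventually_elim
    case (elim t)
    then have "k * (norm ((1 / sqrt t) *\<^sub>R \<eta>))\<^sup>2 \<le> 1 - symbol ((1 / sqrt t) *\<^sub>R \<eta>)"
      by (intro kR) (simp add: n)
    then show ?case using elim by (simp add: n power_divide field_simps)
  qed
  then have "k \<le> \<a> * (norm \<eta>)\<^sup>2"
    by (intro tendsto_lowerbound[OF symbol_second_order]) auto
  then show ?thesis using kR n by simp
qed

section \<open>Decay of the regularised symbol\<close>

lemma continuous_on_duhamel: "continuous_on UNIV (\<lambda>\<xi>. duhamel_symbol t (symbol \<xi>))"
  unfolding duhamel_symbol_def by (intro continuous_intros continuous_on_symbol)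

lemma duhamel_measurable: "(\<lambda>\<xi>. duhamel_symbol t (symbol \<xi>)) \<in> borel_measurable lebesgue"
  by (intro continuous_imp_lebesgue_measurable continuous_on_duhamel)

lemma duhamel_bound: "\<bar>duhamel_symbol t (symbol \<xi>)\<bar> \<le> exp (2 * \<bar>t\<bar>) * t\<^sup>2 * (symbol \<xi>)\<^sup>2"
  by (rule duhamel_symbol_bound[OF abs_symbol_le])

lemma integrable_duhamel: "integrable lebesgue (\<lambda>\<xi>. duhamel_symbol t (symbol \<xi>))"
proof (rule Bochner_Integration.integrable_bound)
  show "integrable lebesgue (\<lambda>\<xi>. exp (2 * \<bar>t\<bar>) * t\<^sup>2 * (symbol \<xi>)\<^sup>2)"
    by (intro integrable_mult_right integrable_symbol_sq)
  show "AE \<xi> in lebesgue. norm (duhamel_symbol t (symbol \<xi>)) \<le> norm (exp (2 * \<bar>t\<bar>) * t\<^sup>2 * (symbol \<xi>)\<^sup>2)"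
    using duhamel_bound[of t] by (intro AE_I2) (simp add: abs_mult)
qed (rule duhamel_measurable)

text \<open>At low frequencies with nonnegative symbol the gap turns
  \<open>exp (- t * (1 - symbol \<xi>))\<close> into a Gaussian. Otherwise the symbol is negative or
  at most \<open>1 / 2\<close>, and \<open>exp (- t)\<close> keeps half of its exponent; there the
  quadratic bound retains the factor \<open>(symbol \<xi>)\<^sup>2\<close> that makes the term
  integrable.\<close>

lemma duhamel_decay:
  obtains k where "0 < k" "\<And>t \<xi>. 0 \<le> t \<Longrightarrow>
    \<bar>duhamel_symbol t (symbol \<xi>)\<bar> \<le> exp (- (k * t * (norm \<xi>)\<^sup>2)) + t\<^sup>2 * exp (- (t / 2)) * (symbol \<xi>)\<^sup>2"
proof -
  obtain k R where kR: "0 < k" "0 < R" "\<And>\<xi>. norm \<xi> \<le> R \<Longrightarrow> k * (norm \<xi>)\<^sup>2 \<le> 1 - symbol \<xi>"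
    "\<And>\<xi>. R \<le> norm \<xi> \<Longrightarrow> \<bar>symbol \<xi>\<bar> \<le> 1 / 2" by (rule symbol_gap) blast
  have "\<bar>duhamel_symbol t y\<bar> \<le> exp (- (k * t * (norm \<xi>)\<^sup>2)) + t\<^sup>2 * exp (- (t / 2)) * y\<^sup>2"
    if t: "0 \<le> t" and y: "y = symbol \<xi>" for t \<xi> y
  proof -
    have far: "\<bar>duhamel_symbol t y\<bar> \<le> t\<^sup>2 * exp (- (t / 2)) * y\<^sup>2"
      if "\<bar>exp (t * y) - 1 - t * y\<bar> \<le> (t * y)\<^sup>2 / 2 * exp (t / 2)"
    proof -
      have "\<bar>duhamel_symbol t y\<bar> \<le> exp (- t) * ((t * y)\<^sup>2 / 2 * exp (t / 2))"
        using that by (simp add: duhamel_symbol_def abs_mult)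
      also have "\<dots> = t\<^sup>2 * exp (- (t / 2)) * y\<^sup>2 / 2"
      proof -
        have "exp (- (t / 2)) = exp (- t) * exp (t / 2)" by (simp add: exp_add[symmetric])
        then show ?thesis by (simp add: power_mult_distrib)
      qed
      also have "\<dots> \<le> t\<^sup>2 * exp (- (t / 2)) * y\<^sup>2" by simp
      finally show ?thesis .
    qed
    consider "y < 0" | "0 \<le> y" "norm \<xi> \<le> R" | "0 \<le> y" "R \<le> norm \<xi>" by linarith
    then show ?thesis
    proof cases
      case 1
      then have z: "t * y \<le> 0" using t by (simp add: mult_nonneg_nonpos)
      have "\<bar>exp (t * y) - 1 - t * y\<bar> \<le> (t * y)\<^sup>2 / 2 * 1"
        using exp_minus_linear_bound_nonpos[OF z] by simp
      also have "\<dots> \<le> (t * y)\<^sup>2 / 2 * exp (t / 2)" using t by (intro mult_left_mono) auto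
      finally have "\<bar>duhamel_symbol t y\<bar> \<le> t\<^sup>2 * exp (- (t / 2)) * y\<^sup>2" by (rule far)
      then show ?thesis by (smt (verit) exp_ge_zero)
    next
      case 2
      have "0 \<le> exp (t * y) - 1 - t * y" using exp_ge_add_one_self[of "t * y"] by linarith
      moreover have "0 \<le> t * y" using 2 t by simp
      then have "exp (t * y) - 1 - t * y \<le> exp (t * y)" by linarith
      ultimately have "\<bar>duhamel_symbol t y\<bar> \<le> exp (- t) * exp (t * y)"
        by (simp add: duhamel_symbol_def abs_mult)
      also have "\<dots> = exp (- (t * (1 - y)))" by (simp add: exp_add[symmetric] algebra_simps)
      also have "\<dots> \<le> exp (- (k * t * (norm \<xi>)\<^sup>2))"
        using mult_left_mono[OF kR(3)[OF 2(2)] t] y by (simp add: mult_ac)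
      finally show ?thesis by (smt (verit) exp_ge_zero mult_nonneg_nonneg zero_le_power2)
    next
      case 3
      then have "\<bar>t * y\<bar> \<le> t / 2" using kR(4)[OF 3(2)] t y mult_left_mono[of "\<bar>y\<bar>" "1/2" t] by (simp add: abs_mult)
      then have "\<bar>exp (t * y) - 1 - t * y\<bar> \<le> (t * y)\<^sup>2 / 2 * exp (t / 2)"
        by (intro order.trans[OF exp_minus_linear_bound] mult_left_mono) auto
      then have "\<bar>duhamel_symbol t y\<bar> \<le> t\<^sup>2 * exp (- (t / 2)) * y\<^sup>2" by (rule far)
      then show ?thesis by (smt (verit) exp_ge_zero)
    qed
  qed
  then show ?thesis using that[OF kR(1)] by blast
qed

lemma integral_exp_norm_sq:
  assumes "0 < c"
  shows "has_bochner_integral lebesgue (\<lambda>\<xi>::'a. exp (- (c * (norm \<xi>)\<^sup>2))) ((pi / c) powr (real DIM('a) / 2))"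
proof -
  have "has_bochner_integral lebesgue (\<lambda>\<xi>::'a. exp (- (c * (norm \<xi>)\<^sup>2))) ((2 * pi) ^ DIM('a) * gauss (2 * c) (0::'a))"
    using gauss_fourier[of "2 * c" "0::'a"] assms by simp
  moreover have "(2 * pi) ^ DIM('a) * gauss (2 * c) (0::'a) = (pi / c) powr (real DIM('a) / 2)"
  proof -
    have "(2 * pi) ^ DIM('a) = (4 * (pi * pi)) powr (real DIM('a) / 2)"
      using power_eq_powr_half[of "2 * pi" "DIM('a)"] by (simp add: powr_mult[symmetric])
    moreover have "(4 * (pi * pi)) powr (real DIM('a) / 2) * (2 * pi * (2 * c)) powr (- (real DIM('a) / 2)) = (pi / c) powr (real DIM('a) / 2)"
      using assms by (simp add: powr_minus divide_inverse[symmetric] powr_divide[symmetric])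
    ultimately show ?thesis by (simp add: gauss_0)
  qed
  ultimately show ?thesis by simp
qed

text \<open>The \<open>L^1\<close> norm of the multiplier controls the norm of the operator from
  \<open>L^1\<close> to \<open>L^\<infinity>\<close>. The Gaussian part gives the power of
  \<open>t\<close>; the exponentially small part is absorbed into it.\<close>

lemma integral_duhamel_decay:
  obtains C where "0 < C" "\<And>t. 0 < t \<Longrightarrow> (LINT \<xi>|lebesgue. \<bar>duhamel_symbol t (symbol \<xi>)\<bar>) \<le> C * t powr (- (real DIM('a) / 2))"
proof -
  obtain k where k: "0 < k" "\<And>t \<xi>. 0 \<le> t \<Longrightarrow>
    \<bar>duhamel_symbol t (symbol \<xi>)\<bar> \<le> exp (- (k * t * (norm \<xi>)\<^sup>2)) + t\<^sup>2 * exp (- (t / 2)) * (symbol \<xi>)\<^sup>2"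
    by (rule duhamel_decay) blast
  obtain C where C: "0 < C" "\<And>t. 0 < t \<Longrightarrow> t powr (2 + real DIM('a) / 2) * exp (- (t / 2)) \<le> C"
    by (rule powr_times_exp_bounded[of "2 + real DIM('a) / 2"]) auto
  define I where "I = (LINT \<xi>|lebesgue. (symbol \<xi>)\<^sup>2)"
  have I: "0 \<le> I" by (simp add: I_def)
  define D where "D = (pi / k) powr (real DIM('a) / 2) + C * I"
  have D: "0 < D" using C I k by (auto simp: D_def intro!: add_pos_nonneg)
  show ?thesis
  proof (rule that[OF D])
    fix t :: real assume t: "0 < t"
    let ?p = "t powr (- (real DIM('a) / 2))"
    have kt: "0 < k * t" using k t by simp
    note g = integral_exp_norm_sq[OF kt]
    have "(LINT \<xi>|lebesgue. \<bar>duhamel_symbol t (symbol \<xi>)\<bar>) \<le> (LINT \<xi>|lebesgue. exp (- (k * t * (norm \<xi>)\<^sup>2)) + t\<^sup>2 * exp (- (t / 2)) * (symbol \<xi>)\<^sup>2)"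
      using k(2) t g integrable_duhamel integrable_symbol_sq
      by (intro integral_mono) (auto simp: has_bochner_integral_iff)
    also have "\<dots> = (pi / (k * t)) powr (real DIM('a) / 2) + t\<^sup>2 * exp (- (t / 2)) * I"
      using g integrable_symbol_sq by (simp add: has_bochner_integral_iff I_def)
    also have "(pi / (k * t)) powr (real DIM('a) / 2) = (pi / k) powr (real DIM('a) / 2) * ?p"
      using k t by (simp add: powr_divide powr_mult powr_minus divide_simps)
    finally have 1: "(LINT \<xi>|lebesgue. \<bar>duhamel_symbol t (symbol \<xi>)\<bar>) \<le> (pi / k) powr (real DIM('a) / 2) * ?p + t\<^sup>2 * exp (- (t / 2)) * I" .
    have "t\<^sup>2 * exp (- (t / 2)) \<le> C * ?p"
    proof -
      have "t powr (2 + real DIM('a) / 2) = t\<^sup>2 * t powr (real DIM('a) / 2)"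
        using t by (simp add: powr_add powr_numeral)
      then have "t\<^sup>2 * exp (- (t / 2)) * t powr (real DIM('a) / 2) \<le> C" using C(2)[OF t] by (simp add: mult_ac)
      then have "t\<^sup>2 * exp (- (t / 2)) \<le> C / t powr (real DIM('a) / 2)" using t by (simp add: pos_le_divide_eq)
      then show ?thesis by (simp add: powr_minus_divide)
    qed
    from mult_right_mono[OF this I] 1 show "(LINT \<xi>|lebesgue. \<bar>duhamel_symbol t (symbol \<xi>)\<bar>) \<le> D * ?p"
      by (simp add: D_def algebra_simps)
  qed
qed

section \<open>The semigroup: flow property and decay\<close>

text \<open>Given by its multiplier rather than as an operator exponential, so that decay can be
  read off. That it solves the equation is \<open>has_real_derivative_semigroup\<close>; sign, upper
  bound and mass estimate come from comparison in \<open>semigroup_bounds\<close>.\<close>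

definition semigroup :: "real \<Rightarrow> ('a \<Rightarrow> real) \<Rightarrow> 'a \<Rightarrow> real" where
  "semigroup t f x = exp (- t) * f x + t * exp (- t) * conv f x +
    (LINT \<xi>|lebesgue. duhamel_symbol t (symbol \<xi>) * cosine_transform f x \<xi>) / (2 * pi) ^ DIM('a)"

lemma semigroup_0 [simp]: "semigroup 0 f x = f x" by (simp add: semigroup_def)

lemma integrable_mult_cosine_transform:
  assumes "integrable lebesgue f" "integrable lebesgue q"
  shows "integrable lebesgue (\<lambda>\<xi>. q \<xi> * cosine_transform f x \<xi>)"
  by (rule integrable_mult_bounded[OF assms(2) _ cosine_transform_bound[OF assms(1)]])
    (intro continuous_imp_lebesgue_measurable continuous_on_cosine_transform_snd assms)

lemma integral_mult_cosine_transform_measurable: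
  assumes f: "integrable lebesgue f" and q: "integrable lebesgue q"
  shows "(\<lambda>x. LINT \<xi>|lebesgue. q \<xi> * cosine_transform f x \<xi>) \<in> borel_measurable lebesgue"
proof (rule lebesgue.borel_measurable_lebesgue_integral)
  have [measurable]: "q \<in> borel_measurable lebesgue" using q by auto
  have "(\<lambda>p. q (snd p) * cosine_transform f (fst p) (snd p)) \<in> borel_measurable (lebesgue \<Otimes>\<^sub>M lebesgue)"
    using continuous_imp_pair_measurable[OF continuous_on_cosine_transform[OF f]] by measurable
  then show "(\<lambda>(x, \<xi>). q \<xi> * cosine_transform f x \<xi>) \<in> borel_measurable (lebesgue \<Otimes>\<^sub>M lebesgue)"
    by (simp add: case_prod_unfold)
qed

lemma semigroup_measurable:
  assumes f: "integrable lebesgue f"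
  shows "semigroup t f \<in> borel_measurable lebesgue"
proof -
  have [measurable]: "f \<in> borel_measurable lebesgue" using f by auto
  note [measurable] = conv_measurable integral_mult_cosine_transform_measurable[OF f integrable_duhamel[of t]]
  show ?thesis unfolding semigroup_def[abs_def] by measurable
qed

lemma conv_integral_cosine_transform:
  assumes f: "integrable lebesgue f" and q: "integrable lebesgue q"
  shows "integrable lebesgue (\<lambda>y. J (x - y) * (LINT \<xi>|lebesgue. q \<xi> * cosine_transform f y \<xi>))"
    and "conv (\<lambda>y. LINT \<xi>|lebesgue. q \<xi> * cosine_transform f y \<xi>) x =
      (LINT \<xi>|lebesgue. q \<xi> * (symbol \<xi> * cosine_transform f x \<xi>))"
proof -
  have "integrable (lebesgue \<Otimes>\<^sub>M lebesgue) (\<lambda>p. J (x - fst p) * q (snd p) * cosine_transform f (fst p) (snd p))"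
    by (rule pair_integrable_mult[OF integrable_J_shift q continuous_imp_pair_measurable[OF continuous_on_cosine_transform[OF f]]])
      (rule cosine_transform_bound[OF f])
  then have i: "integrable (lebesgue \<Otimes>\<^sub>M lebesgue) (\<lambda>(y, \<xi>). J (x - y) * q \<xi> * cosine_transform f y \<xi>)"
    by (simp add: case_prod_unfold)
  show "integrable lebesgue (\<lambda>y. J (x - y) * (LINT \<xi>|lebesgue. q \<xi> * cosine_transform f y \<xi>))"
    using lebesgue_pair.integrable_fst[OF i] by (simp add: mult.assoc)
  have "conv (\<lambda>y. LINT \<xi>|lebesgue. q \<xi> * cosine_transform f y \<xi>) x = (LINT y|lebesgue. LINT \<xi>|lebesgue. J (x - y) * q \<xi> * cosine_transform f y \<xi>)"
    by (simp add: conv_def mult.assoc)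
  also have "\<dots> = (LINT \<xi>|lebesgue. LINT y|lebesgue. J (x - y) * q \<xi> * cosine_transform f y \<xi>)"
    by (rule lebesgue_pair.Fubini_integral[OF i, symmetric])
  also have "\<dots> = (LINT \<xi>|lebesgue. q \<xi> * conv (\<lambda>y. cosine_transform f y \<xi>) x)"
    unfolding conv_def by (subst integral_mult_right_zero[symmetric]) (simp add: mult_ac)
  finally show "conv (\<lambda>y. LINT \<xi>|lebesgue. q \<xi> * cosine_transform f y \<xi>) x =
      (LINT \<xi>|lebesgue. q \<xi> * (symbol \<xi> * cosine_transform f x \<xi>))"
    by (simp add: conv_cosine_transform[OF f])
qed

lemma conv_semigroup:
  assumes f: "integrable lebesgue f"
  shows "conv (semigroup t f) x = exp (- t) * conv f x + t * exp (- t) * conv (conv f) x +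
    (LINT \<xi>|lebesgue. duhamel_symbol t (symbol \<xi>) * (symbol \<xi> * cosine_transform f x \<xi>)) / (2 * pi) ^ DIM('a)"
proof -
  note i = integrable_conv_integrable[OF f, of x] integrable_conv_integrable[OF integrable_conv[OF f], of x]
    conv_integral_cosine_transform[OF f integrable_duhamel[of t], of x]
  let ?F = "\<lambda>y. LINT \<xi>|lebesgue. duhamel_symbol t (symbol \<xi>) * cosine_transform f y \<xi>"
  have "J (x - y) * semigroup t f y = exp (- t) * (J (x - y) * f y) + t * exp (- t) * (J (x - y) * conv f y) +
      1 / (2 * pi) ^ DIM('a) * (J (x - y) * ?F y)" for y
    by (simp add: semigroup_def algebra_simps)
  then have "conv (semigroup t f) x = exp (- t) * conv f x + t * exp (- t) * conv (conv f) x + 1 / (2 * pi) ^ DIM('a) * conv ?F x"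
    using i(1,2,3) by (simp add: conv_def)
  then show ?thesis by (simp add: i(4))
qed

text \<open>The derivative is taken under the frequency integral. The source term of
  \<open>duhamel_symbol\<close> integrates to \<open>conv (conv f)\<close> by
  \<open>conv_conv_eq\<close>, and this is exactly what \<open>conv\<close> makes of the first-order
  term.\<close>

lemma has_real_derivative_semigroup:
  assumes f: "integrable lebesgue f" and B: "\<And>x. \<bar>f x\<bar> \<le> B"
  shows "((\<lambda>t. semigroup t f x) has_real_derivative conv (semigroup t f) x - semigroup t f x) (at t)"
proof -
  define L where "L = (LINT y|lebesgue. \<bar>f y\<bar>)"
  \<comment> \<open>\<open>T\<close> bounds the times within distance \<open>1\<close> of
    \<open>t\<close>. \<open>K\<close> adds the bounds of the two summands of the derivative; its
    factor 2 bounds \<open>\<bar>symbol \<xi> - 1\<bar>\<close>.\<close>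
  define T where "T = \<bar>t\<bar> + 1"
  define K where "K = 2 * (exp (2 * T) * T\<^sup>2) + T * exp T"
  let ?g = "\<lambda>\<xi>. cosine_transform f x \<xi>"
  let ?f' = "\<lambda>s \<xi>. ((symbol \<xi> - 1) * duhamel_symbol s (symbol \<xi>) + s * exp (- s) * (symbol \<xi>)\<^sup>2) * ?g \<xi>"
  have gL: "\<bar>?g \<xi>\<bar> \<le> L" for \<xi> unfolding L_def by (rule cosine_transform_bound[OF f])
  have "((\<lambda>s. LINT \<xi>|lebesgue. duhamel_symbol s (symbol \<xi>) * ?g \<xi>) has_real_derivative (LINT \<xi>|lebesgue. ?f' t \<xi>)) (at t)"
  proof (rule has_real_derivative_integral[where r=1 and w="\<lambda>\<xi>. K * L * (symbol \<xi>)\<^sup>2"])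
    show "integrable lebesgue (\<lambda>\<xi>. duhamel_symbol s (symbol \<xi>) * ?g \<xi>)" for s
      by (rule integrable_mult_cosine_transform[OF f integrable_duhamel])
    show "?f' t \<in> borel_measurable lebesgue"
      by (intro continuous_imp_lebesgue_measurable continuous_intros continuous_on_duhamel continuous_on_symbol
          continuous_on_cosine_transform_snd f)
    show "integrable lebesgue (\<lambda>\<xi>. K * L * (symbol \<xi>)\<^sup>2)" using integrable_symbol_sq by simp
    show "AE \<xi> in lebesgue. \<forall>s. \<bar>s - t\<bar> < 1 \<longrightarrow>
        ((\<lambda>s. duhamel_symbol s (symbol \<xi>) * ?g \<xi>) has_real_derivative ?f' s \<xi>) (at s) \<and> \<bar>?f' s \<xi>\<bar> \<le> K * L * (symbol \<xi>)\<^sup>2"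
    proof (intro AE_I2 allI impI conjI)
      fix \<xi> s assume s: "\<bar>s - t\<bar> < 1"
      show "((\<lambda>s. duhamel_symbol s (symbol \<xi>) * ?g \<xi>) has_real_derivative ?f' s \<xi>) (at s)"
        by (rule DERIV_cmult_right[OF has_real_derivative_duhamel_symbol])
      have sT: "\<bar>s\<bar> \<le> T" using s by (auto simp: T_def)
      have "exp (2 * \<bar>s\<bar>) * \<bar>s\<bar>\<^sup>2 * (symbol \<xi>)\<^sup>2 \<le> exp (2 * T) * T\<^sup>2 * (symbol \<xi>)\<^sup>2"
        using sT by (intro mult_right_mono mult_mono power_mono) auto
      then have d: "\<bar>duhamel_symbol s (symbol \<xi>)\<bar> \<le> exp (2 * T) * T\<^sup>2 * (symbol \<xi>)\<^sup>2"
        using duhamel_bound[of s \<xi>] by simp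
      have "\<bar>(symbol \<xi> - 1) * duhamel_symbol s (symbol \<xi>)\<bar> \<le> 2 * (exp (2 * T) * T\<^sup>2 * (symbol \<xi>)\<^sup>2)"
        unfolding abs_mult using abs_symbol_le[of \<xi>] d by (intro mult_mono) auto
      moreover have "\<bar>s * exp (- s) * (symbol \<xi>)\<^sup>2\<bar> \<le> T * exp T * (symbol \<xi>)\<^sup>2"
        unfolding abs_mult using sT by (intro mult_right_mono mult_mono) (auto simp: abs_mult)
      ultimately have "\<bar>(symbol \<xi> - 1) * duhamel_symbol s (symbol \<xi>) + s * exp (- s) * (symbol \<xi>)\<^sup>2\<bar> \<le> K * (symbol \<xi>)\<^sup>2"
        by (simp add: K_def algebra_simps)
      then have "\<bar>?f' s \<xi>\<bar> \<le> K * (symbol \<xi>)\<^sup>2 * L"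
        unfolding abs_mult using gL by (intro mult_mono) auto
      then show "\<bar>?f' s \<xi>\<bar> \<le> K * L * (symbol \<xi>)\<^sup>2" by (simp add: mult_ac)
    qed
  qed simp
  then have "((\<lambda>t. semigroup t f x) has_real_derivative
      - exp (- t) * f x + (1 - t) * exp (- t) * conv f x + (LINT \<xi>|lebesgue. ?f' t \<xi>) / (2 * pi) ^ DIM('a)) (at t)"
    unfolding semigroup_def by (auto intro!: derivative_eq_intros simp: algebra_simps)
  moreover have "- exp (- t) * f x + (1 - t) * exp (- t) * conv f x + (LINT \<xi>|lebesgue. ?f' t \<xi>) / (2 * pi) ^ DIM('a) =
     conv (semigroup t f) x - semigroup t f x"
  proof -
    have i1: "integrable lebesgue (\<lambda>\<xi>. duhamel_symbol t (symbol \<xi>) * (symbol \<xi> * ?g \<xi>))"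
    proof -
      have "integrable lebesgue (\<lambda>\<xi>. duhamel_symbol t (symbol \<xi>) * symbol \<xi>)"
        by (rule integrable_mult_bounded[OF integrable_duhamel symbol_measurable abs_symbol_le])
      from integrable_mult_cosine_transform[OF f this, of x] show ?thesis by (simp add: mult.assoc)
    qed
    have i2: "integrable lebesgue (\<lambda>\<xi>. duhamel_symbol t (symbol \<xi>) * ?g \<xi>)"
      by (rule integrable_mult_cosine_transform[OF f integrable_duhamel])
    have i3: "integrable lebesgue (\<lambda>\<xi>. (symbol \<xi>)\<^sup>2 * ?g \<xi>)"
      by (rule integrable_mult_cosine_transform[OF f integrable_symbol_sq])
    have "?f' t \<xi> = duhamel_symbol t (symbol \<xi>) * (symbol \<xi> * ?g \<xi>) - duhamel_symbol t (symbol \<xi>) * ?g \<xi> + t * exp (- t) * ((symbol \<xi>)\<^sup>2 * ?g \<xi>)" for \<xi>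
      by (simp add: algebra_simps)
    then have "(LINT \<xi>|lebesgue. ?f' t \<xi>) = (LINT \<xi>|lebesgue. duhamel_symbol t (symbol \<xi>) * (symbol \<xi> * ?g \<xi>))
        - (LINT \<xi>|lebesgue. duhamel_symbol t (symbol \<xi>) * ?g \<xi>) + t * exp (- t) * ((2 * pi) ^ DIM('a) * conv (conv f) x)"
      using i1 i2 i3 conv_conv_eq[OF f B, of x] by simp
    moreover define P where "P = (2 * pi) ^ DIM('a)"
    moreover have "0 < P" by (simp add: P_def)
    ultimately have "(LINT \<xi>|lebesgue. ?f' t \<xi>) / P = (LINT \<xi>|lebesgue. duhamel_symbol t (symbol \<xi>) * (symbol \<xi> * ?g \<xi>)) / P
        - (LINT \<xi>|lebesgue. duhamel_symbol t (symbol \<xi>) * ?g \<xi>) / P + t * exp (- t) * conv (conv f) x"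
      by (simp only: diff_divide_distrib add_divide_distrib) simp
    then show ?thesis
      unfolding conv_semigroup[OF f] semigroup_def[of t f x] P_def[symmetric] by (simp add: algebra_simps)
  qed
  ultimately show ?thesis by simp
qed

text \<open>A crude bound whose purpose is to admit the semigroup to \<open>subsolution\<close>,
  before comparison gives the sharp bounds.\<close>

lemma semigroup_locally_bounded:
  assumes f: "integrable lebesgue f" and B: "\<And>x. \<bar>f x\<bar> \<le> B"
  obtains K where "\<And>t x. 0 \<le> t \<Longrightarrow> t \<le> T \<Longrightarrow> \<bar>semigroup t f x\<bar> \<le> K"
proof -
  define L where "L = (LINT y|lebesgue. \<bar>f y\<bar>)"
  have B0: "0 \<le> B" using B[of undefined] by auto
  define I where "I = (LINT \<xi>|lebesgue. (symbol \<xi>)\<^sup>2)"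
  have fm: "f \<in> borel_measurable lebesgue" using f by auto
  have "\<bar>semigroup t f x\<bar> \<le> B + T * B + exp (2 * T) * T\<^sup>2 * I * L / (2 * pi) ^ DIM('a)" if t: "0 \<le> t" "t \<le> T" for t x
  proof -
    have "\<bar>exp (- t) * f x\<bar> \<le> 1 * B" unfolding abs_mult using B B0 t by (intro mult_mono) auto
    moreover have "\<bar>t * exp (- t) * conv f x\<bar> \<le> (T * 1) * B"
      unfolding abs_mult using conv_bound[OF fm B, of x] B0 t by (intro mult_mono) auto
    moreover have "\<bar>LINT \<xi>|lebesgue. duhamel_symbol t (symbol \<xi>) * cosine_transform f x \<xi>\<bar> \<le> (LINT \<xi>|lebesgue. exp (2 * T) * T\<^sup>2 * L * (symbol \<xi>)\<^sup>2)"
    proof (rule order.trans[OF integral_abs_bound integral_mono])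
      show "\<bar>duhamel_symbol t (symbol \<xi>) * cosine_transform f x \<xi>\<bar> \<le> exp (2 * T) * T\<^sup>2 * L * (symbol \<xi>)\<^sup>2" for \<xi>
      proof -
        have "exp (2 * \<bar>t\<bar>) * t\<^sup>2 * (symbol \<xi>)\<^sup>2 \<le> exp (2 * T) * T\<^sup>2 * (symbol \<xi>)\<^sup>2"
          using t by (intro mult_right_mono mult_mono power_mono) auto
        then have "\<bar>duhamel_symbol t (symbol \<xi>) * cosine_transform f x \<xi>\<bar> \<le> exp (2 * T) * T\<^sup>2 * (symbol \<xi>)\<^sup>2 * L"
          unfolding abs_mult using duhamel_bound[of t \<xi>] cosine_transform_bound[OF f, of x \<xi>]
          by (intro mult_mono) (auto simp: L_def)
        then show ?thesis by (simp add: mult_ac)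
      qed
    qed (use integrable_mult_cosine_transform[OF f integrable_duhamel] integrable_symbol_sq in auto)
    then have "\<bar>(LINT \<xi>|lebesgue. duhamel_symbol t (symbol \<xi>) * cosine_transform f x \<xi>) / (2 * pi) ^ DIM('a)\<bar> \<le> exp (2 * T) * T\<^sup>2 * I * L / (2 * pi) ^ DIM('a)"
      by (simp add: I_def abs_divide divide_right_mono mult_ac)
    ultimately show ?thesis unfolding semigroup_def by linarith
  qed
  then show ?thesis using that by blast
qed

text \<open>One \<open>C\<close> serves all data. This matters because the function to be smoothed
  later is the deficit at the start of a window that moves with \<open>t\<close>.\<close>

lemma semigroup_decay:
  obtains C where "0 < C" "\<And>f B t x. integrable lebesgue f \<Longrightarrow> (\<And>x. \<bar>f x\<bar> \<le> B) \<Longrightarrow> 0 < t \<Longrightarrow>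
     \<bar>semigroup t f x\<bar> \<le> (1 + t) * exp (- t) * B + C * t powr (- (real DIM('a) / 2)) * (LINT y|lebesgue. \<bar>f y\<bar>)"
proof -
  obtain C where C: "0 < C" "\<And>t. 0 < t \<Longrightarrow> (LINT \<xi>|lebesgue. \<bar>duhamel_symbol t (symbol \<xi>)\<bar>) \<le> C * t powr (- (real DIM('a) / 2))"
    by (rule integral_duhamel_decay) blast
  have "\<bar>semigroup t f x\<bar> \<le> (1 + t) * exp (- t) * B + C / (2 * pi) ^ DIM('a) * t powr (- (real DIM('a) / 2)) * (LINT y|lebesgue. \<bar>f y\<bar>)"
    if f: "integrable lebesgue f" and B: "\<And>x. \<bar>f x\<bar> \<le> B" and t: "0 < t" for f B t x
  proof -
    define L where "L = (LINT y|lebesgue. \<bar>f y\<bar>)"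
    have L0: "0 \<le> L" by (simp add: L_def)
    have fm: "f \<in> borel_measurable lebesgue" using f by auto
    have "\<bar>exp (- t) * f x\<bar> \<le> exp (- t) * B" unfolding abs_mult using B by (intro mult_mono) auto
    moreover have "\<bar>t * exp (- t) * conv f x\<bar> \<le> t * exp (- t) * B"
      unfolding abs_mult using conv_bound[OF fm B, of x] t by (intro mult_mono) auto
    moreover have "\<bar>LINT \<xi>|lebesgue. duhamel_symbol t (symbol \<xi>) * cosine_transform f x \<xi>\<bar> \<le> (LINT \<xi>|lebesgue. \<bar>duhamel_symbol t (symbol \<xi>)\<bar> * L)"
    proof (rule order.trans[OF integral_abs_bound integral_mono])
      show "\<bar>duhamel_symbol t (symbol \<xi>) * cosine_transform f x \<xi>\<bar> \<le> \<bar>duhamel_symbol t (symbol \<xi>)\<bar> * L" for \<xi>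
        unfolding abs_mult using cosine_transform_bound[OF f, of x \<xi>] by (intro mult_left_mono) (auto simp: L_def)
    qed (use integrable_mult_cosine_transform[OF f integrable_duhamel] integrable_duhamel in auto)
    then have "\<bar>LINT \<xi>|lebesgue. duhamel_symbol t (symbol \<xi>) * cosine_transform f x \<xi>\<bar> \<le> C * t powr (- (real DIM('a) / 2)) * L"
      using mult_right_mono[OF C(2)[OF t] L0] by simp
    then have "\<bar>(LINT \<xi>|lebesgue. duhamel_symbol t (symbol \<xi>) * cosine_transform f x \<xi>) / (2 * pi) ^ DIM('a)\<bar> \<le> C / (2 * pi) ^ DIM('a) * t powr (- (real DIM('a) / 2)) * L"
      by (simp add: abs_divide divide_right_mono)
    moreover have "(1 + t) * exp (- t) * B = exp (- t) * B + t * exp (- t) * B" by (simp add: algebra_simps)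
    ultimately show ?thesis unfolding semigroup_def L_def[symmetric] by linarith
  qed
  then show ?thesis using that[of "C / (2 * pi) ^ DIM('a)"] C(1) by simp
qed

end

section \<open>Asymptotics and comparison for the semigroup\<close>

lemma abs_cos_diff_le: "\<bar>cos a - cos b\<bar> \<le> min 2 \<bar>a - b :: real\<bar>"
proof -
  have "\<bar>cos a - cos b\<bar> = 2 * (\<bar>sin ((a + b) / 2)\<bar> * \<bar>sin ((b - a) / 2)\<bar>)"
    by (simp add: cos_diff_cos abs_mult)
  also have "\<dots> \<le> 2 * (1 * \<bar>(b - a) / 2\<bar>)"
    by (intro mult_left_mono mult_mono abs_sin_x_le_abs_x) auto
  finally have "\<bar>cos a - cos b\<bar> \<le> \<bar>a - b\<bar>" by simp
  moreover have "\<bar>cos a - cos b\<bar> \<le> 2"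
    using abs_cos_le_one[of a] abs_cos_le_one[of b] by linarith
  ultimately show ?thesis by simp
qed

text \<open>Replacing \<open>f\<close> by a point mass at the origin costs a modulus that is uniform
  in \<open>x\<close>. The minimum with 2 keeps this modulus finite and continuous without a first
  moment of \<open>f\<close>.\<close>

lemma cosine_transform_low_frequency:
  fixes f :: "'a::euclidean_space \<Rightarrow> real"
  assumes f: "integrable lebesgue f"
  obtains \<omega> :: "'a \<Rightarrow> real" where "continuous_on UNIV \<omega>" "\<omega> 0 = 0" "\<And>\<xi>. 0 \<le> \<omega> \<xi>"
    "\<And>\<xi>. \<omega> \<xi> \<le> 2 * (LINT y|lebesgue. \<bar>f y\<bar>)"
    "\<And>x \<xi>. \<bar>cosine_transform f x \<xi> - (LINT y|lebesgue. f y) * cos (x \<bullet> \<xi>)\<bar> \<le> \<omega> \<xi>"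
proof -
  define \<omega> where "\<omega> \<xi> = (LINT y|lebesgue. \<bar>f y\<bar> * min 2 (norm y * norm \<xi>))" for \<xi> :: 'a
  have fa: "integrable lebesgue (\<lambda>y. \<bar>f y\<bar>)" using f by simp
  have i: "integrable lebesgue (\<lambda>y. \<bar>f y\<bar> * min 2 (norm y * norm \<xi>))" for \<xi> :: 'a
    by (rule integrable_mult_bounded[OF fa, where K=2])
      (auto intro!: continuous_imp_lebesgue_measurable continuous_intros)
  have "continuous_on UNIV \<omega>"
    unfolding \<omega>_def continuous_on_sequentially
  proof (intro allI ballI impI, unfold comp_def, elim conjE)
    fix X :: "nat \<Rightarrow> 'a" and \<xi> assume X: "X \<longlonglongrightarrow> \<xi>"
    show "(\<lambda>n. LINT y|lebesgue. \<bar>f y\<bar> * min 2 (norm y * norm (X n))) \<longlonglongrightarrow> (LINT y|lebesgue. \<bar>f y\<bar> * min 2 (norm y * norm \<xi>))"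
    proof (rule integral_dominated_convergence[where w="\<lambda>y. \<bar>f y\<bar> * 2"])
      show "AE y in lebesgue. (\<lambda>n. \<bar>f y\<bar> * min 2 (norm y * norm (X n))) \<longlonglongrightarrow> \<bar>f y\<bar> * min 2 (norm y * norm \<xi>)"
        using X by (intro AE_I2 tendsto_intros)
      show "AE y in lebesgue. norm (\<bar>f y\<bar> * min 2 (norm y * norm (X n))) \<le> \<bar>f y\<bar> * 2" for n
        by (intro AE_I2) (simp add: abs_mult mult_left_mono)
    qed (use i fa in auto)
  qed
  moreover have "\<omega> 0 = 0" by (simp add: \<omega>_def)
  moreover have "0 \<le> \<omega> \<xi>" for \<xi> by (simp add: \<omega>_def)
  moreover have "\<omega> \<xi> \<le> 2 * (LINT y|lebesgue. \<bar>f y\<bar>)" for \<xi>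
  proof -
    have "\<omega> \<xi> \<le> (LINT y|lebesgue. \<bar>f y\<bar> * 2)" unfolding \<omega>_def
      by (rule integral_mono) (use i fa in \<open>auto intro: mult_left_mono\<close>)
    then show ?thesis by simp
  qed
  moreover have "\<bar>cosine_transform f x \<xi> - (LINT y|lebesgue. f y) * cos (x \<bullet> \<xi>)\<bar> \<le> \<omega> \<xi>" for x \<xi>
  proof -
    have ii: "integrable lebesgue (\<lambda>y. f y * (cos ((x - y) \<bullet> \<xi>) - cos (x \<bullet> \<xi>)))"
      unfolding right_diff_distrib using f integrable_mult_cos[OF f, of x \<xi>] by simp
    have "cosine_transform f x \<xi> - (LINT y|lebesgue. f y) * cos (x \<bullet> \<xi>) = (LINT y|lebesgue. f y * (cos ((x - y) \<bullet> \<xi>) - cos (x \<bullet> \<xi>)))"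
      unfolding cosine_transform_def right_diff_distrib using f integrable_mult_cos[OF f, of x \<xi>] by simp
    also have "\<bar>\<dots>\<bar> \<le> \<omega> \<xi>"
      unfolding \<omega>_def
    proof (rule order.trans[OF integral_abs_bound integral_mono])
      fix y
      have "\<bar>cos ((x - y) \<bullet> \<xi>) - cos (x \<bullet> \<xi>)\<bar> \<le> min 2 \<bar>y \<bullet> \<xi>\<bar>"
        using abs_cos_diff_le[of "(x - y) \<bullet> \<xi>" "x \<bullet> \<xi>"] by (simp add: inner_diff_left)
      also have "\<dots> \<le> min 2 (norm y * norm \<xi>)"
        using Cauchy_Schwarz_ineq2[of y \<xi>] by (intro min.mono) auto
      finally show "\<bar>f y * (cos ((x - y) \<bullet> \<xi>) - cos (x \<bullet> \<xi>))\<bar> \<le> \<bar>f y\<bar> * min 2 (norm y * norm \<xi>)"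
        unfolding abs_mult by (rule mult_left_mono) simp
    qed (use i ii in auto)
    finally show ?thesis .
  qed
  ultimately show ?thesis using that by blast
qed

lemma AE_not_in_negligible: "negligible Z \<Longrightarrow> AE x in lebesgue. x \<notin> Z"
  by (simp add: negligible_iff_null_sets AE_not_in)

lemma has_real_derivative_power_over_fact:
  "((\<lambda>s::real. s ^ Suc n / fact (Suc n)) has_real_derivative s ^ n / fact n) (at s)"
proof -
  have "((\<lambda>s::real. s ^ Suc n / fact (Suc n)) has_real_derivative (real (Suc n) * s ^ n) / fact (Suc n)) (at s)"
    by (rule DERIV_cdivide) (use DERIV_pow[of "Suc n" s] in simp)
  then show ?thesis by (simp add: fact_Suc del: of_nat_Suc power_Suc)
qed

lemma has_real_derivative_exp_partial_sum:
  fixes c :: "nat \<Rightarrow> real"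
  shows "((\<lambda>s. \<Sum>k<Suc n. s ^ k / fact k * c k) has_real_derivative (\<Sum>k<n. s ^ k / fact k * c (Suc k))) (at s)"
proof (induction n)
  case (Suc n)
  have "((\<lambda>s. s ^ Suc n / fact (Suc n) * c (Suc n)) has_real_derivative s ^ n / fact n * c (Suc n)) (at s)"
    by (rule DERIV_cmult_right[OF has_real_derivative_power_over_fact])
  from DERIV_add[OF Suc.IH this] show ?case by simp
qed simp

lemma power_over_fact_tendsto_0: "(\<lambda>n. t ^ n / fact n :: real) \<longlonglongrightarrow> 0"
  using summable_LIMSEQ_zero[OF summable_exp[of t]] by (simp add: divide_inverse mult.commute)

section \<open>Large-time profile of the semigroup\<close>

context dispersal_kernel begin

text \<open>The difference of the two multipliers is bounded free of \<open>x\<close>, and the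
  substitution \<open>\<xi> = \<eta> / sqrt t\<close> turns the factor \<open>t powr (N / 2)\<close>
  into a Jacobian. After it the Gaussians no longer depend on \<open>t\<close>, so dominated
  convergence applies.\<close>

lemma semigroup_asymptotics:
  assumes f: "integrable lebesgue f" and B: "\<And>x. \<bar>f x\<bar> \<le> B" and \<epsilon>: "0 < \<epsilon>"
  shows "\<forall>\<^sub>F t in at_top. \<forall>x. t powr (real DIM('a) / 2) *
    \<bar>semigroup t f x - (LINT y|lebesgue. f y) * gauss (2 * \<a> * t) x\<bar> < \<epsilon>"
proof -
  define m where "m = (LINT y|lebesgue. f y)"
  define L where "L = (LINT y|lebesgue. \<bar>f y\<bar>)"
  define I where "I = (LINT \<xi>|lebesgue. (symbol \<xi>)\<^sup>2)"
  define q where "q = real DIM('a) / 2"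
  define P where "P = (2 * pi) ^ DIM('a)"
  have P: "0 < P" by (simp add: P_def)
  have L: "0 \<le> L" by (simp add: L_def)
  have fm: "f \<in> borel_measurable lebesgue" using f by auto
  obtain \<omega> where \<omega>: "continuous_on UNIV \<omega>" "\<omega> 0 = 0" "\<And>\<xi>. 0 \<le> \<omega> \<xi>" "\<And>\<xi>. \<omega> \<xi> \<le> 2 * L"
    "\<And>x \<xi>. \<bar>cosine_transform f x \<xi> - m * cos (x \<bullet> \<xi>)\<bar> \<le> \<omega> \<xi>"
    using cosine_transform_low_frequency[OF f] unfolding m_def L_def by blast
  obtain k where k: "0 < k" "\<And>t \<xi>. 0 \<le> t \<Longrightarrow>
    \<bar>duhamel_symbol t (symbol \<xi>)\<bar> \<le> exp (- (k * t * (norm \<xi>)\<^sup>2)) + t\<^sup>2 * exp (- (t / 2)) * (symbol \<xi>)\<^sup>2"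
    by (rule duhamel_decay) blast
  define g where "g t \<xi> = exp (- (\<a> * t * (norm \<xi>)\<^sup>2))" for t and \<xi> :: 'a
  \<comment> \<open>The exponentially small part of \<open>duhamel_decay\<close> is subtracted
    inside: rescaled, it has no integrable majorant independent of \<open>t\<close>, and it is
    integrated separately before rescaling.\<close>
  define H where "H t \<xi> = L * max 0 (\<bar>duhamel_symbol t (symbol \<xi>) - g t \<xi>\<bar> - t\<^sup>2 * exp (- (t / 2)) * (symbol \<xi>)\<^sup>2) + g t \<xi> * \<omega> \<xi>" for t \<xi>
  have H0: "0 \<le> H t \<xi>" for t \<xi> using L \<omega>(3) by (simp add: H_def g_def)
  have Hm: "continuous_on UNIV (H t)" for t
    unfolding H_def g_def by (intro continuous_intros continuous_on_duhamel continuous_on_symbol \<omega>)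
  have Hb: "H t \<xi> \<le> L * exp (- (k * t * (norm \<xi>)\<^sup>2)) + 3 * L * g t \<xi>" if "0 < t" for t \<xi>
  proof -
    have "\<bar>duhamel_symbol t (symbol \<xi>) - g t \<xi>\<bar> - t\<^sup>2 * exp (- (t / 2)) * (symbol \<xi>)\<^sup>2 \<le> exp (- (k * t * (norm \<xi>)\<^sup>2)) + g t \<xi>"
    proof -
      have "\<bar>g t \<xi>\<bar> = g t \<xi>" by (simp add: g_def)
      then show ?thesis using k(2)[of t \<xi>] that by linarith
    qed
    then have "L * max 0 (\<bar>duhamel_symbol t (symbol \<xi>) - g t \<xi>\<bar> - t\<^sup>2 * exp (- (t / 2)) * (symbol \<xi>)\<^sup>2) \<le> L * (exp (- (k * t * (norm \<xi>)\<^sup>2)) + g t \<xi>)"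
      by (intro mult_left_mono L max.boundedI) (simp_all add: g_def add_nonneg_nonneg)
    moreover have "g t \<xi> * \<omega> \<xi> \<le> g t \<xi> * (2 * L)" using \<omega>(4) by (intro mult_left_mono) (auto simp: g_def)
    ultimately show ?thesis unfolding H_def by (simp add: algebra_simps)
  qed
  have gi: "integrable lebesgue (g t)" if "0 < t" for t
    using integral_exp_norm_sq[of "\<a> * t"] a_pos that by (simp add: g_def[abs_def] has_bochner_integral_iff)
  have Wi: "integrable lebesgue (\<lambda>\<xi>::'a. L * exp (- (k * t * (norm \<xi>)\<^sup>2)) + 3 * L * g t \<xi>)" if "0 < t" for t
    using integral_exp_norm_sq[of "k * t"] k(1) that gi[OF that] by (simp add: has_bochner_integral_iff)
  have Hi: "integrable lebesgue (H t)" if "0 < t" for t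
    by (rule Bochner_Integration.integrable_bound[OF Wi[OF that] continuous_imp_lebesgue_measurable[OF Hm]])
      (use Hb[OF that] H0 in \<open>auto intro!: AE_I2 order.trans[OF _ abs_ge_self]\<close>)
  have point: "\<bar>semigroup t f x - m * gauss (2 * \<a> * t) x\<bar> \<le>
     (1 + t) * exp (- t) * B + (integral\<^sup>L lebesgue (H t) + L * I * (t\<^sup>2 * exp (- (t / 2)))) / P" if t: "0 < t" for t x
  proof -
    have gf: "has_bochner_integral lebesgue (\<lambda>\<xi>. g t \<xi> * cos (x \<bullet> \<xi>)) (P * gauss (2 * \<a> * t) x)"
      using gauss_fourier[of "2 * \<a> * t" x] a_pos t by (simp add: g_def P_def mult.assoc)
    have i1: "integrable lebesgue (\<lambda>\<xi>. duhamel_symbol t (symbol \<xi>) * cosine_transform f x \<xi>)"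
      by (rule integrable_mult_cosine_transform[OF f integrable_duhamel])
    have i2: "integrable lebesgue (\<lambda>\<xi>. m * (g t \<xi> * cos (x \<bullet> \<xi>)))" using gf by (simp add: has_bochner_integral_iff)
    have "\<bar>(LINT \<xi>|lebesgue. duhamel_symbol t (symbol \<xi>) * cosine_transform f x \<xi>) - P * (m * gauss (2 * \<a> * t) x)\<bar> =
       \<bar>LINT \<xi>|lebesgue. duhamel_symbol t (symbol \<xi>) * cosine_transform f x \<xi> - m * (g t \<xi> * cos (x \<bullet> \<xi>))\<bar>"
      using i1 i2 gf by (simp add: has_bochner_integral_iff mult.left_commute)
    also have "\<dots> \<le> (LINT \<xi>|lebesgue. H t \<xi> + L * (t\<^sup>2 * exp (- (t / 2))) * (symbol \<xi>)\<^sup>2)"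
    proof (rule order.trans[OF integral_abs_bound integral_mono])
      fix \<xi>
      let ?E = "duhamel_symbol t (symbol \<xi>)"
      let ?r = "t\<^sup>2 * exp (- (t / 2)) * (symbol \<xi>)\<^sup>2"
      have "?E * cosine_transform f x \<xi> - m * (g t \<xi> * cos (x \<bullet> \<xi>)) =
        (?E - g t \<xi>) * cosine_transform f x \<xi> + g t \<xi> * (cosine_transform f x \<xi> - m * cos (x \<bullet> \<xi>))" by (simp add: algebra_simps)
      also have "\<bar>\<dots>\<bar> \<le> \<bar>(?E - g t \<xi>) * cosine_transform f x \<xi>\<bar> + \<bar>g t \<xi> * (cosine_transform f x \<xi> - m * cos (x \<bullet> \<xi>))\<bar>"
        by (rule abs_triangle_ineq)
      also have "\<bar>(?E - g t \<xi>) * cosine_transform f x \<xi>\<bar> \<le> (max 0 (\<bar>?E - g t \<xi>\<bar> - ?r) + ?r) * L"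
        unfolding abs_mult using cosine_transform_bound[OF f, of x \<xi>] by (intro mult_mono) (auto simp: L_def)
      also have "\<bar>g t \<xi> * (cosine_transform f x \<xi> - m * cos (x \<bullet> \<xi>))\<bar> \<le> g t \<xi> * \<omega> \<xi>"
        unfolding abs_mult using \<omega>(5) by (intro mult_mono) (auto simp: g_def)
      finally show "\<bar>?E * cosine_transform f x \<xi> - m * (g t \<xi> * cos (x \<bullet> \<xi>))\<bar> \<le> H t \<xi> + L * (t\<^sup>2 * exp (- (t / 2))) * (symbol \<xi>)\<^sup>2"
        unfolding H_def by (simp add: algebra_simps)
    qed (use i1 i2 Hi[OF t] integrable_symbol_sq in auto)
    also have "\<dots> = integral\<^sup>L lebesgue (H t) + L * I * (t\<^sup>2 * exp (- (t / 2)))"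
      using Hi[OF t] integrable_symbol_sq by (simp add: I_def mult_ac)
    finally have a: "\<bar>(LINT \<xi>|lebesgue. duhamel_symbol t (symbol \<xi>) * cosine_transform f x \<xi>) - P * (m * gauss (2 * \<a> * t) x)\<bar> \<le>
       integral\<^sup>L lebesgue (H t) + L * I * (t\<^sup>2 * exp (- (t / 2)))" .
    have 1: "\<bar>(LINT \<xi>|lebesgue. duhamel_symbol t (symbol \<xi>) * cosine_transform f x \<xi>) / P - m * gauss (2 * \<a> * t) x\<bar> \<le>
       (integral\<^sup>L lebesgue (H t) + L * I * (t\<^sup>2 * exp (- (t / 2)))) / P" (is "\<bar>?l / P - ?r\<bar> \<le> _")
    proof -
      have "?l / P - ?r = (?l - P * ?r) / P" using P by (simp add: diff_divide_distrib)
      then have "\<bar>?l / P - ?r\<bar> = \<bar>?l - P * ?r\<bar> / P" using P by (simp add: abs_divide)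
      then show ?thesis using a P by (simp add: divide_right_mono)
    qed
    have "\<bar>exp (- t) * f x\<bar> \<le> exp (- t) * B" unfolding abs_mult using B by (intro mult_mono) auto
    moreover have "\<bar>t * exp (- t) * conv f x\<bar> \<le> t * exp (- t) * B"
      unfolding abs_mult using conv_bound[OF fm B, of x] t by (intro mult_mono) auto
    moreover have "(1 + t) * exp (- t) * B = exp (- t) * B + t * exp (- t) * B" by (simp add: algebra_simps)
    ultimately show ?thesis using 1 unfolding semigroup_def P_def[symmetric] by linarith
  qed
  have scale: "t powr q * integral\<^sup>L lebesgue (H t) = (LINT \<eta>|lebesgue. H t ((1 / sqrt t) *\<^sub>R \<eta>))" if t: "0 < t" for t
  proof -
    have "has_bochner_integral lebesgue (\<lambda>\<eta>. H t (0 + (1 / sqrt t) *\<^sub>R \<eta>)) (integral\<^sup>L lebesgue (H t) / \<bar>1 / sqrt t\<bar> ^ DIM('a))"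
      by (rule has_bochner_integral_affine) (use t Hi[OF t] in \<open>auto simp: has_bochner_integral_iff\<close>)
    moreover have "sqrt t ^ DIM('a) = t powr q"
      using t by (simp add: q_def powr_half_sqrt[symmetric] powr_powr powr_realpow[symmetric] del: powr_half_sqrt)
    then have "integral\<^sup>L lebesgue (H t) / \<bar>1 / sqrt t\<bar> ^ DIM('a) = t powr q * integral\<^sup>L lebesgue (H t)"
      using t by (simp add: power_divide)
    ultimately show ?thesis by (simp add: has_bochner_integral_iff)
  qed
  have lim: "((\<lambda>t. LINT \<eta>|lebesgue. H t ((1 / sqrt t) *\<^sub>R \<eta>)) \<longlongrightarrow> (LINT (\<eta>::'a)|lebesgue. 0)) at_top"
  proof (rule integral_dominated_convergence_at_top[where w="\<lambda>\<eta>. L * exp (- (k * 1 * (norm \<eta>)\<^sup>2)) + 3 * L * g 1 \<eta>"])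
    show "integrable lebesgue (\<lambda>\<eta>::'a. L * exp (- (k * 1 * (norm \<eta>)\<^sup>2)) + 3 * L * g 1 \<eta>)" by (rule Wi) simp
    show "(\<lambda>\<eta>. H t ((1 / sqrt t) *\<^sub>R \<eta>)) \<in> borel_measurable lebesgue" for t
      by (intro continuous_imp_lebesgue_measurable continuous_on_compose2[OF Hm] continuous_intros) auto
    show "\<forall>\<^sub>F t in at_top. AE \<eta> in lebesgue. norm (H t ((1 / sqrt t) *\<^sub>R \<eta>)) \<le> L * exp (- (k * 1 * (norm \<eta>)\<^sup>2)) + 3 * L * g 1 \<eta>"
      using eventually_gt_at_top[of 0]
    proof eventually_elim
      case (elim t)
      have "t * (norm ((1 / sqrt t) *\<^sub>R \<eta>))\<^sup>2 = (norm \<eta>)\<^sup>2" for \<eta> :: 'a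
        using elim by (simp add: power_mult_distrib power_divide)
      then have "k * t * (norm ((1 / sqrt t) *\<^sub>R \<eta>))\<^sup>2 = k * 1 * (norm \<eta>)\<^sup>2" "g t ((1 / sqrt t) *\<^sub>R \<eta>) = g 1 \<eta>" for \<eta> :: 'a
        unfolding g_def by (simp_all only: mult.assoc mult_1_left)
      then show ?case using Hb[OF elim] H0 by (intro AE_I2) (metis abs_of_nonneg real_norm_def)
    qed
    show "AE \<eta> in lebesgue. ((\<lambda>t. H t ((1 / sqrt t) *\<^sub>R \<eta>)) \<longlongrightarrow> 0) at_top"
    proof (intro AE_I2)
      fix \<eta> :: 'a
      let ?s = "\<lambda>t. symbol ((1 / sqrt t) *\<^sub>R \<eta>)"
      have e1: "\<forall>\<^sub>F t in at_top. g t ((1 / sqrt t) *\<^sub>R \<eta>) = g 1 \<eta>"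
        using eventually_gt_at_top[of 0] by eventually_elim (simp add: g_def power_divide)
      have D: "((\<lambda>t. duhamel_symbol t (?s t)) \<longlongrightarrow> g 1 \<eta>) at_top"
      proof -
        have "((\<lambda>t. exp (- (t * (1 - ?s t)))) \<longlongrightarrow> exp (- (\<a> * (norm \<eta>)\<^sup>2))) at_top"
          by (intro tendsto_intros symbol_second_order)
        moreover have "((\<lambda>t. exp (- t) * (1 + t * ?s t)) \<longlongrightarrow> 0) at_top"
        proof (rule Lim_null_comparison)
          show "\<forall>\<^sub>F t in at_top. norm (exp (- t) * (1 + t * ?s t)) \<le> exp (- t) * (1 + t)"
            using eventually_gt_at_top[of 0]
          proof eventually_elim
            case (elim t)
            have "\<bar>t * ?s t\<bar> \<le> t" using abs_symbol_le elim by (simp add: abs_mult mult_left_le)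
            then have "\<bar>1 + t * ?s t\<bar> \<le> 1 + t" by linarith
            then show ?case by (simp add: abs_mult)
          qed
          show "((\<lambda>t::real. exp (- t) * (1 + t)) \<longlongrightarrow> 0) at_top" by real_asymp
        qed
        ultimately have "((\<lambda>t. exp (- (t * (1 - ?s t))) - exp (- t) * (1 + t * ?s t)) \<longlongrightarrow> exp (- (\<a> * (norm \<eta>)\<^sup>2)) - 0) at_top"
          by (rule tendsto_diff)
        moreover have "exp (- (t * (1 - y))) - exp (- t) * (1 + t * y) = duhamel_symbol t y" for t y :: real
        proof -
          have "exp (- (t * (1 - y))) = exp (- t) * exp (t * y)" by (simp add: exp_add[symmetric] algebra_simps)
          then show ?thesis by (simp add: duhamel_symbol_def algebra_simps)
        qed
        ultimately show ?thesis by (simp add: g_def)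
      qed
      have z: "((\<lambda>t. (1 / sqrt t) *\<^sub>R \<eta>) \<longlongrightarrow> 0) at_top"
      proof -
        have "((\<lambda>t. 1 / sqrt t) \<longlongrightarrow> 0) at_top" by real_asymp
        from tendsto_scaleR[OF this tendsto_const, of \<eta>] show ?thesis by simp
      qed
      have W: "((\<lambda>t. \<omega> ((1 / sqrt t) *\<^sub>R \<eta>)) \<longlongrightarrow> 0) at_top"
        using continuous_on_tendsto_compose[OF \<omega>(1) z] \<omega>(2) by simp
      have "((\<lambda>t. L * \<bar>duhamel_symbol t (?s t) - g 1 \<eta>\<bar> + g 1 \<eta> * \<omega> ((1 / sqrt t) *\<^sub>R \<eta>)) \<longlongrightarrow> L * \<bar>g 1 \<eta> - g 1 \<eta>\<bar> + g 1 \<eta> * 0) at_top"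
        by (intro tendsto_intros D W)
      then have up: "((\<lambda>t. L * \<bar>duhamel_symbol t (?s t) - g 1 \<eta>\<bar> + g 1 \<eta> * \<omega> ((1 / sqrt t) *\<^sub>R \<eta>)) \<longlongrightarrow> 0) at_top" by simp
      show "((\<lambda>t. H t ((1 / sqrt t) *\<^sub>R \<eta>)) \<longlongrightarrow> 0) at_top"
      proof (rule Lim_null_comparison[OF _ up])
        show "\<forall>\<^sub>F t in at_top. norm (H t ((1 / sqrt t) *\<^sub>R \<eta>)) \<le> L * \<bar>duhamel_symbol t (?s t) - g 1 \<eta>\<bar> + g 1 \<eta> * \<omega> ((1 / sqrt t) *\<^sub>R \<eta>)"
          using e1
        proof eventually_elim
          case (elim t)
          have "H t ((1 / sqrt t) *\<^sub>R \<eta>) \<le> L * \<bar>duhamel_symbol t (?s t) - g 1 \<eta>\<bar> + g 1 \<eta> * \<omega> ((1 / sqrt t) *\<^sub>R \<eta>)"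
            unfolding H_def elim by (intro add_right_mono mult_left_mono L) auto
          then show ?case using H0 by simp
        qed
      qed
    qed
  qed simp
  let ?R = "\<lambda>t. B * (t powr q * ((1 + t) * exp (- t))) + ((LINT \<eta>|lebesgue. H t ((1 / sqrt t) *\<^sub>R \<eta>)) + L * I * (t powr q * (t\<^sup>2 * exp (- (t / 2))))) / P"
  have "(?R \<longlongrightarrow> B * 0 + (0 + L * I * 0) / P) at_top"
  proof (intro tendsto_intros)
    show "((\<lambda>t::real. t powr q * ((1 + t) * exp (- t))) \<longlongrightarrow> 0) at_top" by real_asymp
    show "((\<lambda>t::real. t powr q * (t\<^sup>2 * exp (- (t / 2)))) \<longlongrightarrow> 0) at_top" by real_asymp
    show "((\<lambda>t. LINT \<eta>|lebesgue. H t ((1 / sqrt t) *\<^sub>R \<eta>)) \<longlongrightarrow> 0) at_top" using lim by simp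
  qed (use P in simp)
  then have "\<forall>\<^sub>F t in at_top. ?R t < \<epsilon>" using \<epsilon> by (intro order_tendstoD) auto
  then show ?thesis
    using eventually_gt_at_top[of 0]
  proof eventually_elim
    case (elim t)
    show ?case
    proof
      fix x
      have "t powr q * \<bar>semigroup t f x - m * gauss (2 * \<a> * t) x\<bar> \<le> t powr q * ((1 + t) * exp (- t) * B + (integral\<^sup>L lebesgue (H t) + L * I * (t\<^sup>2 * exp (- (t / 2)))) / P)"
        by (intro mult_left_mono point elim) simp
      also have "\<dots> = ?R t" unfolding scale[OF elim(2), symmetric] by (simp add: algebra_simps add_divide_distrib)
      finally show "t powr (real DIM('a) / 2) * \<bar>semigroup t f x - (LINT y|lebesgue. f y) * gauss (2 * \<a> * t) x\<bar> < \<epsilon>"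
        using elim(1) by (simp add: q_def m_def)
    qed
  qed
qed

section \<open>Comparison and mass estimate\<close>

text \<open>One exceptional set serves all times, so the inequality can be integrated in time at a
  fixed point. Continuity on the closed interval ties the initial values to the inequality in the
  open one, and boundedness gives a meaning to \<open>conv (z t)\<close>.\<close>

definition subsolution :: "'a set \<Rightarrow> real \<Rightarrow> (real \<Rightarrow> 'a \<Rightarrow> real) \<Rightarrow> bool" where
  "subsolution Z T z \<longleftrightarrow>
     (\<forall>t\<in>{0..T}. z t \<in> borel_measurable lebesgue) \<and> (\<exists>K. \<forall>t\<in>{0..T}. \<forall>x. \<bar>z t x\<bar> \<le> K) \<and>
     (\<forall>x. x \<notin> Z \<longrightarrow> continuous_on {0..T} (\<lambda>t. z t x)) \<and>
     (\<forall>x. x \<notin> Z \<longrightarrow> (\<forall>t\<in>{0<..<T}. \<exists>d. ((\<lambda>t. z t x) has_real_derivative d) (at t) \<and> d \<le> conv (z t) x - z t x))"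

lemma conv_power:
  assumes f: "f \<in> borel_measurable lebesgue" and F: "\<And>x. \<bar>f x\<bar> \<le> F"
  shows "(conv ^^ k) f \<in> borel_measurable lebesgue" "\<bar>(conv ^^ k) f x\<bar> \<le> F"
proof -
  have "(conv ^^ k) f \<in> borel_measurable lebesgue \<and> (\<forall>x. \<bar>(conv ^^ k) f x\<bar> \<le> F)"
    using f F by (induction k) (auto intro: conv_measurable conv_bound)
  then show "(conv ^^ k) f \<in> borel_measurable lebesgue" "\<bar>(conv ^^ k) f x\<bar> \<le> F" by auto
qed

text \<open>Comparing \<open>exp t * z t\<close> with the iterates of the Picard scheme for \<open>y' = conv y\<close> gives both the
  maximum principle and, by summing the series, the mass estimate.\<close>

lemma subsolution_picard:
  assumes z: "subsolution Z T z" and Z: "negligible Z"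
    and f: "f \<in> borel_measurable lebesgue" "\<And>x. \<bar>f x\<bar> \<le> F" and init: "\<And>x. x \<notin> Z \<Longrightarrow> z 0 x \<le> f x"
  obtains M where "\<And>n x t. x \<notin> Z \<Longrightarrow> 0 \<le> t \<Longrightarrow> t \<le> T \<Longrightarrow>
    exp t * z t x \<le> (\<Sum>k<n. t ^ k / fact k * (conv ^^ k) f x) + M * (t ^ n / fact n)"
proof -
  obtain K where K: "\<And>t x. 0 \<le> t \<Longrightarrow> t \<le> T \<Longrightarrow> \<bar>z t x\<bar> \<le> K"
  proof -
    obtain K where "\<forall>t\<in>{0..T}. \<forall>x. \<bar>z t x\<bar> \<le> K" using z unfolding subsolution_def by blast
    then show ?thesis by (intro that[of K]) auto
  qed
  have zm: "z t \<in> borel_measurable lebesgue" if "0 \<le> t" "t \<le> T" for t using z that unfolding subsolution_def by auto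
  define M where "M = exp T * K"
  have "exp t * z t x \<le> (\<Sum>k<n. t ^ k / fact k * (conv ^^ k) f x) + M * (t ^ n / fact n)"
    if "x \<notin> Z" "0 \<le> t" "t \<le> T" for n x t
    using that
  proof (induction n arbitrary: x t)
    case 0
    have "0 \<le> K" using K[OF 0(2,3), of x] by auto
    have "exp t * z t x \<le> exp t * K" using K[OF 0(2,3), of x] by (intro mult_left_mono) auto
    also have "\<dots> \<le> exp T * K" using 0(3) \<open>0 \<le> K\<close> by (intro mult_right_mono) auto
    finally show ?case by (simp add: M_def)
  next
    case (Suc n)
    \<comment> \<open>The gap in the bound of order \<open>Suc n\<close>. As the factor
      \<open>exp s\<close> removes the term \<open>- z\<close>, its derivative is at least
      \<open>conv\<close> of the gap of order \<open>n\<close>, which is nonnegative almost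
      everywhere by induction.\<close>
    define h where "h s = (\<Sum>k<Suc n. s ^ k / fact k * (conv ^^ k) f x) + M * (s ^ Suc n / fact (Suc n)) - exp s * z s x" for s
    have "h 0 \<le> h t"
    proof (rule DERIV_nonneg_imp_increasing_open[OF Suc.prems(2)])
      have "continuous_on {0..T} (\<lambda>t. z t x)" using z Suc.prems unfolding subsolution_def by auto
      then have c: "continuous_on {0..t} (\<lambda>t. z t x)" by (rule continuous_on_subset) (use Suc.prems in auto)
      show "continuous_on {0..t} h" unfolding h_def by (intro continuous_intros c) auto
      fix s assume s: "0 < s" "s < t"
      then have sT: "0 \<le> s" "s \<le> T" "s \<in> {0<..<T}" using Suc.prems by auto
      obtain d where d: "((\<lambda>t. z t x) has_real_derivative d) (at s)" "d \<le> conv (z s) x - z s x"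
        using z Suc.prems sT(3) unfolding subsolution_def by blast
      have "((\<lambda>s. M * (s ^ Suc n / fact (Suc n))) has_real_derivative M * (s ^ n / fact n)) (at s)"
        by (rule DERIV_cmult[OF has_real_derivative_power_over_fact])
      moreover have "((\<lambda>s. exp s * z s x) has_real_derivative exp s * (z s x + d)) (at s)"
        by (auto intro!: derivative_eq_intros d simp: algebra_simps)
      ultimately have "(h has_real_derivative (\<Sum>k<n. s ^ k / fact k * (conv ^^ Suc k) f x) + M * (s ^ n / fact n) - exp s * (z s x + d)) (at s)"
        unfolding h_def
        by (intro DERIV_diff DERIV_add has_real_derivative_exp_partial_sum[where c="\<lambda>k. (conv ^^ k) f x"])
      moreover have "exp s * (z s x + d) \<le> (\<Sum>k<n. s ^ k / fact k * (conv ^^ Suc k) f x) + M * (s ^ n / fact n)"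
      proof -
        have ik: "integrable lebesgue (\<lambda>y. J (x - y) * (conv ^^ k) f y)" for k
          by (rule integrable_conv_bounded[OF conv_power[OF f]])
        have iz: "integrable lebesgue (\<lambda>y. J (x - y) * z s y)"
          by (rule integrable_conv_bounded[OF zm K]) (use sT in auto)
        have expand: "J (x - y) * ((\<Sum>k<n. s ^ k / fact k * (conv ^^ k) f y) + M * (s ^ n / fact n)) =
          (\<Sum>k<n. s ^ k / fact k * (J (x - y) * (conv ^^ k) f y)) + (M * (s ^ n / fact n)) * J (x - y)" for y
          by (simp add: distrib_left sum_distrib_left mult_ac)
        have "exp s * (z s x + d) \<le> exp s * conv (z s) x" using d(2) by simp
        also have "\<dots> = conv (\<lambda>y. exp s * z s y) x"
          unfolding conv_def by (subst integral_mult_right_zero[symmetric]) (simp add: mult_ac)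
        also have "\<dots> \<le> conv (\<lambda>y. (\<Sum>k<n. s ^ k / fact k * (conv ^^ k) f y) + M * (s ^ n / fact n)) x"
        proof (rule conv_mono_AE)
          show "integrable lebesgue (\<lambda>y. J (x - y) * (exp s * z s y))"
            using integrable_mult_right[OF iz, of "exp s"] by (simp add: mult_ac)
          show "integrable lebesgue (\<lambda>y. J (x - y) * ((\<Sum>k<n. s ^ k / fact k * (conv ^^ k) f y) + M * (s ^ n / fact n)))"
            unfolding expand using ik integrable_J_shift by (intro Bochner_Integration.integrable_add Bochner_Integration.integrable_sum integrable_mult_right)
          show "AE y in lebesgue. exp s * z s y \<le> (\<Sum>k<n. s ^ k / fact k * (conv ^^ k) f y) + M * (s ^ n / fact n)"
            using AE_not_in_negligible[OF Z] by eventually_elim (rule Suc.IH[OF _ sT(1,2)])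
        qed
        also have "\<dots> = (\<Sum>k<n. s ^ k / fact k * (conv ^^ Suc k) f x) + M * (s ^ n / fact n)"
        proof -
          have "conv (\<lambda>y. (\<Sum>k<n. s ^ k / fact k * (conv ^^ k) f y) + M * (s ^ n / fact n)) x =
            (\<Sum>k<n. LINT y|lebesgue. s ^ k / fact k * (J (x - y) * (conv ^^ k) f y)) + (LINT y|lebesgue. (M * (s ^ n / fact n)) * J (x - y))"
          proof -
            have i: "integrable lebesgue (\<lambda>y. s ^ k / fact k * (J (x - y) * (conv ^^ k) f y))" for k
              by (intro integrable_mult_right ik)
            have "(LINT y|lebesgue. (\<Sum>k<n. s ^ k / fact k * (J (x - y) * (conv ^^ k) f y)) + (M * (s ^ n / fact n)) * J (x - y)) =
              (LINT y|lebesgue. (\<Sum>k<n. s ^ k / fact k * (J (x - y) * (conv ^^ k) f y))) + (LINT y|lebesgue. (M * (s ^ n / fact n)) * J (x - y))"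
              by (intro Bochner_Integration.integral_add Bochner_Integration.integrable_sum i integrable_mult_right integrable_J_shift)
            also have "(LINT y|lebesgue. (\<Sum>k<n. s ^ k / fact k * (J (x - y) * (conv ^^ k) f y))) = (\<Sum>k<n. LINT y|lebesgue. s ^ k / fact k * (J (x - y) * (conv ^^ k) f y))"
              by (intro Bochner_Integration.integral_sum i)
            finally show ?thesis unfolding conv_def expand .
          qed
          also have "(LINT y|lebesgue. (M * (s ^ n / fact n)) * J (x - y)) = M * (s ^ n / fact n)"
            by (simp add: integral_J_shift)
          also have "(\<Sum>k<n. LINT y|lebesgue. s ^ k / fact k * (J (x - y) * (conv ^^ k) f y)) = (\<Sum>k<n. s ^ k / fact k * (conv ^^ Suc k) f x)"
            by (simp only: integral_mult_right_zero funpow.simps comp_def conv_def)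
          finally show ?thesis .
        qed
        finally show ?thesis .
      qed
      ultimately show "\<exists>y. (h has_real_derivative y) (at s) \<and> 0 \<le> y" by force
    qed
    moreover have "(\<Sum>k<Suc n. 0 ^ k / fact k * (conv ^^ k) f x) = f x"
      by (subst sum.lessThan_Suc_shift) simp
    then have "0 \<le> h 0" using init[OF Suc.prems(1)] by (simp add: h_def del: sum.lessThan_Suc)
    ultimately have "0 \<le> h t" by linarith
    then show ?case unfolding h_def by linarith
  qed
  then show ?thesis using that by blast
qed

text \<open>With \<open>f = 0\<close> the Picard sums vanish and only the remainder
  \<open>M * (t ^ n / fact n)\<close> is left.\<close>

lemma comparison_principle:
  assumes z: "subsolution Z T z" and Z: "negligible Z" and init: "\<And>x. x \<notin> Z \<Longrightarrow> z 0 x \<le> 0"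
    and x: "x \<notin> Z" and t: "0 \<le> t" "t \<le> T"
  shows "z t x \<le> 0"
proof -
  obtain M where M: "\<And>n x t. x \<notin> Z \<Longrightarrow> 0 \<le> t \<Longrightarrow> t \<le> T \<Longrightarrow>
    exp t * z t x \<le> (\<Sum>k<n. t ^ k / fact k * (conv ^^ k) (\<lambda>_. 0) x) + M * (t ^ n / fact n)"
    using subsolution_picard[OF z Z, of "\<lambda>_. 0" 0] init by (auto simp del: funpow.simps)
  have "(conv ^^ k) (\<lambda>_. 0) x = 0" for k
    using conv_power(2)[of "\<lambda>_. 0" 0 k x] by simp
  then have "exp t * z t x \<le> M * (t ^ n / fact n)" for n using M[OF x t, of n] by simp
  moreover have "(\<lambda>n. M * (t ^ n / fact n)) \<longlonglongrightarrow> M * 0"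
    by (intro tendsto_intros power_over_fact_tendsto_0)
  ultimately have "exp t * z t x \<le> M * 0" by (intro LIMSEQ_le_const) auto
  then show ?thesis by (simp add: mult_le_0_iff)
qed

text \<open>The Picard bound converges to \<open>exp (- t)\<close> times the exponential series in
  \<open>conv\<close>, a Poisson average of iterates that all have the mass of \<open>f\<close>.
  Monotone convergence gives this average the same mass, and it dominates \<open>z t\<close>;
  integrability of \<open>z t\<close> is part of the outcome.\<close>

lemma subsolution_mass:
  assumes z: "subsolution Z T z" and Z: "negligible Z" and z0: "\<And>t x. 0 \<le> z t x"
    and f: "integrable lebesgue f" "\<And>x. \<bar>f x\<bar> \<le> F" "\<And>x. 0 \<le> f x" and init: "\<And>x. x \<notin> Z \<Longrightarrow> z 0 x \<le> f x"
    and t: "0 \<le> t" "t \<le> T"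
  shows "integrable lebesgue (z t)" "(LINT x|lebesgue. z t x) \<le> (LINT x|lebesgue. f x)"
proof -
  have fm: "f \<in> borel_measurable lebesgue" using f by auto
  have c: "integrable lebesgue ((conv ^^ k) f) \<and> (LINT x|lebesgue. (conv ^^ k) f x) = (LINT x|lebesgue. f x) \<and> (\<forall>x. 0 \<le> (conv ^^ k) f x)" for k
    using f by (induction k) (auto simp: integrable_conv integral_conv, auto simp: conv_def)
  define S where "S n x = exp (- t) * (\<Sum>k<n. t ^ k / fact k * (conv ^^ k) f x)" for n x
  define P where "P x = exp (- t) * (\<Sum>k. t ^ k / fact k * (conv ^^ k) f x)" for x
  have sm: "summable (\<lambda>k. t ^ k / fact k * (conv ^^ k) f x)" for x
  proof (rule summable_comparison_test')
    show "summable (\<lambda>k. F * (inverse (fact k) * t ^ k))" by (intro summable_mult summable_exp)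
    show "norm (t ^ k / fact k * (conv ^^ k) f x) \<le> F * (inverse (fact k) * t ^ k)" if "0 \<le> k" for k
      using mult_left_mono[OF conv_power(2)[OF fm f(2), of k x], of "t ^ k / fact k"] t
      by (simp add: abs_mult divide_inverse mult_ac)
  qed
  have lim: "(\<lambda>n. S n x) \<longlonglongrightarrow> P x" for x
    unfolding S_def P_def by (intro tendsto_intros summable_LIMSEQ sm)
  have Si: "integrable lebesgue (S n)" for n unfolding S_def[abs_def]
    by (intro integrable_mult_right Bochner_Integration.integrable_sum) (use c in auto)
  have Sint: "(LINT x|lebesgue. S n x) = exp (- t) * ((\<Sum>k<n. t ^ k / fact k) * (LINT x|lebesgue. f x))" for n
  proof -
    have "(LINT x|lebesgue. (\<Sum>k<n. t ^ k / fact k * (conv ^^ k) f x)) = (\<Sum>k<n. t ^ k / fact k) * (LINT x|lebesgue. f x)"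
      using c by (subst Bochner_Integration.integral_sum) (auto simp: sum_distrib_right)
    then show ?thesis by (simp only: S_def integral_mult_right_zero)
  qed
  have "(\<lambda>n. exp (- t) * ((\<Sum>k<n. t ^ k / fact k) * (LINT x|lebesgue. f x))) \<longlonglongrightarrow> exp (- t) * (exp t * (LINT x|lebesgue. f x))"
    using exp_converges[of t] by (intro tendsto_intros) (simp add: sums_def divide_inverse mult.commute)
  then have Slim: "(\<lambda>n. LINT x|lebesgue. S n x) \<longlonglongrightarrow> (LINT x|lebesgue. f x)"
    unfolding Sint by (simp add: mult.assoc[symmetric] exp_add[symmetric])
  have mono: "mono (\<lambda>n. S n x)" for x
    unfolding S_def by (intro monoI mult_left_mono sum_mono2) (use t c in \<open>auto intro!: mult_nonneg_nonneg\<close>)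
  have Pm: "P \<in> borel_measurable lebesgue"
    by (rule borel_measurable_LIMSEQ_real[OF lim]) (use Si in auto)
  have Pi: "integrable lebesgue P" "(LINT x|lebesgue. P x) = (LINT x|lebesgue. f x)"
    using integrable_monotone_convergence[OF Si _ _ Slim Pm] integral_monotone_convergence[OF Si _ _ Slim Pm] mono lim
    by auto
  obtain M where M: "\<And>n x t. x \<notin> Z \<Longrightarrow> 0 \<le> t \<Longrightarrow> t \<le> T \<Longrightarrow>
    exp t * z t x \<le> (\<Sum>k<n. t ^ k / fact k * (conv ^^ k) f x) + M * (t ^ n / fact n)"
    using subsolution_picard[OF z Z fm f(2) init] by blast
  have le: "z t x \<le> P x" if "x \<notin> Z" for x
  proof -
    have "z t x \<le> S n x + exp (- t) * (M * (t ^ n / fact n))" for n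
    proof -
      have "exp (- t) * (exp t * z t x) \<le> exp (- t) * ((\<Sum>k<n. t ^ k / fact k * (conv ^^ k) f x) + M * (t ^ n / fact n))"
        by (intro mult_left_mono M that t) simp
      then show ?thesis by (simp add: S_def mult.assoc[symmetric] exp_add[symmetric] distrib_left)
    qed
    moreover have "(\<lambda>n. S n x + exp (- t) * (M * (t ^ n / fact n))) \<longlonglongrightarrow> P x + exp (- t) * (M * 0)"
      by (intro tendsto_intros lim power_over_fact_tendsto_0)
    ultimately have "z t x \<le> P x + exp (- t) * (M * 0)" by (intro LIMSEQ_le_const) auto
    then show ?thesis by simp
  qed
  then have ae: "AE x in lebesgue. z t x \<le> P x"
    using AE_not_in_negligible[OF Z] by (auto elim: eventually_mono)
  have zm: "z t \<in> borel_measurable lebesgue" using z t unfolding subsolution_def by auto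
  show zi: "integrable lebesgue (z t)"
    by (rule Bochner_Integration.integrable_bound[OF Pi(1) zm])
      (use ae z0 in \<open>auto elim!: eventually_mono intro: order.trans[OF _ abs_ge_self]\<close>)
  show "(LINT x|lebesgue. z t x) \<le> (LINT x|lebesgue. f x)"
    using integral_mono_AE[OF zi Pi(1) ae] Pi(2) by simp
qed

lemma conv_affine:
  assumes "integrable lebesgue (\<lambda>y. J (x - y) * f y)" "integrable lebesgue (\<lambda>y. J (x - y) * g y)"
  shows "conv (\<lambda>y. c * f y + d * g y + e) x = c * conv f x + d * conv g x + e"
proof -
  have "J (x - y) * (c * f y + d * g y + e) = c * (J (x - y) * f y) + d * (J (x - y) * g y) + e * J (x - y)" for y
    by (simp add: algebra_simps)
  then show ?thesis using assms integrable_J_shift by (simp add: conv_def integral_J_shift)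
qed

text \<open>None of these properties is visible in the multiplier formula; all come from comparison,
  using that the semigroup solves the equation.\<close>

lemma semigroup_bounds:
  assumes f: "integrable lebesgue f" "\<And>x. 0 \<le> f x" "\<And>x. f x \<le> B" and t: "0 \<le> t"
  shows "0 \<le> semigroup t f x" "semigroup t f x \<le> B" "integrable lebesgue (semigroup t f)"
    "(LINT x|lebesgue. semigroup t f x) \<le> (LINT x|lebesgue. f x)"
proof -
  have fB: "\<bar>f x\<bar> \<le> B" for x using f(2,3) by simp
  note der = has_real_derivative_semigroup[OF f(1) fB]
  obtain K where K: "\<And>s x. 0 \<le> s \<Longrightarrow> s \<le> t \<Longrightarrow> \<bar>semigroup s f x\<bar> \<le> K"
    using semigroup_locally_bounded[OF f(1) fB, of t] by blast
  have sm: "semigroup s f \<in> borel_measurable lebesgue" for s by (rule semigroup_measurable[OF f(1)])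
  have cs: "continuous_on {0..t} (\<lambda>s. semigroup s f x)" for x
    by (rule DERIV_continuous_on, rule has_field_derivative_at_within, rule der)
  \<comment> \<open>One affine family for both pointwise bounds: \<open>c = - 1\<close>,
    \<open>e = 0\<close> gives the sign, and \<open>c = 1\<close>, \<open>e = - B\<close> the upper
    bound.\<close>
  have sub: "subsolution {} t (\<lambda>s x. c * semigroup s f x + e)" for c e
    unfolding subsolution_def
  proof (intro conjI ballI allI impI)
    show "(\<lambda>x. c * semigroup s f x + e) \<in> borel_measurable lebesgue" for s using sm by measurable
    show "\<exists>K. \<forall>s\<in>{0..t}. \<forall>x. \<bar>c * semigroup s f x + e\<bar> \<le> K"
    proof (intro exI[of _ "\<bar>c\<bar> * K + \<bar>e\<bar>"] ballI allI)
      fix s x assume "s \<in> {0..t}"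
      then have "\<bar>c * semigroup s f x\<bar> \<le> \<bar>c\<bar> * K" unfolding abs_mult by (intro mult_left_mono K) auto
      then show "\<bar>c * semigroup s f x + e\<bar> \<le> \<bar>c\<bar> * K + \<bar>e\<bar>" by linarith
    qed
    show "continuous_on {0..t} (\<lambda>s. c * semigroup s f x + e)" for x
      by (intro continuous_intros cs)
    fix x s assume s: "s \<in> {0<..<t}"
    have i: "integrable lebesgue (\<lambda>y. J (x - y) * semigroup s f y)"
      by (rule integrable_conv_bounded[OF sm K]) (use s in auto)
    have "conv (\<lambda>y. c * semigroup s f y + 0 * semigroup s f y + e) x = c * conv (semigroup s f) x + 0 * conv (semigroup s f) x + e"
      by (rule conv_affine[OF i i])
    then have "c * (conv (semigroup s f) x - semigroup s f x) = conv (\<lambda>x. c * semigroup s f x + e) x - (c * semigroup s f x + e)"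
      by (simp add: algebra_simps)
    moreover have "((\<lambda>s. c * semigroup s f x + e) has_real_derivative c * (conv (semigroup s f) x - semigroup s f x)) (at s)"
      by (auto intro!: derivative_eq_intros der)
    ultimately show "\<exists>d. ((\<lambda>s. c * semigroup s f x + e) has_real_derivative d) (at s) \<and> d \<le> conv (\<lambda>x. c * semigroup s f x + e) x - (c * semigroup s f x + e)"
      by auto
  qed
  show nn: "0 \<le> semigroup t f x"
    using comparison_principle[OF sub[of "-1" 0], of x t] f(2) t by auto
  show "semigroup t f x \<le> B"
    using comparison_principle[OF sub[of 1 "- B"], of x t] f(3) t by auto
  have nns: "0 \<le> semigroup s f x" if "0 \<le> s" "s \<le> t" for s x
    using comparison_principle[OF sub[of "-1" 0], of x s] f(2) that by auto
  \<comment> \<open>\<open>subsolution_mass\<close> asks for nonnegativity at all real times, while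
    it is known on \<open>[0, t]\<close>; the function is therefore set to \<open>0\<close>
    outside.\<close>
  have "subsolution {} t (\<lambda>s x. if 0 \<le> s \<and> s \<le> t then semigroup s f x else 0)"
    using sub[of 1 0] unfolding subsolution_def
  proof (elim conjE, intro conjI ballI allI impI)
    fix x s assume s: "s \<in> {0<..<t}"
    obtain d where d: "((\<lambda>s. semigroup s f x) has_real_derivative d) (at s)" "d \<le> conv (semigroup s f) x - semigroup s f x"
      using der[of x s] by blast
    have "((\<lambda>s. if 0 \<le> s \<and> s \<le> t then semigroup s f x else 0) has_real_derivative d) (at s)"
      by (rule has_field_derivative_transform_within_open[OF d(1), of "{0<..<t}"]) (use s in auto)
    then show "\<exists>d. ((\<lambda>s. if 0 \<le> s \<and> s \<le> t then semigroup s f x else 0) has_real_derivative d) (at s) \<and>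
        d \<le> conv (\<lambda>x. if 0 \<le> s \<and> s \<le> t then semigroup s f x else 0) x - (if 0 \<le> s \<and> s \<le> t then semigroup s f x else 0)"
      using d(2) s by auto
  next
    show "continuous_on {0..t} (\<lambda>s. if 0 \<le> s \<and> s \<le> t then semigroup s f x else 0)" for x
      using cs[of x] by (rule continuous_on_eq) auto
  qed auto
  from subsolution_mass[OF this _ _ f(1) fB f(2), of t] nns t
  show "integrable lebesgue (semigroup t f)" "(LINT x|lebesgue. semigroup t f x) \<le> (LINT x|lebesgue. f x)"
    by auto
qed

end

section \<open>Uniqueness for the heat equation with a point mass\<close>

definition has_partial :: "'a::euclidean_space \<Rightarrow> ('a \<Rightarrow> real) \<Rightarrow> ('a \<Rightarrow> real) \<Rightarrow> bool" where
  "has_partial i f f' \<longleftrightarrow> (\<forall>x. ((\<lambda>s. f (x + s *\<^sub>R i)) has_real_derivative f' x) (at 0))"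

lemma has_partial_at:
  assumes "has_partial i f f'"
  shows "((\<lambda>s. f (x + s *\<^sub>R i)) has_real_derivative f' (x + s *\<^sub>R i)) (at s)"
proof -
  have "((\<lambda>h. f ((x + s *\<^sub>R i) + h *\<^sub>R i)) has_real_derivative f' (x + s *\<^sub>R i)) (at 0)"
    using assms unfolding has_partial_def by blast
  then have "((\<lambda>h. f (x + (h + s) *\<^sub>R i)) has_real_derivative f' (x + s *\<^sub>R i)) (at 0)"
    by (simp add: algebra_simps)
  then show ?thesis using DERIV_shift[of "\<lambda>s. f (x + s *\<^sub>R i)" _ 0 s] by simp
qed

lemma has_partial_mult:
  assumes "has_partial i f f'" "has_partial i g g'"
  shows "has_partial i (\<lambda>x. f x * g x) (\<lambda>x. f' x * g x + f x * g' x)"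
  unfolding has_partial_def
proof
  fix x
  from DERIV_mult[OF assms(1)[unfolded has_partial_def, rule_format, of x] assms(2)[unfolded has_partial_def, rule_format, of x]]
  show "((\<lambda>s. f (x + s *\<^sub>R i) * g (x + s *\<^sub>R i)) has_real_derivative f' x * g x + f x * g' x) (at 0)"
    by (simp add: mult.commute add.commute)
qed

lemma has_partial_diff:
  assumes "has_partial i f f'" "has_partial i g g'"
  shows "has_partial i (\<lambda>x. f x - g x) (\<lambda>x. f' x - g' x)"
  using assms unfolding has_partial_def by (auto intro: DERIV_diff)

lemma has_partial_add:
  assumes "has_partial i f f'" "has_partial i g g'"
  shows "has_partial i (\<lambda>x. f x + g x) (\<lambda>x. f' x + g' x)"
  using assms unfolding has_partial_def by (auto intro: DERIV_add)

lemma has_partial_const: "has_partial i (\<lambda>x. c) (\<lambda>x. 0)"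
  unfolding has_partial_def by auto

lemma has_partial_compose:
  assumes "has_partial i f f'" "\<And>z. (h has_real_derivative h' z) (at z)"
  shows "has_partial i (\<lambda>x. h (f x)) (\<lambda>x. h' (f x) * f' x)"
  unfolding has_partial_def
proof
  fix x
  have 1: "((\<lambda>s. f (x + s *\<^sub>R i)) has_real_derivative f' x) (at 0)" using assms(1) unfolding has_partial_def by blast
  have 2: "(h has_real_derivative h' (f x)) (at (f (x + 0 *\<^sub>R i)))" using assms(2)[of "f x"] by simp
  show "((\<lambda>s. h (f (x + s *\<^sub>R i))) has_real_derivative h' (f x) * f' x) (at 0)"
    by (rule DERIV_chain2[where f=h and g="\<lambda>s. f (x + s *\<^sub>R i)", OF 2 1])
qed

lemma has_partial_norm_sq:
  assumes "i \<in> Basis" shows "has_partial i (\<lambda>y. (norm (y - x))\<^sup>2) (\<lambda>y. 2 * ((y - x) \<bullet> i))"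
  unfolding has_partial_def
proof
  fix y
  have "(norm (y + s *\<^sub>R i - x))\<^sup>2 = (norm (y - x))\<^sup>2 + 2 * s * ((y - x) \<bullet> i) + s\<^sup>2" for s
  proof -
    have "y + s *\<^sub>R i - x = (y - x) + s *\<^sub>R i" by simp
    then show ?thesis
      using assms unfolding power2_norm_eq_inner
      by (simp only: inner_add inner_scaleR_left inner_scaleR_right inner_Basis inner_commute) (simp add: algebra_simps power2_eq_square inner_commute)
  qed
  moreover have "((\<lambda>s. (norm (y - x))\<^sup>2 + 2 * s * ((y - x) \<bullet> i) + s\<^sup>2) has_real_derivative 2 * ((y - x) \<bullet> i)) (at 0)"
    by (auto intro!: derivative_eq_intros)
  ultimately show "((\<lambda>s. (norm (y + s *\<^sub>R i - x))\<^sup>2) has_real_derivative 2 * ((y - x) \<bullet> i)) (at 0)" by simp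
qed

lemma has_partial_inner:
  assumes "i \<in> Basis" shows "has_partial i (\<lambda>y. (y - x) \<bullet> i) (\<lambda>y. 1)"
  unfolding has_partial_def using assms
  by (auto simp: inner_add_left inner_diff_left intro!: derivative_eq_intros)

text \<open>The integral of the translate of \<open>f\<close> by \<open>s *\<^sub>R i\<close> does
  not depend on \<open>s\<close>; it is differentiated under the integral sign at
  \<open>s = 0\<close>. No iterated integrals are involved.\<close>

lemma integral_partial_eq_0:
  fixes f f' :: "'a::euclidean_space \<Rightarrow> real"
  assumes p: "has_partial i f f'" and i: "norm i \<le> 1" and c: "continuous_on UNIV f" "continuous_on UNIV f'"
    and s: "\<And>x. f x \<noteq> 0 \<Longrightarrow> norm x \<le> \<rho>"
  shows "integrable lebesgue f'" "(LINT x|lebesgue. f' x) = 0"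
proof -
  have s': "norm x \<le> \<rho>" if "f' x \<noteq> 0" for x
  proof (rule ccontr)
    assume n: "\<not> norm x \<le> \<rho>"
    have "open {s :: real. \<rho> < norm (x + s *\<^sub>R i)}" by (intro open_Collect_less continuous_intros)
    moreover have "(0::real) \<in> {s. \<rho> < norm (x + s *\<^sub>R i)}" using n by simp
    moreover have "f (x + r *\<^sub>R i) = 0" if "r \<in> {s. \<rho> < norm (x + s *\<^sub>R i)}" for r
      using s[of "x + r *\<^sub>R i"] that by auto
    ultimately have "((\<lambda>s. 0) has_real_derivative f' x) (at 0)"
      using p has_field_derivative_transform_within_open[of "\<lambda>s. f (x + s *\<^sub>R i)" "f' x" 0 "{s. \<rho> < norm (x + s *\<^sub>R i)}" "\<lambda>s. 0"]
      unfolding has_partial_def by auto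
    then have "f' x = 0" using DERIV_unique[OF _ DERIV_const] by blast
    with that show False by simp
  qed
  show f'i: "integrable lebesgue f'" by (rule integrable_continuous_bounded_support[OF c(2) s'])
  have fi: "integrable lebesgue f" by (rule integrable_continuous_bounded_support[OF c(1) s])
  obtain C where C: "\<And>x. \<bar>f' x\<bar> \<le> C"
  proof -
    have "compact (f' ` cball 0 \<rho>)"
      using c(2) by (intro compact_continuous_image) (auto intro: continuous_on_subset)
    then obtain b where b: "\<forall>y\<in>f' ` cball 0 \<rho>. norm y \<le> b"
      using compact_imp_bounded bounded_iff by metis
    have "\<bar>f' x\<bar> \<le> \<bar>b\<bar>" for x
    proof (cases "f' x = 0")
      case False
      then have "f' x \<in> f' ` cball 0 \<rho>" using s'[of x] by auto
      then show ?thesis using b by force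
    qed simp
    then show ?thesis using that by blast
  qed
  have "((\<lambda>s. LINT x|lebesgue. f (x + s *\<^sub>R i)) has_real_derivative (LINT x|lebesgue. f' (x + 0 *\<^sub>R i))) (at 0)"
  proof (rule has_real_derivative_integral[where r=1 and w="\<lambda>x. C * indicat_real (cball (0::'a) (\<rho> + 1)) x"])
    show "integrable lebesgue (\<lambda>x. f (x + s *\<^sub>R i))" for s
      using integrable_lebesgue_translate[OF fi, of "s *\<^sub>R i"] by (simp add: add.commute)
    show "(\<lambda>x. f' (x + 0 *\<^sub>R i)) \<in> borel_measurable lebesgue" using f'i by auto
    show "integrable lebesgue (\<lambda>x. C * indicat_real (cball (0::'a) (\<rho> + 1)) x)"
      using lmeasurable_cball lmeasurable_iff_integrable by (intro integrable_mult_right) blast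
    show "AE x in lebesgue. \<forall>s. \<bar>s - 0\<bar> < 1 \<longrightarrow>
        ((\<lambda>s. f (x + s *\<^sub>R i)) has_real_derivative f' (x + s *\<^sub>R i)) (at s) \<and>
        \<bar>f' (x + s *\<^sub>R i)\<bar> \<le> C * indicat_real (cball (0::'a) (\<rho> + 1)) x"
    proof (intro AE_I2 allI impI conjI)
      fix x s assume "\<bar>s - 0\<bar> < (1::real)"
      then have "norm (s *\<^sub>R i) \<le> 1" using i by (simp add: mult_le_one)
      then have n: "norm x \<le> norm (x + s *\<^sub>R i) + 1"
        using norm_triangle_ineq4[of "x + s *\<^sub>R i" "s *\<^sub>R i"] by simp
      show "((\<lambda>s. f (x + s *\<^sub>R i)) has_real_derivative f' (x + s *\<^sub>R i)) (at s)" by (rule has_partial_at[OF p])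
      show "\<bar>f' (x + s *\<^sub>R i)\<bar> \<le> C * indicat_real (cball (0::'a) (\<rho> + 1)) x"
      proof (cases "f' (x + s *\<^sub>R i) = 0")
        case True then show ?thesis using order.trans[OF abs_ge_zero C[of 0]] by simp
      next
        case False
        from s'[OF this] n have "norm x \<le> \<rho> + 1" by simp
        then show ?thesis using C by simp
      qed
    qed
  qed simp
  moreover have "(LINT x|lebesgue. f (x + s *\<^sub>R i)) = (LINT x|lebesgue. f x)" for s
    using integral_lebesgue_translate[OF fi, of "s *\<^sub>R i"] by (simp add: add.commute)
  ultimately have "((\<lambda>s::real. LINT x|lebesgue. f x) has_real_derivative (LINT x|lebesgue. f' x)) (at 0)" by simp
  then show "(LINT x|lebesgue. f' x) = 0" using DERIV_unique[OF _ DERIV_const] by blast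
qed

text \<open>Reconciles the two encodings of second derivatives: \<open>C_class\<close> iterates
  Frechet derivatives in basis directions, \<open>laplacian\<close> iterates \<open>deriv\<close>
  along lines.\<close>

lemma C_class_2_partials:
  fixes v :: "'a::euclidean_space \<Rightarrow> real"
  assumes v: "C_class 2 v"
  obtains v1 v2 where "continuous_on UNIV v" "\<And>i. i \<in> Basis \<Longrightarrow> has_partial i v (v1 i)"
    "\<And>i. i \<in> Basis \<Longrightarrow> has_partial i (v1 i) (v2 i)" "\<And>i. i \<in> Basis \<Longrightarrow> continuous_on UNIV (v1 i)"
    "\<And>i. i \<in> Basis \<Longrightarrow> continuous_on UNIV (v2 i)" "\<And>x. laplacian v x = (\<Sum>i\<in>Basis. v2 i x)"
proof -
  define v1 where "v1 i x = frechet_derivative v (at x) i" for i x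
  define v2 where "v2 i x = frechet_derivative (v1 i) (at x) i" for i x
  have fr: "has_partial i g (\<lambda>x. frechet_derivative g (at x) i)" if g: "g differentiable_on UNIV" for g :: "'a \<Rightarrow> real" and i
    unfolding has_partial_def
  proof
    fix x
    have "(g has_derivative frechet_derivative g (at x)) (at x)"
      using g frechet_derivative_works by (auto simp: differentiable_on_def)
    then have 1: "(g has_derivative frechet_derivative g (at x)) (at (x + 0 *\<^sub>R i))" by simp
    have 2: "((\<lambda>s::real. x + s *\<^sub>R i) has_derivative (\<lambda>s. s *\<^sub>R i)) (at 0)"
      by (auto intro!: derivative_eq_intros)
    have "((\<lambda>s. g (x + s *\<^sub>R i)) has_derivative (\<lambda>s. frechet_derivative g (at x) (s *\<^sub>R i))) (at 0)"
      using diff_chain_at[OF 2 1] by (simp add: o_def)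
    moreover have "frechet_derivative g (at x) (s *\<^sub>R i) = frechet_derivative g (at x) i * s" for s
    proof -
      have "linear (frechet_derivative g (at x))"
        using 1 has_derivative_linear by auto
      then show ?thesis by (simp add: linear_scale)
    qed
    ultimately show "((\<lambda>s. g (x + s *\<^sub>R i)) has_real_derivative frechet_derivative g (at x) i) (at 0)"
      by (simp add: has_field_derivative_def mult_commute_abs)
  qed
  have d: "v differentiable_on UNIV" "\<And>i. i \<in> Basis \<Longrightarrow> v1 i differentiable_on UNIV"
    "\<And>i. i \<in> Basis \<Longrightarrow> continuous_on UNIV (v2 i)"
    using v unfolding numeral_2_eq_2 v1_def v2_def by (auto simp: fun_eq_iff)
  have p1: "has_partial i v (v1 i)" for i unfolding v1_def by (rule fr[OF d(1)])
  have p2: "has_partial i (v1 i) (v2 i)" if "i \<in> Basis" for i unfolding v2_def by (rule fr[OF d(2)[OF that]])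
  have "laplacian v x = (\<Sum>i\<in>Basis. v2 i x)" for x
    unfolding laplacian_def
  proof (rule sum.cong[OF refl])
    fix i :: 'a assume i: "i \<in> Basis"
    have "deriv (\<lambda>s. v (x + s *\<^sub>R i)) = (\<lambda>s. v1 i (x + s *\<^sub>R i))"
      by (rule ext, rule DERIV_imp_deriv, rule has_partial_at[OF p1])
    moreover have "deriv (\<lambda>s. v1 i (x + s *\<^sub>R i)) 0 = v2 i x"
      by (rule DERIV_imp_deriv) (use p2[OF i] in \<open>auto simp: has_partial_def\<close>)
    ultimately show "(deriv ^^ 2) (\<lambda>s. v (x + s *\<^sub>R i)) 0 = v2 i x" by (simp add: numeral_2_eq_2)
  qed
  then show ?thesis
    using that[of v1 v2] p1 p2 d differentiable_imp_continuous_on by blast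
qed

text \<open>Green's identity, one coordinate at a time: the partial of
  \<open>v1 * \<psi> - v * \<psi>1\<close> is \<open>v2 * \<psi> - v * \<psi>2\<close>, because the
  mixed products cancel, and its integral vanishes.\<close>

lemma integral_laplacian_by_parts:
  fixes v :: "'a::euclidean_space \<Rightarrow> real"
  assumes v: "C_class 2 v"
    and \<psi>: "\<And>i. i \<in> Basis \<Longrightarrow> has_partial i \<psi> (\<psi>1 i)" "\<And>i. i \<in> Basis \<Longrightarrow> has_partial i (\<psi>1 i) (\<psi>2 i)"
    and c: "continuous_on UNIV \<psi>" "\<And>i. i \<in> Basis \<Longrightarrow> continuous_on UNIV (\<psi>1 i)" "\<And>i. i \<in> Basis \<Longrightarrow> continuous_on UNIV (\<psi>2 i)"
    and s: "\<And>x. \<psi> x \<noteq> 0 \<Longrightarrow> norm x \<le> \<rho>" "\<And>x i. i \<in> Basis \<Longrightarrow> \<psi>1 i x \<noteq> 0 \<Longrightarrow> norm x \<le> \<rho>"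
      "\<And>x i. i \<in> Basis \<Longrightarrow> \<psi>2 i x \<noteq> 0 \<Longrightarrow> norm x \<le> \<rho>"
  shows "integrable lebesgue (\<lambda>x. laplacian v x * \<psi> x)"
    "(LINT x|lebesgue. laplacian v x * \<psi> x) = (LINT x|lebesgue. v x * (\<Sum>i\<in>Basis. \<psi>2 i x))"
proof -
  obtain v1 v2 where v12: "continuous_on UNIV v" "\<And>i. i \<in> Basis \<Longrightarrow> has_partial i v (v1 i)"
    "\<And>i. i \<in> Basis \<Longrightarrow> has_partial i (v1 i) (v2 i)" "\<And>i. i \<in> Basis \<Longrightarrow> continuous_on UNIV (v1 i)"
    "\<And>i. i \<in> Basis \<Longrightarrow> continuous_on UNIV (v2 i)" "\<And>x. laplacian v x = (\<Sum>i\<in>Basis. v2 i x)"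
    using C_class_2_partials[OF v] by blast
  have i1: "integrable lebesgue (\<lambda>x. v2 i x * \<psi> x)" and i2: "integrable lebesgue (\<lambda>x. v x * \<psi>2 i x)"
    if i: "i \<in> Basis" for i
    by (rule integrable_continuous_bounded_support[where \<rho>=\<rho>]; use v12 c s i in \<open>auto intro!: continuous_intros\<close>)+
  have eq: "(LINT x|lebesgue. v2 i x * \<psi> x) = (LINT x|lebesgue. v x * \<psi>2 i x)" if i: "i \<in> Basis" for i
  proof -
    let ?f = "\<lambda>x. v1 i x * \<psi> x - v x * \<psi>1 i x"
    have "has_partial i ?f (\<lambda>x. (v2 i x * \<psi> x + v1 i x * \<psi>1 i x) - (v1 i x * \<psi>1 i x + v x * \<psi>2 i x))"
      by (intro has_partial_diff has_partial_mult v12 \<psi> i)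
    then have p: "has_partial i ?f (\<lambda>x. v2 i x * \<psi> x - v x * \<psi>2 i x)" by simp
    have sf: "norm x \<le> \<rho>" if "?f x \<noteq> 0" for x
      using that s(1)[of x] s(2)[OF i, of x] by (cases "\<psi> x = 0") auto
    have "(LINT x|lebesgue. v2 i x * \<psi> x - v x * \<psi>2 i x) = 0"
      by (rule integral_partial_eq_0(2)[OF p _ _ _ sf]) (use v12 c i in \<open>auto intro!: continuous_intros\<close>)
    then show ?thesis using i1[OF i] i2[OF i] by simp
  qed
  show "integrable lebesgue (\<lambda>x. laplacian v x * \<psi> x)"
    unfolding v12(6) sum_distrib_right by (intro Bochner_Integration.integrable_sum i1)
  have "(LINT x|lebesgue. laplacian v x * \<psi> x) = (\<Sum>i\<in>Basis. LINT x|lebesgue. v2 i x * \<psi> x)"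
    unfolding v12(6) sum_distrib_right by (intro Bochner_Integration.integral_sum i1)
  also have "\<dots> = (\<Sum>i\<in>Basis. LINT x|lebesgue. v x * \<psi>2 i x)" by (intro sum.cong refl eq)
  also have "\<dots> = (LINT x|lebesgue. v x * (\<Sum>i\<in>Basis. \<psi>2 i x))"
    unfolding sum_distrib_left by (intro Bochner_Integration.integral_sum[symmetric] i2)
  finally show "(LINT x|lebesgue. laplacian v x * \<psi> x) = (LINT x|lebesgue. v x * (\<Sum>i\<in>Basis. \<psi>2 i x))" .
qed

section \<open>A cutoff with two continuous derivatives\<close>

text \<open>From the second power on, the positive part has no kink at \<open>0\<close>. The
  exponents 3 and 2 give the two derivatives of the cutoff.\<close>

lemma DERIV_positive_part_power:
  "((\<lambda>q::real. (max 0 q) ^ Suc (Suc n)) has_real_derivative real (Suc (Suc n)) * (max 0 q) ^ Suc n) (at q)"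
proof -
  consider "q < 0" | "q = 0" | "q > 0" by linarith
  then show ?thesis
  proof cases
    case 1
    then have "((\<lambda>q::real. 0) has_real_derivative real (Suc (Suc n)) * (max 0 q) ^ Suc n) (at q)" by simp
    then show ?thesis
      by (rule has_field_derivative_transform_within_open[of _ _ _ "{..<0}"]) (use 1 in auto)
  next
    case 2
    have "((\<lambda>h::real. (max 0 h) ^ Suc (Suc n) / h) \<longlongrightarrow> 0) (at 0)"
    proof (rule Lim_null_comparison)
      show "\<forall>\<^sub>F h in at 0. norm ((max 0 h) ^ Suc (Suc n) / h) \<le> \<bar>h\<bar> ^ Suc n"
      proof (intro always_eventually allI)
        fix h :: real
        show "norm ((max 0 h) ^ Suc (Suc n) / h) \<le> \<bar>h\<bar> ^ Suc n"
        proof (cases "0 < h")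
          case False
          then have "(max 0 h) ^ Suc (Suc n) / h = 0" by (simp add: max_def)
          then show ?thesis by (simp only: norm_zero zero_le_power abs_ge_zero)
        qed (simp add: max_def)
      qed
      have "((\<lambda>h::real. \<bar>h\<bar> ^ Suc n) \<longlongrightarrow> \<bar>0\<bar> ^ Suc n) (at 0)" by (intro tendsto_intros)
      then show "((\<lambda>h::real. \<bar>h\<bar> ^ Suc n) \<longlongrightarrow> 0) (at 0)" by simp
    qed
    then show ?thesis using 2 by (simp add: DERIV_def)
  next
    case 3
    have "((\<lambda>q::real. q ^ Suc (Suc n)) has_real_derivative real (Suc (Suc n)) * (max 0 q) ^ Suc n) (at q)"
      using DERIV_pow[of "Suc (Suc n)" q] 3 by (simp add: max_def)
    then show ?thesis
      by (rule has_field_derivative_transform_within_open[of _ _ _ "{0<..}"]) (use 3 in auto)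
  qed
qed

text \<open>The cube is the smallest integer power of a positive part with a continuous second
  derivative; \<open>cutoff1\<close> and \<open>cutoff2\<close> are the first and second partials in
  direction \<open>i\<close>.\<close>

definition cutoff :: "real \<Rightarrow> 'a::euclidean_space \<Rightarrow> real" where
  "cutoff R y = (max 0 (1 - (norm y)\<^sup>2 / R\<^sup>2)) ^ 3"

definition cutoff1 :: "real \<Rightarrow> 'a::euclidean_space \<Rightarrow> 'a \<Rightarrow> real" where
  "cutoff1 R i y = (max 0 (1 - (norm y)\<^sup>2 / R\<^sup>2)) ^ 2 * (- 6 * (y \<bullet> i) / R\<^sup>2)"

definition cutoff2 :: "real \<Rightarrow> 'a::euclidean_space \<Rightarrow> 'a \<Rightarrow> real" where
  "cutoff2 R i y = max 0 (1 - (norm y)\<^sup>2 / R\<^sup>2) * (24 * (y \<bullet> i)\<^sup>2 / R ^ 4) - (max 0 (1 - (norm y)\<^sup>2 / R\<^sup>2)) ^ 2 * (6 / R\<^sup>2)"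

lemma cutoff_partials:
  fixes i :: "'a::euclidean_space"
  assumes i: "i \<in> Basis" and R: "0 < R"
  shows "has_partial i (cutoff R) (cutoff1 R i)" "has_partial i (cutoff1 R i) (cutoff2 R i)"
proof -
  have q: "has_partial i (\<lambda>y. 1 - (norm y)\<^sup>2 / R\<^sup>2) (\<lambda>y. - 2 * (y \<bullet> i) / R\<^sup>2)"
    using has_partial_diff[OF has_partial_const has_partial_mult[OF has_partial_norm_sq[OF i, of 0] has_partial_const], of 1 "1 / R\<^sup>2"]
    by simp
  have A: "has_partial i (\<lambda>y. (max 0 (1 - (norm y)\<^sup>2 / R\<^sup>2)) ^ Suc (Suc 1)) (\<lambda>y. (real (Suc (Suc 1)) * (max 0 (1 - (norm y)\<^sup>2 / R\<^sup>2)) ^ Suc 1) * (- 2 * (y \<bullet> i) / R\<^sup>2))"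
    by (rule has_partial_compose[OF q DERIV_positive_part_power])
  have B: "(\<lambda>y. (max 0 (1 - (norm y)\<^sup>2 / R\<^sup>2)) ^ Suc (Suc 1)) = cutoff R" by (simp add: cutoff_def[abs_def] numeral_3_eq_3)
  have C: "(\<lambda>y. (real (Suc (Suc 1)) * (max 0 (1 - (norm y)\<^sup>2 / R\<^sup>2)) ^ Suc 1) * (- 2 * (y \<bullet> i) / R\<^sup>2)) = cutoff1 R i"
    by (simp add: cutoff1_def[abs_def] fun_eq_iff power2_eq_square)
  show "has_partial i (cutoff R) (cutoff1 R i)" using A unfolding B C .
  have 1: "has_partial i (\<lambda>y. (max 0 (1 - (norm y)\<^sup>2 / R\<^sup>2)) ^ Suc (Suc 0)) (\<lambda>y. (real (Suc (Suc 0)) * (max 0 (1 - (norm y)\<^sup>2 / R\<^sup>2)) ^ Suc 0) * (- 2 * (y \<bullet> i) / R\<^sup>2))"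
    by (rule has_partial_compose[OF q DERIV_positive_part_power])
  have 2: "has_partial i (\<lambda>y. (- 6 * (y \<bullet> i) / R\<^sup>2)) (\<lambda>y. - 6 / R\<^sup>2)"
    using has_partial_mult[OF has_partial_inner[OF i, of 0] has_partial_const, of "- 6 / R\<^sup>2"] by (simp add: mult.commute)
  have A: "has_partial i (\<lambda>y. (max 0 (1 - (norm y)\<^sup>2 / R\<^sup>2)) ^ Suc (Suc 0) * (- 6 * (y \<bullet> i) / R\<^sup>2))
     (\<lambda>y. (real (Suc (Suc 0)) * (max 0 (1 - (norm y)\<^sup>2 / R\<^sup>2)) ^ Suc 0) * (- 2 * (y \<bullet> i) / R\<^sup>2) * (- 6 * (y \<bullet> i) / R\<^sup>2) + (max 0 (1 - (norm y)\<^sup>2 / R\<^sup>2)) ^ Suc (Suc 0) * (- 6 / R\<^sup>2))"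
    by (rule has_partial_mult[OF 1 2])
  have B: "(\<lambda>y. (max 0 (1 - (norm y)\<^sup>2 / R\<^sup>2)) ^ Suc (Suc 0) * (- 6 * (y \<bullet> i) / R\<^sup>2)) = cutoff1 R i"
    by (simp add: cutoff1_def[abs_def] fun_eq_iff numeral_2_eq_2)
  have C: "(\<lambda>y. (real (Suc (Suc 0)) * (max 0 (1 - (norm y)\<^sup>2 / R\<^sup>2)) ^ Suc 0) * (- 2 * (y \<bullet> i) / R\<^sup>2) * (- 6 * (y \<bullet> i) / R\<^sup>2) + (max 0 (1 - (norm y)\<^sup>2 / R\<^sup>2)) ^ Suc (Suc 0) * (- 6 / R\<^sup>2)) = cutoff2 R i"
    using R by (simp add: cutoff2_def[abs_def] fun_eq_iff power2_eq_square eval_nat_numeral mult_ac)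
  show "has_partial i (cutoff1 R i) (cutoff2 R i)" using A unfolding B C .
qed

text \<open>On the support \<open>\<bar>y \<bullet> i\<bar> \<le> R\<close>, which gives both
  bounds. The second derivative is in fact at most \<open>30 / R\<^sup>2\<close>, weakened by
  \<open>1 \<le> R\<close> so that both errors share the factor \<open>1 / R\<close>.\<close>

lemma cutoff_bounds:
  fixes y :: "'a::euclidean_space"
  assumes R: "1 \<le> R"
  shows "0 \<le> cutoff R y" "cutoff R y \<le> 1" "cutoff R y \<noteq> 0 \<Longrightarrow> norm y \<le> R"
    and "i \<in> Basis \<Longrightarrow> \<bar>cutoff1 R i y\<bar> \<le> 6 / R" "i \<in> Basis \<Longrightarrow> \<bar>cutoff2 R i y\<bar> \<le> 30 / R"
    and "cutoff1 R i y \<noteq> 0 \<Longrightarrow> norm y \<le> R" "cutoff2 R i y \<noteq> 0 \<Longrightarrow> norm y \<le> R"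
proof -
  define q where "q = max 0 (1 - (norm y)\<^sup>2 / R\<^sup>2)"
  have q: "0 \<le> q" "q \<le> 1" using R by (auto simp: q_def)
  have q0: "q \<noteq> 0 \<Longrightarrow> norm y \<le> R"
  proof -
    assume "q \<noteq> 0"
    then have "0 < q" using q by simp
    then have "(norm y)\<^sup>2 / R\<^sup>2 < 1" by (simp add: q_def less_max_iff_disj)
    then have "(norm y)\<^sup>2 < R\<^sup>2" using R by simp
    then show "norm y \<le> R" using R power2_less_imp_less[of "norm y" R] by simp
  qed
  have c: "cutoff R y = q ^ 3" "cutoff1 R i y = q\<^sup>2 * (- 6 * (y \<bullet> i) / R\<^sup>2)"
    "cutoff2 R i y = q * (24 * (y \<bullet> i)\<^sup>2 / R ^ 4) - q\<^sup>2 * (6 / R\<^sup>2)"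
    by (simp_all add: cutoff_def cutoff1_def cutoff2_def q_def)
  show "0 \<le> cutoff R y" "cutoff R y \<le> 1" using q by (auto simp: c power_le_one)
  show "cutoff R y \<noteq> 0 \<Longrightarrow> norm y \<le> R" "cutoff1 R i y \<noteq> 0 \<Longrightarrow> norm y \<le> R" "cutoff2 R i y \<noteq> 0 \<Longrightarrow> norm y \<le> R"
    using q0 unfolding c by (cases "q = 0"; simp)+
  have sq: "1 / R\<^sup>2 \<le> 1 / R" using R by (simp add: power2_eq_square field_simps)
  show "\<bar>cutoff1 R i y\<bar> \<le> 6 / R" if i: "i \<in> Basis"
  proof (cases "q = 0")
    case True then show ?thesis using R by (simp add: c)
  next
    case False
    then have "\<bar>y \<bullet> i\<bar> \<le> R" using q0 Basis_le_norm[OF i, of y] by simp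
    have "\<bar>cutoff1 R i y\<bar> = q\<^sup>2 * (6 * \<bar>y \<bullet> i\<bar> / R\<^sup>2)" by (simp add: c abs_mult)
    also have "\<dots> \<le> 1 * (6 * R / R\<^sup>2)"
      using q \<open>\<bar>y \<bullet> i\<bar> \<le> R\<close> R by (intro mult_mono divide_right_mono) (auto simp: power_le_one)
    also have "\<dots> = 6 / R" using R by (simp add: power2_eq_square)
    finally show ?thesis .
  qed
  show "\<bar>cutoff2 R i y\<bar> \<le> 30 / R" if i: "i \<in> Basis"
  proof (cases "q = 0")
    case True then show ?thesis using R by (simp add: c)
  next
    case False
    then have "\<bar>y \<bullet> i\<bar> \<le> R" using q0 Basis_le_norm[OF i, of y] by simp
    then have "(y \<bullet> i)\<^sup>2 \<le> R\<^sup>2" using R by (simp add: abs_le_square_iff[symmetric])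
    then have "q * (24 * (y \<bullet> i)\<^sup>2 / R ^ 4) \<le> 1 * (24 * R\<^sup>2 / R ^ 4)"
      using q R by (intro mult_mono divide_right_mono) auto
    also have "\<dots> = 24 * (1 / R\<^sup>2)" using R by (simp add: eval_nat_numeral)
    finally have 1: "q * (24 * (y \<bullet> i)\<^sup>2 / R ^ 4) \<le> 24 * (1 / R\<^sup>2)" .
    have "q\<^sup>2 * (6 / R\<^sup>2) \<le> 1 * (6 / R\<^sup>2)" using q R by (intro mult_right_mono) (auto simp: power_le_one)
    then have "q\<^sup>2 * (6 / R\<^sup>2) \<le> 6 * (1 / R\<^sup>2)" by simp
    moreover have "0 \<le> 1 / R\<^sup>2" by simp
    moreover have "0 \<le> q * (24 * (y \<bullet> i)\<^sup>2 / R ^ 4)" "0 \<le> q\<^sup>2 * (6 / R\<^sup>2)" using q R by auto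
    moreover have "0 \<le> A \<Longrightarrow> 0 \<le> B \<Longrightarrow> A \<le> 24 * r \<Longrightarrow> B \<le> 6 * r \<Longrightarrow> 0 \<le> r \<Longrightarrow> \<bar>A - B\<bar> \<le> 30 * r" for A B r :: real
      by linarith
    ultimately have "\<bar>cutoff2 R i y\<bar> \<le> 30 * (1 / R\<^sup>2)" unfolding c using 1 by blast
    then show ?thesis using sq by simp
  qed
qed

lemma continuous_on_cutoff:
  "continuous_on UNIV (cutoff R)" "continuous_on UNIV (cutoff1 R i)" "continuous_on UNIV (cutoff2 R i)"
  unfolding cutoff_def[abs_def] cutoff1_def[abs_def] cutoff2_def[abs_def] divide_inverse
  by (intro continuous_intros)+

section \<open>Estimates for the heat kernel\<close>

lemma gauss_partials:
  fixes i :: "'a::euclidean_space"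
  assumes i: "i \<in> Basis" and e: "0 < e"
  shows "has_partial i (\<lambda>y. gauss e (y - x)) (\<lambda>y. gauss e (y - x) * (- ((y - x) \<bullet> i) / e))"
    and "has_partial i (\<lambda>y. gauss e (y - x) * (- ((y - x) \<bullet> i) / e)) (\<lambda>y. gauss e (y - x) * (((y - x) \<bullet> i)\<^sup>2 / e\<^sup>2 - 1 / e))"
proof -
  let ?c = "(2 * pi * e) powr (- (real DIM('a) / 2))"
  have d: "((\<lambda>z. ?c * exp (- z / (2 * e))) has_real_derivative - 1 / (2 * e) * (?c * exp (- z / (2 * e)))) (at z)" for z
    using e by (auto intro!: derivative_eq_intros)
  show p1: "has_partial i (\<lambda>y. gauss e (y - x)) (\<lambda>y. gauss e (y - x) * (- ((y - x) \<bullet> i) / e))"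
    using has_partial_compose[OF has_partial_norm_sq[OF i, of x] d] e
    by (simp add: gauss_def mult_ac)
  have p2: "has_partial i (\<lambda>y. - ((y - x) \<bullet> i) / e) (\<lambda>y. - 1 / e)"
    using has_partial_mult[OF has_partial_inner[OF i, of x] has_partial_const[of _ "- 1 / e"]] by simp
  show "has_partial i (\<lambda>y. gauss e (y - x) * (- ((y - x) \<bullet> i) / e)) (\<lambda>y. gauss e (y - x) * (((y - x) \<bullet> i)\<^sup>2 / e\<^sup>2 - 1 / e))"
  proof -
    have "g * (- p / e) * (- p / e) + g * (- p / e) * 0 + g * (- 1 / e) = g * (p\<^sup>2 / e\<^sup>2 - 1 / e)" for g p :: real
      using e by (simp add: field_simps power2_eq_square)
    then have "g * (- p / e) * (- p / e) + g * (- 1 / e) = g * (p\<^sup>2 / e\<^sup>2 - 1 / e)" for g p :: real by simp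
    then show ?thesis using has_partial_mult[OF p1 p2] by (simp only:)
  qed
qed

text \<open>The heat equation in the variance: the difference in parentheses, times the Gaussian, is
  the sum over the basis of the second partials in \<open>gauss_partials\<close>, so the derivative
  is half the Laplacian.\<close>

lemma has_real_derivative_gauss:
  fixes z :: "'a::euclidean_space"
  assumes e: "0 < e"
  shows "((\<lambda>e. gauss e z) has_real_derivative gauss e z * (((norm z)\<^sup>2 / e\<^sup>2 - real DIM('a) / e) / 2)) (at e)"
proof -
  let ?h = "\<lambda>e. exp (- (real DIM('a) / 2) * ln (2 * pi * e) - (norm z)\<^sup>2 / (2 * e))"
  have eq: "?h e = gauss e z" if "0 < e" for e
    using that by (simp add: gauss_def powr_def mult_exp_exp)
  have "(?h has_real_derivative ?h e * (((norm z)\<^sup>2 / e\<^sup>2 - real DIM('a) / e) / 2)) (at e)"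
    using e by (auto intro!: derivative_eq_intros simp: field_simps power2_eq_square)
  then have "(?h has_real_derivative gauss e z * (((norm z)\<^sup>2 / e\<^sup>2 - real DIM('a) / e) / 2)) (at e)"
    using eq[OF e] by simp
  then show ?thesis
    by (rule has_field_derivative_transform_within_open[of _ _ _ "{0<..}"]) (use e eq in auto)
qed

lemma gauss_0_antimono:
  assumes "0 < d" "d \<le> e" shows "gauss e (0::'a::euclidean_space) \<le> gauss d (0::'a)"
  unfolding gauss_0 using assms by (intro powr_mono2') auto

text \<open>With \<open>w = norm z / sqrt e\<close> it comes down to
  \<open>w * exp (- (w\<^sup>2 / 2)) \<le> 1\<close>. The bound is uniform in
  \<open>e \<ge> d\<close> since the variance of the backward kernel varies with time.\<close>

lemma gauss_gradient_bound:
  fixes z :: "'a::euclidean_space"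
  assumes d: "0 < d" "d \<le> e" and i: "i \<in> Basis"
  shows "\<bar>gauss e z * (- (z \<bullet> i) / e)\<bar> \<le> gauss d (0::'a) / sqrt d"
proof -
  have e: "0 < e" using d by simp
  define w where "w = norm z / sqrt e"
  have w: "0 \<le> w" "w\<^sup>2 = (norm z)\<^sup>2 / e" using e by (auto simp: w_def power_divide)
  have "w \<le> 1 + w\<^sup>2 / 2" using zero_le_power2[of "w - 1"] by (simp add: power2_eq_square algebra_simps)
  also have "\<dots> \<le> exp (w\<^sup>2 / 2)" by (rule exp_ge_add_one_self)
  finally have "w * exp (- (w\<^sup>2 / 2)) \<le> 1" by (simp add: exp_minus field_simps)
  then have 1: "exp (- ((norm z)\<^sup>2 / (2 * e))) * (norm z / sqrt e) \<le> 1" using w by (simp add: w_def mult.commute)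
  have "\<bar>gauss e z * (- (z \<bullet> i) / e)\<bar> = gauss e z * (\<bar>z \<bullet> i\<bar> / e)" using e by (simp add: abs_mult)
  also have "\<dots> \<le> gauss e z * (norm z / e)"
    using Basis_le_norm[OF i, of z] e by (intro mult_left_mono divide_right_mono) auto
  also have "\<dots> = gauss e (0::'a) * (exp (- ((norm z)\<^sup>2 / (2 * e))) * (norm z / sqrt e)) / sqrt e"
  proof -
    have "norm z / e = (norm z / sqrt e) / sqrt e" using e by simp
    moreover have "gauss e z = gauss e (0::'a) * exp (- ((norm z)\<^sup>2 / (2 * e)))" by (simp add: gauss_def)
    ultimately show ?thesis by (simp only: times_divide_eq_right mult.assoc)
  qed
  also have "\<dots> \<le> gauss e (0::'a) * 1 / sqrt e"
    using e 1 by (intro divide_right_mono mult_left_mono) auto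
  also have "\<dots> \<le> gauss d (0::'a) / sqrt d"
    using d gauss_0_antimono[OF d, where 'a='a] by (intro frac_le) auto
  finally show ?thesis .
qed

text \<open>The transform of \<open>gauss d - gauss e\<close> is nonnegative, so the difference
  attains its largest absolute value at the origin. This compares kernels at two times uniformly in
  space.\<close>

lemma gauss_diff_le:
  fixes y :: "'a::euclidean_space"
  assumes d: "0 < d" "d \<le> e"
  shows "\<bar>gauss d y - gauss e y\<bar> \<le> gauss d (0::'a) - gauss e (0::'a)"
proof -
  let ?g = "\<lambda>e \<xi>::'a. exp (- (e * (norm \<xi>)\<^sup>2 / 2))"
  have e: "0 < e" using d by simp
  note h = gauss_fourier[OF d(1), where 'a='a] gauss_fourier[OF e, where 'a='a]
  have h0: "has_bochner_integral lebesgue (?g d) ((2 * pi) ^ DIM('a) * gauss d (0::'a))"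
    "has_bochner_integral lebesgue (?g e) ((2 * pi) ^ DIM('a) * gauss e (0::'a))"
    using h(1)[of 0] h(2)[of 0] by simp_all
  have g: "?g e \<xi> \<le> ?g d \<xi>" for \<xi> using d by (simp add: mult_right_mono)
  have "(2 * pi) ^ DIM('a) * (gauss d y - gauss e y) = (LINT \<xi>|lebesgue. (?g d \<xi> - ?g e \<xi>) * cos (y \<bullet> \<xi>))"
    using h(1)[of y] h(2)[of y] unfolding left_diff_distrib right_diff_distrib by (simp add: has_bochner_integral_iff)
  also have "\<bar>\<dots>\<bar> \<le> (LINT \<xi>|lebesgue. ?g d \<xi> - ?g e \<xi>)"
  proof (rule order.trans[OF integral_abs_bound integral_mono])
    show "integrable lebesgue (\<lambda>\<xi>. \<bar>(?g d \<xi> - ?g e \<xi>) * cos (y \<bullet> \<xi>)\<bar>)"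
      using h(1)[of y] h(2)[of y] unfolding left_diff_distrib by (simp add: has_bochner_integral_iff)
    show "integrable lebesgue (\<lambda>\<xi>. ?g d \<xi> - ?g e \<xi>)" using h0 by (simp add: has_bochner_integral_iff)
    show "\<bar>(?g d \<xi> - ?g e \<xi>) * cos (y \<bullet> \<xi>)\<bar> \<le> ?g d \<xi> - ?g e \<xi>" for \<xi>
      using g[of \<xi>] by (simp add: abs_mult mult_left_le)
  qed
  also have "\<dots> = (2 * pi) ^ DIM('a) * (gauss d (0::'a) - gauss e (0::'a))"
    using h0 unfolding right_diff_distrib by (simp add: has_bochner_integral_iff)
  finally show ?thesis by (simp add: abs_mult)
qed

text \<open>Half of the exponent is spent on the distance \<open>\<delta>\<close>; the other half is
  a Gaussian of doubled variance, whose normalisation differs by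
  \<open>2 powr (N / 2)\<close>.\<close>

lemma gauss_far_le:
  fixes z :: "'a::euclidean_space"
  assumes e: "0 < e" and z: "0 \<le> \<delta>" "\<delta> \<le> norm z"
  shows "gauss e z \<le> 2 powr (real DIM('a) / 2) * exp (- (\<delta>\<^sup>2 / (4 * e))) * gauss (2 * e) z"
proof -
  have p: "(2 * pi * e) powr (- (real DIM('a) / 2)) = 2 powr (real DIM('a) / 2) * (2 * pi * (2 * e)) powr (- (real DIM('a) / 2))"
  proof -
    have "(2 * pi * (2 * e)) powr (- (real DIM('a) / 2)) = (2 * (2 * pi * e)) powr (- (real DIM('a) / 2))" by (simp add: mult_ac)
    also have "\<dots> = 2 powr (- (real DIM('a) / 2)) * (2 * pi * e) powr (- (real DIM('a) / 2))"
      using e by (subst powr_mult) auto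
    finally show ?thesis by (simp add: mult.assoc[symmetric] powr_add[symmetric])
  qed
  have "\<delta>\<^sup>2 \<le> (norm z)\<^sup>2" using z by (intro power_mono)
  then have "- (norm z)\<^sup>2 / (2 * e) \<le> - (\<delta>\<^sup>2 / (4 * e)) + - (norm z)\<^sup>2 / (2 * (2 * e))"
    using e by (simp add: field_simps)
  then have "exp (- (norm z)\<^sup>2 / (2 * e)) \<le> exp (- (\<delta>\<^sup>2 / (4 * e))) * exp (- (norm z)\<^sup>2 / (2 * (2 * e)))"
    unfolding exp_add[symmetric] by (simp only: exp_le_cancel_iff)
  then have "2 powr (real DIM('a) / 2) * (2 * pi * (2 * e)) powr (- (real DIM('a) / 2)) * exp (- (norm z)\<^sup>2 / (2 * e))
     \<le> 2 powr (real DIM('a) / 2) * (2 * pi * (2 * e)) powr (- (real DIM('a) / 2)) * (exp (- (\<delta>\<^sup>2 / (4 * e))) * exp (- (norm z)\<^sup>2 / (2 * (2 * e))))"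
    by (rule mult_left_mono) simp
  then show ?thesis unfolding gauss_def p by (simp only: mult_ac)
qed

text \<open>An approximate identity for functions that change with \<open>e\<close> and are bounded
  only in \<open>L^1\<close>. Near \<open>x\<close> the joint continuity is used; far away the
  factor \<open>exp (- (\<delta>\<^sup>2 / (4 * e)))\<close> beats the growth of
  \<open>gauss (2 * e) 0\<close>.\<close>

lemma gauss_concentrates:
  fixes V :: "real \<Rightarrow> 'a::euclidean_space \<Rightarrow> real"
  assumes V: "\<And>e. 0 < e \<Longrightarrow> e < r \<Longrightarrow> integrable lebesgue (V e)" "\<And>e. 0 < e \<Longrightarrow> e < r \<Longrightarrow> (LINT y|lebesgue. \<bar>V e y\<bar>) \<le> C"
    and r: "0 < r"
    and L: "\<And>e. 0 < e \<Longrightarrow> e < r \<Longrightarrow> (LINT y|lebesgue. V e y * gauss e (y - x)) = L"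
    and cont: "\<And>\<epsilon>. 0 < \<epsilon> \<Longrightarrow> \<exists>\<delta>>0. \<forall>e y. 0 < e \<and> e < \<delta> \<and> dist y x < \<delta> \<longrightarrow> \<bar>V e y - v\<bar> \<le> \<epsilon>"
  shows "L = v"
proof -
  have "\<bar>L - v\<bar> \<le> \<epsilon>" if \<epsilon>: "0 < \<epsilon>" for \<epsilon>
  proof -
    obtain \<delta> where \<delta>: "0 < \<delta>" "\<And>e y. 0 < e \<Longrightarrow> e < \<delta> \<Longrightarrow> dist y x < \<delta> \<Longrightarrow> \<bar>V e y - v\<bar> \<le> \<epsilon>"
      using cont[OF \<epsilon>] by auto
    define n where "n = real DIM('a) / 2"
    let ?q = "\<lambda>e. 2 powr n * exp (- (\<delta>\<^sup>2 / (4 * e)))"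
    have b: "\<bar>L - v\<bar> \<le> \<epsilon> + ?q e * (C * gauss (2 * e) (0::'a) + \<bar>v\<bar>)" if e: "0 < e" "e < r" "e < \<delta>" for e
    proof -
      have gi: "has_bochner_integral lebesgue (\<lambda>y. gauss d (y - x)) 1" if "0 < d" for d
        using integrable_lebesgue_translate[of "gauss d" "- x"] integral_lebesgue_translate[of "gauss d" "- x"] gauss_integral[OF that, where 'a='a]
        by (simp add: has_bochner_integral_iff)
      have Vg: "integrable lebesgue (\<lambda>y. V e y * gauss e (y - x))"
      proof (rule integrable_mult_bounded[OF V(1)[OF e(1,2)], where K="gauss e (0::'a)"])
        show "(\<lambda>y. gauss e (y - x)) \<in> borel_measurable lebesgue" using gi[OF e(1)] by (auto simp: has_bochner_integral_iff)
      qed (use gauss_le_gauss_0[OF e(1)] in simp)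
      have h1: "L - v = (LINT y|lebesgue. (V e y - v) * gauss e (y - x))"
        using Vg gi[OF e(1)] L[OF e(1,2)] unfolding left_diff_distrib by (simp add: has_bochner_integral_iff)
      have h2: "\<bar>LINT y|lebesgue. (V e y - v) * gauss e (y - x)\<bar> \<le> (LINT y|lebesgue. \<epsilon> * gauss e (y - x) + ?q e * (\<bar>V e y\<bar> * gauss (2 * e) (0::'a) + \<bar>v\<bar> * gauss (2 * e) (y - x)))"
      proof (rule order.trans[OF integral_abs_bound integral_mono])
        show "integrable lebesgue (\<lambda>y. \<bar>(V e y - v) * gauss e (y - x)\<bar>)"
          using Vg gi[OF e(1)] unfolding left_diff_distrib by (simp add: has_bochner_integral_iff)
        show "integrable lebesgue (\<lambda>y. \<epsilon> * gauss e (y - x) + ?q e * (\<bar>V e y\<bar> * gauss (2 * e) (0::'a) + \<bar>v\<bar> * gauss (2 * e) (y - x)))"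
          using V(1)[OF e(1,2)] gi[OF e(1)] gi[of "2 * e"] e(1) by (simp add: has_bochner_integral_iff)
        fix y
        have ag: "\<bar>(V e y - v) * gauss e (y - x)\<bar> = \<bar>V e y - v\<bar> * gauss e (y - x)" by (simp add: abs_mult)
        show "\<bar>(V e y - v) * gauss e (y - x)\<bar> \<le> \<epsilon> * gauss e (y - x) + ?q e * (\<bar>V e y\<bar> * gauss (2 * e) (0::'a) + \<bar>v\<bar> * gauss (2 * e) (y - x))"
        proof (cases "dist y x < \<delta>")
          case True
          then have "\<bar>V e y - v\<bar> * gauss e (y - x) \<le> \<epsilon> * gauss e (y - x)"
            using \<delta>(2) e by (intro mult_right_mono) auto
          moreover have "0 \<le> ?q e * (\<bar>V e y\<bar> * gauss (2 * e) (0::'a) + \<bar>v\<bar> * gauss (2 * e) (y - x))"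
            by (intro mult_nonneg_nonneg add_nonneg_nonneg) auto
          ultimately show ?thesis unfolding ag by linarith
        next
          case False
          then have far: "gauss e (y - x) \<le> ?q e * gauss (2 * e) (y - x)"
            unfolding n_def by (intro gauss_far_le) (use e \<delta>(1) in \<open>auto simp: dist_norm\<close>)
          have "\<bar>V e y - v\<bar> * gauss e (y - x) \<le> (\<bar>V e y\<bar> + \<bar>v\<bar>) * (?q e * gauss (2 * e) (y - x))"
            using far by (intro mult_mono) auto
          also have "\<dots> = ?q e * (\<bar>V e y\<bar> * gauss (2 * e) (y - x) + \<bar>v\<bar> * gauss (2 * e) (y - x))" by (simp add: algebra_simps)
          also have "\<dots> \<le> ?q e * (\<bar>V e y\<bar> * gauss (2 * e) (0::'a) + \<bar>v\<bar> * gauss (2 * e) (y - x))"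
            using e gauss_le_gauss_0[of "2 * e" "y - x"] by (intro mult_left_mono add_right_mono) auto
          finally have "\<bar>V e y - v\<bar> * gauss e (y - x) \<le> \<dots>" .
          moreover have "0 \<le> \<epsilon> * gauss e (y - x)" using \<epsilon> by simp
          ultimately show ?thesis unfolding ag by linarith
        qed
      qed
      have h3: "(LINT y|lebesgue. \<epsilon> * gauss e (y - x) + ?q e * (\<bar>V e y\<bar> * gauss (2 * e) (0::'a) + \<bar>v\<bar> * gauss (2 * e) (y - x))) = \<epsilon> + ?q e * ((LINT y|lebesgue. \<bar>V e y\<bar>) * gauss (2 * e) (0::'a) + \<bar>v\<bar>)"
        using V(1)[OF e(1,2)] gi[OF e(1)] gi[of "2 * e"] e(1) by (simp add: has_bochner_integral_iff)
      have h4: "\<epsilon> + ?q e * ((LINT y|lebesgue. \<bar>V e y\<bar>) * gauss (2 * e) (0::'a) + \<bar>v\<bar>) \<le> \<epsilon> + ?q e * (C * gauss (2 * e) (0::'a) + \<bar>v\<bar>)"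
        by (intro add_left_mono mult_left_mono add_right_mono mult_right_mono V e) auto
      show ?thesis unfolding h1 by (rule order.trans[OF h2[unfolded h3] h4])
    qed
    have "((\<lambda>e. exp (- (\<delta>\<^sup>2 / (4 * e)))) \<longlongrightarrow> 0) (at_right 0)" using \<delta>(1) by real_asymp
    moreover have "((\<lambda>e. exp (- (\<delta>\<^sup>2 / (4 * e))) * gauss (2 * e) (0::'a)) \<longlongrightarrow> 0) (at_right 0)"
      unfolding gauss_0 using \<delta>(1) by real_asymp
    ultimately have "((\<lambda>e. \<epsilon> + 2 powr n * (C * (exp (- (\<delta>\<^sup>2 / (4 * e))) * gauss (2 * e) (0::'a)) + \<bar>v\<bar> * exp (- (\<delta>\<^sup>2 / (4 * e)))))
       \<longlongrightarrow> \<epsilon> + 2 powr n * (C * 0 + \<bar>v\<bar> * 0)) (at_right 0)"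
      by (intro tendsto_intros)
    then have lim: "((\<lambda>e. \<epsilon> + 2 powr n * (C * (exp (- (\<delta>\<^sup>2 / (4 * e))) * gauss (2 * e) (0::'a)) + \<bar>v\<bar> * exp (- (\<delta>\<^sup>2 / (4 * e)))))
       \<longlongrightarrow> \<epsilon>) (at_right 0)" by simp
    have "\<forall>\<^sub>F e in at_right 0. e \<in> {0<..<min r \<delta>}" using r \<delta>(1) by (intro eventually_at_right_real) auto
    then have "\<forall>\<^sub>F e in at_right 0. \<bar>L - v\<bar> \<le> \<epsilon> + 2 powr n * (C * (exp (- (\<delta>\<^sup>2 / (4 * e))) * gauss (2 * e) (0::'a)) + \<bar>v\<bar> * exp (- (\<delta>\<^sup>2 / (4 * e))))"
    proof eventually_elim
      case (elim e)
      then show ?case using b[of e] by (simp add: algebra_simps)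
    qed
    then show ?thesis using lim by (intro tendsto_lowerbound[OF lim]) auto
  qed
  then have "\<bar>L - v\<bar> \<le> 0" by (rule field_le_epsilon[where y=0, simplified])
  then show ?thesis by simp
qed

text \<open>For fixed \<open>x\<close> and \<open>T\<close>, the backward heat kernel \<open>gauss (2 a (T - s)) (y - x)\<close> is tested against
  \<open>U\<close> at time \<open>s\<close>.  The cutoff makes the integrations by parts legitimate and costs \<open>O(1 / R)\<close>, so that
  the pairing is constant in \<open>s\<close>; its limits at \<open>s = 0\<close> and \<open>s = T\<close> are the two sides of the claim.\<close>

lemma heat_solution_delta_eq:
  fixes U :: "'a::euclidean_space \<Rightarrow> real \<Rightarrow> real"
  assumes a: "0 < a" and U: "heat_solution_delta a M U" and T: "0 < T"
  shows "U x T = M * gauss (2 * a * T) x"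
proof -
  have cU: "continuous_on (UNIV \<times> {0<..}) (\<lambda>(x, t). U x t)"
    and cUt: "continuous_on (UNIV \<times> {0<..}) (\<lambda>(x, t). deriv (U x) t)"
    and C2: "\<And>t. 0 < t \<Longrightarrow> C_class 2 (\<lambda>x. U x t)"
    and he: "\<And>x t. 0 < t \<Longrightarrow> (U x has_real_derivative a * laplacian (\<lambda>y. U y t) x) (at t)"
    and Ui: "\<And>t. 0 < t \<Longrightarrow> integrable lebesgue (\<lambda>x. U x t)"
    and ini: "\<And>\<phi>. continuous_on UNIV \<phi> \<Longrightarrow> compact_support \<phi> \<Longrightarrow>
        ((\<lambda>t. LINT x|lebesgue. U x t * \<phi> x) \<longlongrightarrow> M * \<phi> 0) (at_right 0)"
    using U unfolding heat_solution_delta_def by auto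
  obtain C where C: "\<And>t. 0 < t \<Longrightarrow> (LINT x|lebesgue. \<bar>U x t\<bar>) \<le> C"
    using U unfolding heat_solution_delta_def by blast
  have C0: "0 \<le> C" using order.trans[OF _ C[OF T]] by simp
  have lap: "a * laplacian (\<lambda>y. U y t) y = deriv (U y) t" if "0 < t" for y t
    using DERIV_imp_deriv[OF he[OF that]] by simp
  have cUx: "continuous_on UNIV (\<lambda>y. U y t)" if "0 < t" for t
  proof -
    have "continuous_on UNIV (\<lambda>y::'a. (y, t))" by (intro continuous_intros)
    from continuous_on_compose2[OF cU this] that show ?thesis by force
  qed
  have cUtx: "continuous_on UNIV (\<lambda>y. deriv (U y) t)" if "0 < t" for t
  proof -
    have "continuous_on UNIV (\<lambda>y::'a. (y, t))" by (intro continuous_intros)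
    from continuous_on_compose2[OF cUt this] that show ?thesis by force
  qed
  \<comment> \<open>The variance left until time \<open>T\<close>; with it \<open>G\<close> solves
    the backward equation \<open>G_s = - a \<Delta>G\<close>.\<close>
  define E where "E s = 2 * a * (T - s)" for s
  have E: "0 < E s" if "s < T" for s using a that by (simp add: E_def)
  define G where "G s y = gauss (E s) (y - x)" for s y
  define G1 where "G1 i s y = gauss (E s) (y - x) * (- ((y - x) \<bullet> i) / E s)" for i s y
  define G2 where "G2 i s y = gauss (E s) (y - x) * (((y - x) \<bullet> i)\<^sup>2 / (E s)\<^sup>2 - 1 / E s)" for i s y
  define LG where "LG s y = gauss (E s) (y - x) * ((norm (y - x))\<^sup>2 / (E s)\<^sup>2 - real DIM('a) / E s)" for s y
  have sumG2: "(\<Sum>i\<in>Basis. G2 i s y) = LG s y" for s y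
  proof -
    have "(norm (y - x))\<^sup>2 = (\<Sum>i\<in>Basis. ((y - x) \<bullet> i)\<^sup>2)"
      unfolding power2_norm_eq_inner by (subst euclidean_inner) (simp add: power2_eq_square)
    then show ?thesis unfolding G2_def LG_def
      by (simp add: sum_distrib_left[symmetric] sum_subtractf sum_divide_distrib[symmetric])
  qed
  have cG: "continuous_on UNIV (G s)" "continuous_on UNIV (G1 i s)" "continuous_on UNIV (G2 i s)" for s i
    unfolding G_def[abs_def] G1_def[abs_def] G2_def[abs_def] divide_inverse
    by (intro continuous_intros continuous_on_compose2[OF continuous_on_gauss]; auto)+
  have cLG: "continuous_on UNIV (LG s)" for s
    unfolding LG_def[abs_def] divide_inverse
    by (intro continuous_intros continuous_on_compose2[OF continuous_on_gauss]) auto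
  define \<psi> where "\<psi> R s y = G s y * cutoff R y" for R s y
  define \<psi>s where "\<psi>s R s y = - a * LG s y * cutoff R y" for R s y
  define \<psi>1 where "\<psi>1 R s i y = G1 i s y * cutoff R y + G s y * cutoff1 R i y" for R s i y
  define \<psi>2 where "\<psi>2 R s i y = (G2 i s y * cutoff R y + G1 i s y * cutoff1 R i y) + (G1 i s y * cutoff1 R i y + G s y * cutoff2 R i y)" for R s i y
  \<comment> \<open>What the cutoff adds to the Laplacian of the test function. Every term contains
    a derivative of the cutoff, hence a factor \<open>1 / R\<close>.\<close>
  define err where "err R s y = (\<Sum>i\<in>Basis. 2 * (G1 i s y * cutoff1 R i y) + G s y * cutoff2 R i y)" for R s y
  have sum2: "(\<Sum>i\<in>Basis. \<psi>2 R s i y) = LG s y * cutoff R y + err R s y" for R s y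
  proof -
    have "\<psi>2 R s i y = G2 i s y * cutoff R y + (2 * (G1 i s y * cutoff1 R i y) + G s y * cutoff2 R i y)" for i
      by (simp add: \<psi>2_def)
    then show ?thesis by (simp only: err_def sum.distrib sumG2[symmetric] sum_distrib_right)
  qed
  have c\<psi>: "continuous_on UNIV (\<psi> R s)" "continuous_on UNIV (\<psi>s R s)" "continuous_on UNIV (\<psi>1 R s i)" "continuous_on UNIV (\<psi>2 R s i)"
    "continuous_on UNIV (err R s)" for R s i
    unfolding \<psi>_def[abs_def] \<psi>s_def[abs_def] \<psi>1_def[abs_def] \<psi>2_def[abs_def] err_def[abs_def]
    by (intro continuous_intros continuous_on_compose2[OF cG(1)] continuous_on_compose2[OF cG(2)] continuous_on_compose2[OF cG(3)]
      continuous_on_compose2[OF cLG] continuous_on_compose2[OF continuous_on_cutoff(1)] continuous_on_compose2[OF continuous_on_cutoff(2)]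
      continuous_on_compose2[OF continuous_on_cutoff(3)]; auto)+
  have p\<psi>: "has_partial i (\<psi> R s) (\<psi>1 R s i)" "has_partial i (\<psi>1 R s i) (\<psi>2 R s i)"
    if "i \<in> Basis" "0 < R" "s < T" for R s i
    unfolding \<psi>_def[abs_def] \<psi>1_def[abs_def] \<psi>2_def[abs_def] G_def G1_def G2_def
    by (intro has_partial_mult has_partial_add gauss_partials cutoff_partials E that)+
  have supp: "cutoff R y = 0" "cutoff1 R i y = 0" "cutoff2 R i y = 0" if "1 \<le> R" "\<not> norm y \<le> R" for R i and y :: 'a
    using cutoff_bounds(3,6,7)[OF that(1)] that(2) by blast+
  have s\<psi>: "\<psi> R s y \<noteq> 0 \<Longrightarrow> norm y \<le> R" "\<psi>s R s y \<noteq> 0 \<Longrightarrow> norm y \<le> R" "\<psi>1 R s i y \<noteq> 0 \<Longrightarrow> norm y \<le> R" "\<psi>2 R s i y \<noteq> 0 \<Longrightarrow> norm y \<le> R"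
    "err R s y \<noteq> 0 \<Longrightarrow> norm y \<le> R" if "1 \<le> R" for R s y i
    by (rule ccontr, simp add: \<psi>_def \<psi>s_def \<psi>1_def \<psi>2_def err_def supp[OF that])+
  define \<Phi> where "\<Phi> R s = (LINT y|lebesgue. U y s * \<psi> R s y)" for R s
  have ds: "((\<lambda>s. \<psi> R s y) has_real_derivative \<psi>s R s y) (at s)" if "s < T" for R s y
  proof -
    have 1: "((\<lambda>e. gauss e (y - x)) has_real_derivative gauss (E s) (y - x) * (((norm (y - x))\<^sup>2 / (E s)\<^sup>2 - real DIM('a) / E s) / 2)) (at (E s))"
      by (rule has_real_derivative_gauss[OF E[OF that]])
    have 2: "(E has_real_derivative - 2 * a) (at s)"
      unfolding E_def[abs_def] by (auto intro!: derivative_eq_intros)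
    have "((\<lambda>s. gauss (E s) (y - x) * cutoff R y) has_real_derivative
       (gauss (E s) (y - x) * (((norm (y - x))\<^sup>2 / (E s)\<^sup>2 - real DIM('a) / E s) / 2) * (- 2 * a)) * cutoff R y) (at s)"
      by (rule DERIV_cmult_right[OF DERIV_chain2[OF 1 2]])
    moreover have "(gauss (E s) (y - x) * (((norm (y - x))\<^sup>2 / (E s)\<^sup>2 - real DIM('a) / E s) / 2) * (- 2 * a)) * cutoff R y = \<psi>s R s y"
      by (simp add: \<psi>s_def LG_def)
    ultimately show ?thesis by (simp add: \<psi>_def[abs_def] G_def[abs_def])
  qed
  have d\<Phi>: "(\<Phi> R has_real_derivative a * (LINT y|lebesgue. U y s * err R s y)) (at s)"
    if R: "1 \<le> R" and s: "0 < s" "s < T" for R s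
  proof -
    \<comment> \<open>A closed interval of this radius around \<open>s\<close> stays inside
      \<open>(0, T)\<close>, so the integrand below is bounded on the compact set
      \<open>?S\<close>.\<close>
    define r where "r = min (s / 2) ((T - s) / 2)"
    have r: "0 < r" using s by (simp add: r_def)
    have rs: "0 < \<sigma> \<and> \<sigma> < T" if "\<bar>\<sigma> - s\<bar> \<le> r" for \<sigma>
    proof -
      have "r \<le> s / 2" "r \<le> (T - s) / 2" by (simp_all only: r_def min.cobounded1 min.cobounded2)
      then show ?thesis using that s by (auto simp: abs_le_iff)
    qed
    let ?D = "\<lambda>\<sigma> y. deriv (U y) \<sigma> * \<psi> R \<sigma> y + U y \<sigma> * \<psi>s R \<sigma> y"
    let ?S = "cball (0::'a) R \<times> {s - r..s + r}"
    have sub: "?S \<subseteq> UNIV \<times> {0<..}" using rs by (force simp: abs_le_iff)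
    have lt: "snd p < T" if "p \<in> ?S" for p using rs[of "snd p"] that by (auto simp: abs_le_iff mem_Times_iff)
    have cE: "continuous_on ?S (\<lambda>p. E (snd p))" unfolding E_def by (intro continuous_intros)
    have ne: "E (snd p) \<noteq> 0" if "p \<in> ?S" for p using E[OF lt[OF that]] by simp
    have cg: "continuous_on ?S (\<lambda>p. gauss (E (snd p)) (fst p - x))"
      unfolding gauss_def using ne by (intro continuous_intros cE) auto
    have "continuous_on ?S (\<lambda>p. ?D (snd p) (fst p))"
    proof (intro continuous_intros)
      show "continuous_on ?S (\<lambda>p. deriv (U (fst p)) (snd p))"
        using continuous_on_subset[OF cUt sub] by (simp add: case_prod_unfold)
      show "continuous_on ?S (\<lambda>p. U (fst p) (snd p))"
        using continuous_on_subset[OF cU sub] by (simp add: case_prod_unfold)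
      show "continuous_on ?S (\<lambda>p. \<psi> R (snd p) (fst p))"
        unfolding \<psi>_def G_def by (intro continuous_intros cg continuous_on_compose2[OF continuous_on_cutoff(1)]) auto
      show "continuous_on ?S (\<lambda>p. \<psi>s R (snd p) (fst p))"
        unfolding \<psi>s_def LG_def using ne
        by (intro continuous_intros cg cE continuous_on_compose2[OF continuous_on_cutoff(1)]) auto
    qed
    moreover have "compact ?S" by (intro compact_Times) auto
    ultimately have "bounded ((\<lambda>p. ?D (snd p) (fst p)) ` ?S)"
      by (intro compact_imp_bounded compact_continuous_image)
    then obtain K where K: "\<forall>z\<in>(\<lambda>p. ?D (snd p) (fst p)) ` ?S. norm z \<le> K"
      unfolding bounded_iff by blast
    have "((\<lambda>s. LINT y|lebesgue. U y s * \<psi> R s y) has_real_derivative (LINT y|lebesgue. ?D s y)) (at s)"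
    proof (rule has_real_derivative_integral[where r=r and w="\<lambda>y. \<bar>K\<bar> * indicat_real (cball (0::'a) R) y", OF r])
      show "integrable lebesgue (\<lambda>y. U y \<sigma> * \<psi> R \<sigma> y)" if "\<bar>\<sigma> - s\<bar> < r" for \<sigma>
        using rs[of \<sigma>] that
        by (intro integrable_continuous_bounded_support[where \<rho>=R] continuous_on_mult cUx c\<psi>) (auto intro: s\<psi>(1)[OF R])
      show "?D s \<in> borel_measurable lebesgue"
        using s by (intro continuous_imp_lebesgue_measurable continuous_intros cUx cUtx c\<psi>)
      show "integrable lebesgue (\<lambda>y. \<bar>K\<bar> * indicat_real (cball (0::'a) R) y)"
        using lmeasurable_cball lmeasurable_iff_integrable by (intro integrable_mult_right) blast
      show "AE y in lebesgue. \<forall>\<sigma>. \<bar>\<sigma> - s\<bar> < r \<longrightarrow>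
          ((\<lambda>s. U y s * \<psi> R s y) has_real_derivative ?D \<sigma> y) (at \<sigma>) \<and> \<bar>?D \<sigma> y\<bar> \<le> \<bar>K\<bar> * indicat_real (cball (0::'a) R) y"
      proof (intro AE_I2 allI impI conjI)
        fix y \<sigma> assume \<sigma>: "\<bar>\<sigma> - s\<bar> < r"
        then have \<sigma>': "0 < \<sigma>" "\<sigma> < T" using rs[of \<sigma>] by auto
        have "(U y has_real_derivative deriv (U y) \<sigma>) (at \<sigma>)" using he[OF \<sigma>'(1), of y] lap[OF \<sigma>'(1), of y] by simp
        from DERIV_mult[OF this ds[OF \<sigma>'(2), of R y]]
        show "((\<lambda>s. U y s * \<psi> R s y) has_real_derivative ?D \<sigma> y) (at \<sigma>)" by (simp add: mult.commute add.commute)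
        show "\<bar>?D \<sigma> y\<bar> \<le> \<bar>K\<bar> * indicat_real (cball (0::'a) R) y"
        proof (cases "norm y \<le> R")
          case True
          have "(y, \<sigma>) \<in> ?S" using True \<sigma> by (auto simp: abs_less_iff)
          from K[rule_format, OF imageI[OF this]] show ?thesis using True by simp
        next
          case False
          then have "\<psi> R \<sigma> y = 0" "\<psi>s R \<sigma> y = 0" using s\<psi>(1,2)[OF R, of \<sigma> y] by blast+
          then show ?thesis by simp
        qed
      qed
    qed
    moreover have "(LINT y|lebesgue. ?D s y) = a * (LINT y|lebesgue. U y s * err R s y)"
    proof -
      have R0: "0 < R" using R by simp
      have ibp: "(LINT y|lebesgue. laplacian (\<lambda>y. U y s) y * \<psi> R s y) = (LINT y|lebesgue. U y s * (\<Sum>i\<in>Basis. \<psi>2 R s i y))"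
        and il: "integrable lebesgue (\<lambda>y. laplacian (\<lambda>y. U y s) y * \<psi> R s y)"
      proof -
        have p: "\<And>i. i \<in> Basis \<Longrightarrow> has_partial i (\<psi> R s) (\<psi>1 R s i)" "\<And>i. i \<in> Basis \<Longrightarrow> has_partial i (\<psi>1 R s i) (\<psi>2 R s i)"
          using p\<psi>[OF _ R0 s(2)] by blast+
        have q: "\<And>y. \<psi> R s y \<noteq> 0 \<Longrightarrow> norm y \<le> R" "\<And>y i. i \<in> Basis \<Longrightarrow> \<psi>1 R s i y \<noteq> 0 \<Longrightarrow> norm y \<le> R"
          "\<And>y i. i \<in> Basis \<Longrightarrow> \<psi>2 R s i y \<noteq> 0 \<Longrightarrow> norm y \<le> R"
          using s\<psi>(1,3,4)[OF R] by blast+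
        show "(LINT y|lebesgue. laplacian (\<lambda>y. U y s) y * \<psi> R s y) = (LINT y|lebesgue. U y s * (\<Sum>i\<in>Basis. \<psi>2 R s i y))"
          "integrable lebesgue (\<lambda>y. laplacian (\<lambda>y. U y s) y * \<psi> R s y)"
          by (rule integral_laplacian_by_parts[where \<rho>=R, OF C2[OF s(1)] p c\<psi>(1) c\<psi>(3) c\<psi>(4) q]; assumption)+
      qed
      have i1: "integrable lebesgue (\<lambda>y. U y s * (LG s y * cutoff R y))"
        using supp[OF R] s by (intro integrable_continuous_bounded_support[where \<rho>=R] continuous_on_mult cUx cLG continuous_on_cutoff) auto
      have i2: "integrable lebesgue (\<lambda>y. U y s * err R s y)"
        using s by (intro integrable_continuous_bounded_support[where \<rho>=R] continuous_on_mult cUx c\<psi>) (auto intro: s\<psi>(5)[OF R])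
      have "?D s y = a * (laplacian (\<lambda>y. U y s) y * \<psi> R s y) - a * (U y s * (LG s y * cutoff R y))" for y
        using lap[OF s(1), of y] by (simp add: \<psi>s_def mult.assoc[symmetric])
      \<comment> \<open>By \<open>sum2\<close> the Laplacian of the kernel occurs with both signs;
        after cancellation only \<open>err\<close> is left.\<close>
      then have "(LINT y|lebesgue. ?D s y) = a * (LINT y|lebesgue. U y s * (LG s y * cutoff R y + err R s y)) - a * (LINT y|lebesgue. U y s * (LG s y * cutoff R y))"
        using il i1 ibp by (simp add: sum2)
      also have "\<dots> = a * (LINT y|lebesgue. U y s * err R s y)"
        unfolding distrib_left using i1 i2 by (simp add: algebra_simps)
      finally show ?thesis .
    qed
    ultimately show ?thesis by (simp add: \<Phi>_def[abs_def])
  qed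
  have const: "(LINT y|lebesgue. U y s * G s y) = M * gauss (2 * a * T) x" if s: "0 < s" "s < T" for s
  proof -
    \<comment> \<open>The variance decreases in time, so its value at \<open>s\<close> controls the
      kernel and its gradient at all earlier times.\<close>
    define d where "d = E s"
    have d: "0 < d" using E[OF s(2)] by (simp add: d_def)
    have dE: "d \<le> E \<sigma>" if "\<sigma> \<le> s" for \<sigma> using a that by (simp add: d_def E_def mult_left_mono)
    define g where "g = gauss d (0::'a)"
    have g0: "0 \<le> g" by (simp add: g_def)
    define K where "K = real DIM('a) * (12 * (g / sqrt d) + 30 * g)"
    have errb: "\<bar>err R \<sigma> y\<bar> \<le> K / R" if R: "1 \<le> R" and \<sigma>: "\<sigma> \<le> s" for R \<sigma> y
    proof -
      have "\<bar>err R \<sigma> y\<bar> \<le> (\<Sum>i\<in>(Basis::'a set). 2 * ((g / sqrt d) * (6 / R)) + g * (30 / R))"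
        unfolding err_def
      proof (rule order.trans[OF sum_abs sum_mono])
        fix i :: 'a assume i: "i \<in> Basis"
        have 1: "\<bar>G1 i \<sigma> y\<bar> \<le> g / sqrt d"
          unfolding G1_def g_def by (rule gauss_gradient_bound[OF d dE[OF \<sigma>] i])
        have "E \<sigma> > 0" using dE[OF \<sigma>] d by linarith
        then have 2: "\<bar>G \<sigma> y\<bar> \<le> g"
          using order.trans[OF gauss_le_gauss_0 gauss_0_antimono[OF d dE[OF \<sigma>]], of "y - x"] by (simp add: G_def g_def)
        have "\<bar>G1 i \<sigma> y * cutoff1 R i y\<bar> \<le> (g / sqrt d) * (6 / R)"
          unfolding abs_mult using 1 cutoff_bounds(4)[OF R i, of y] by (intro mult_mono) (use g0 d in auto)
        moreover have "\<bar>G \<sigma> y * cutoff2 R i y\<bar> \<le> g * (30 / R)"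
          unfolding abs_mult using 2 cutoff_bounds(5)[OF R i, of y] by (intro mult_mono) (use g0 d in auto)
        ultimately show "\<bar>2 * (G1 i \<sigma> y * cutoff1 R i y) + G \<sigma> y * cutoff2 R i y\<bar> \<le> 2 * ((g / sqrt d) * (6 / R)) + g * (30 / R)"
          by linarith
      qed
      also have "\<dots> = K / R" by (simp add: K_def algebra_simps add_divide_distrib)
      finally show ?thesis .
    qed
    have K0: "0 \<le> K" using g0 d by (simp add: K_def)
    have fin: "\<bar>\<Phi> R s - M * gauss (2 * a * T) x\<bar> \<le> a * (C * (K / R)) * s" if R: "1 \<le> R" for R
    proof -
      have step: "\<bar>\<Phi> R s - \<Phi> R \<sigma>\<bar> \<le> a * (C * (K / R)) * s" if \<sigma>: "0 < \<sigma>" "\<sigma> < s" for \<sigma>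
      proof -
        have "norm (\<Phi> R s - \<Phi> R \<sigma>) \<le> a * (C * (K / R)) * norm (s - \<sigma>)"
        proof (rule field_differentiable_bound[of "{\<sigma>..s}"])
          fix z assume z: "z \<in> {\<sigma>..s}"
          then have z': "0 < z" "z < T" using \<sigma> s by auto
          show "(\<Phi> R has_field_derivative a * (LINT y|lebesgue. U y z * err R z y)) (at z within {\<sigma>..s})"
            by (rule has_field_derivative_at_within[OF d\<Phi>[OF R z']])
          have "\<bar>LINT y|lebesgue. U y z * err R z y\<bar> \<le> (LINT y|lebesgue. \<bar>U y z\<bar> * (K / R))"
          proof (rule order.trans[OF integral_abs_bound integral_mono])
            show "\<bar>U y z * err R z y\<bar> \<le> \<bar>U y z\<bar> * (K / R)" for y
              unfolding abs_mult using errb[OF R, of z y] z by (intro mult_left_mono) auto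
            show "integrable lebesgue (\<lambda>y. \<bar>U y z * err R z y\<bar>)"
              using z' by (intro integrable_abs integrable_continuous_bounded_support[where \<rho>=R] continuous_on_mult cUx c\<psi>) (auto intro: s\<psi>(5)[OF R])
          qed (use Ui[OF z'(1)] in auto)
          also have "\<dots> \<le> C * (K / R)" using C[OF z'(1)] K0 R by (simp add: divide_right_mono mult_right_mono)
          finally have "\<bar>a\<bar> * \<bar>LINT y|lebesgue. U y z * err R z y\<bar> \<le> \<bar>a\<bar> * (C * (K / R))"
            by (rule mult_left_mono) simp
          then show "norm (a * (LINT y|lebesgue. U y z * err R z y)) \<le> a * (C * (K / R))"
            using a by (simp only: real_norm_def abs_mult abs_of_pos)
        qed (use \<sigma> in auto)
        also have "\<dots> \<le> a * (C * (K / R)) * s" using a C0 K0 R \<sigma> by (intro mult_left_mono) auto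
        finally show ?thesis by simp
      qed
      \<comment> \<open>The initial condition speaks of a fixed test function, whereas
        \<open>\<psi> R s\<close> moves with \<open>s\<close>. The kernel is frozen at time
        \<open>0\<close>; by \<open>gauss_diff_le\<close> and the \<open>L^1\<close> bound on
        \<open>U\<close> the change tends to \<open>0\<close>.\<close>
      have lim0: "(\<Phi> R \<longlongrightarrow> M * gauss (2 * a * T) x) (at_right 0)"
      proof -
        let ?\<phi> = "\<lambda>y. gauss (E 0) (y - x) * cutoff R y"
        have c\<phi>: "continuous_on UNIV ?\<phi>" using c\<psi>(1)[of R 0] by (simp add: \<psi>_def[abs_def] G_def)
        have "compact_support ?\<phi>"
        proof -
          have "support_on UNIV ?\<phi> \<subseteq> cball 0 R" using s\<psi>(1)[OF R, of 0] by (auto simp: support_on_def \<psi>_def G_def)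
          then have "closure (support_on UNIV ?\<phi>) \<subseteq> cball 0 R" by (rule closure_minimal) simp
          then show ?thesis unfolding compact_support_def by (metis closed_closure compact_cball compact_Int_closed inf.absorb_iff2)
        qed
        from ini[OF c\<phi> this] have A: "((\<lambda>t. LINT y|lebesgue. U y t * ?\<phi> y) \<longlongrightarrow> M * gauss (2 * a * T) x) (at_right 0)"
          by (simp add: E_def cutoff_def)
        have B: "((\<lambda>t. \<Phi> R t - (LINT y|lebesgue. U y t * ?\<phi> y)) \<longlongrightarrow> 0) (at_right 0)"
        proof (rule Lim_null_comparison)
          have "\<forall>\<^sub>F t in at_right 0. t \<in> {0<..<T}" using T by (intro eventually_at_right_real)
          then show "\<forall>\<^sub>F t in at_right 0. norm (\<Phi> R t - (LINT y|lebesgue. U y t * ?\<phi> y)) \<le> C * (gauss (E t) (0::'a) - gauss (E 0) (0::'a))"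
          proof eventually_elim
            case (elim t)
            then have t: "0 < t" "t < T" by auto
            have Et: "0 < E t" "E t \<le> E 0" using E[OF t(2)] a t by (auto simp: E_def mult_left_mono)
            define D where "D = gauss (E t) (0::'a) - gauss (E 0) (0::'a)"
            have i1: "integrable lebesgue (\<lambda>y. U y t * \<psi> R t y)" "integrable lebesgue (\<lambda>y. U y t * ?\<phi> y)"
              using t by (intro integrable_continuous_bounded_support[where \<rho>=R] continuous_on_mult cUx c\<psi> c\<phi>; use supp[OF R] in \<open>auto simp: \<psi>_def\<close>)+
            have "\<Phi> R t - (LINT y|lebesgue. U y t * ?\<phi> y) = (LINT y|lebesgue. U y t * \<psi> R t y - U y t * ?\<phi> y)"
              using i1 by (simp add: \<Phi>_def)
            also have "\<bar>\<dots>\<bar> \<le> (LINT y|lebesgue. \<bar>U y t\<bar> * D)"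
            proof (rule order.trans[OF integral_abs_bound integral_mono])
              fix y
              have "\<bar>gauss (E t) (y - x) - gauss (E 0) (y - x)\<bar> * cutoff R y \<le> D * 1"
                using gauss_diff_le[OF Et, of "y - x"] cutoff_bounds(1,2)[OF R, of y] by (intro mult_mono) (auto simp: D_def)
              then have "\<bar>U y t\<bar> * (\<bar>gauss (E t) (y - x) - gauss (E 0) (y - x)\<bar> * cutoff R y) \<le> \<bar>U y t\<bar> * D"
                by (intro mult_left_mono) auto
              moreover have "U y t * \<psi> R t y - U y t * ?\<phi> y = U y t * ((gauss (E t) (y - x) - gauss (E 0) (y - x)) * cutoff R y)"
                by (simp add: \<psi>_def G_def algebra_simps)
              ultimately show "\<bar>U y t * \<psi> R t y - U y t * ?\<phi> y\<bar> \<le> \<bar>U y t\<bar> * D"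
                using cutoff_bounds(1)[OF R, of y] by (simp add: abs_mult)
            qed (use i1 Ui[OF t(1)] in auto)
            also have "\<dots> \<le> C * D"
              using C[OF t(1)] gauss_0_antimono[OF Et, where 'a='a] by (simp add: D_def mult_right_mono)
            finally show ?case by (simp add: D_def)
          qed
          have "isCont (\<lambda>e. gauss e (0::'a)) (E 0)" using has_real_derivative_gauss[OF E[OF T]] DERIV_isCont by blast
          moreover have "(E \<longlongrightarrow> E 0) (at_right 0)" unfolding E_def by (intro tendsto_intros)
          ultimately have "((\<lambda>t. gauss (E t) (0::'a)) \<longlongrightarrow> gauss (E 0) (0::'a)) (at_right 0)" by (rule isCont_tendsto_compose)
          then have "((\<lambda>t. C * (gauss (E t) (0::'a) - gauss (E 0) (0::'a))) \<longlongrightarrow> C * (gauss (E 0) (0::'a) - gauss (E 0) (0::'a))) (at_right 0)"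
            by (intro tendsto_intros)
          then show "((\<lambda>t. C * (gauss (E t) (0::'a) - gauss (E 0) (0::'a))) \<longlongrightarrow> 0) (at_right 0)" by simp
        qed
        from tendsto_add[OF A B] show ?thesis by simp
      qed
      have "((\<lambda>\<sigma>. \<bar>\<Phi> R s - \<Phi> R \<sigma>\<bar>) \<longlongrightarrow> \<bar>\<Phi> R s - M * gauss (2 * a * T) x\<bar>) (at_right 0)" by (intro tendsto_intros lim0)
      moreover have "\<forall>\<^sub>F \<sigma> in at_right 0. \<sigma> \<in> {0<..<s}" using s by (intro eventually_at_right_real)
      then have "\<forall>\<^sub>F \<sigma> in at_right 0. \<bar>\<Phi> R s - \<Phi> R \<sigma>\<bar> \<le> a * (C * (K / R)) * s"
        by eventually_elim (use step in auto)
      ultimately show ?thesis by (intro tendsto_upperbound[of _ _ "at_right 0"]) auto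
    qed
    \<comment> \<open>Letting the cutoff radius grow along \<open>real n + 1\<close>, which respects
      \<open>1 \<le> R\<close>, removes the error term.\<close>
    have l1: "(\<lambda>n. \<Phi> (real n + 1) s) \<longlonglongrightarrow> M * gauss (2 * a * T) x"
    proof (rule LIM_zero_cancel, rule Lim_null_comparison)
      show "\<forall>\<^sub>F n in sequentially. norm (\<Phi> (real n + 1) s - M * gauss (2 * a * T) x) \<le> a * C * K * s * (1 / (real n + 1))"
        using fin by (intro always_eventually allI) (auto simp: mult_ac)
      have "(\<lambda>n. 1 / (real n + 1)) \<longlonglongrightarrow> 0" by real_asymp
      then show "(\<lambda>n. a * C * K * s * (1 / (real n + 1))) \<longlonglongrightarrow> 0" by (rule tendsto_mult_right_zero)
    qed
    have l2: "(\<lambda>n. \<Phi> (real n + 1) s) \<longlonglongrightarrow> (LINT y|lebesgue. U y s * G s y)"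
      unfolding \<Phi>_def
    proof (rule integral_dominated_convergence[where w="\<lambda>y. \<bar>U y s\<bar> * gauss (E s) (0::'a)"])
      show "(\<lambda>y. U y s * G s y) \<in> borel_measurable lebesgue" "(\<lambda>y. U y s * \<psi> (real n + 1) s y) \<in> borel_measurable lebesgue" for n
        using s by (intro continuous_imp_lebesgue_measurable continuous_on_mult cUx cG c\<psi>; simp)+
      show "integrable lebesgue (\<lambda>y. \<bar>U y s\<bar> * gauss (E s) (0::'a))" using Ui[OF s(1)] by simp
      show "AE y in lebesgue. (\<lambda>n. U y s * \<psi> (real n + 1) s y) \<longlonglongrightarrow> U y s * G s y"
      proof (intro AE_I2 tendsto_intros)
        fix y :: 'a
        have "(\<lambda>n. 1 / (real n + 1)\<^sup>2) \<longlonglongrightarrow> 0" by real_asymp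
        then have "(\<lambda>n. cutoff (real n + 1) y) \<longlonglongrightarrow> (max 0 (1 - (norm y)\<^sup>2 * 0)) ^ 3"
          unfolding cutoff_def divide_inverse by (intro tendsto_intros) (simp add: inverse_eq_divide)
        then have "(\<lambda>n. G s y * cutoff (real n + 1) y) \<longlonglongrightarrow> G s y * 1" by (intro tendsto_intros) simp
        then show "(\<lambda>n. \<psi> (real n + 1) s y) \<longlonglongrightarrow> G s y" by (simp add: \<psi>_def)
      qed
      show "AE y in lebesgue. norm (U y s * \<psi> (real n + 1) s y) \<le> \<bar>U y s\<bar> * gauss (E s) (0::'a)" for n
      proof (intro AE_I2)
        fix y
        have "\<bar>\<psi> (real n + 1) s y\<bar> \<le> gauss (E s) (0::'a) * 1"
          unfolding \<psi>_def G_def abs_mult using gauss_le_gauss_0[OF E[OF s(2)], of "y - x"] cutoff_bounds(1,2)[of "real n + 1" y]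
          by (intro mult_mono) auto
        then show "norm (U y s * \<psi> (real n + 1) s y) \<le> \<bar>U y s\<bar> * gauss (E s) (0::'a)"
          by (simp add: abs_mult mult_left_mono)
      qed
    qed
    show ?thesis by (rule LIMSEQ_unique[OF l2 l1])
  qed
  have "M * gauss (2 * a * T) x = U x T"
  \<comment> \<open>Time is reparametrised by the remaining variance \<open>e\<close>, that is
    \<open>s = T - e / (2 * a)\<close>, so that \<open>s\<close> tending to \<open>T\<close> becomes
    \<open>e\<close> tending to \<open>0\<close>.\<close>
  proof (rule gauss_concentrates[where V="\<lambda>e y. U y (T - e / (2 * a))" and r="2 * a * T" and C=C and x=x])
    have pos: "0 < T - e / (2 * a)" "T - e / (2 * a) < T" if "0 < e" "e < 2 * a * T" for e
      using that a by (auto simp: field_simps)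
    show "0 < 2 * a * T" using a T by simp
    fix e assume e: "0 < e" "e < 2 * a * T"
    show "integrable lebesgue (\<lambda>y. U y (T - e / (2 * a)))" by (rule Ui[OF pos(1)[OF e]])
    show "(LINT y|lebesgue. \<bar>U y (T - e / (2 * a))\<bar>) \<le> C" by (rule C[OF pos(1)[OF e]])
    have "E (T - e / (2 * a)) = e" using a by (simp add: E_def)
    then show "(LINT y|lebesgue. U y (T - e / (2 * a)) * gauss e (y - x)) = M * gauss (2 * a * T) x"
      using const[OF pos[OF e]] by (simp add: G_def)
  next
    fix \<epsilon> :: real assume \<epsilon>: "0 < \<epsilon>"
    have "continuous (at (x, T)) (\<lambda>(x, t). U x t)"
      using cU T by (subst (asm) continuous_on_eq_continuous_at) (auto intro: open_Times)
    then obtain \<delta> where \<delta>: "0 < \<delta>" "\<And>p. dist p (x, T) < \<delta> \<Longrightarrow> dist (case p of (x, t) \<Rightarrow> U x t) (U x T) < \<epsilon>"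
      using \<epsilon> unfolding continuous_at_eps_delta by (metis case_prod_conv)
    show "\<exists>\<delta>>0. \<forall>e y. 0 < e \<and> e < \<delta> \<and> dist y x < \<delta> \<longrightarrow> \<bar>U y (T - e / (2 * a)) - U x T\<bar> \<le> \<epsilon>"
    \<comment> \<open>\<open>e < a * \<delta>\<close> keeps the time offset
      \<open>e / (2 * a)\<close> below \<open>\<delta> / 2\<close>; the other half of
      \<open>\<delta>\<close> is for the point \<open>y\<close>.\<close>
    proof (intro exI[of _ "min (\<delta> / 2) (a * \<delta>)"] conjI allI impI)
      show "0 < min (\<delta> / 2) (a * \<delta>)" using \<delta> a by simp
      fix e y assume ey: "0 < e \<and> e < min (\<delta> / 2) (a * \<delta>) \<and> dist y x < min (\<delta> / 2) (a * \<delta>)"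
      have "dist (y, T - e / (2 * a)) (x, T) \<le> dist y x + dist (T - e / (2 * a)) T"
        unfolding dist_Pair_Pair by (rule sqrt_sum_squares_le_sum) auto
      also have "dist (T - e / (2 * a)) T = e / (2 * a)" using ey a by (simp add: dist_real_def)
      also have "e / (2 * a) < \<delta> / 2" using ey a by (simp add: field_simps)
      also have "dist y x + \<delta> / 2 < \<delta>" using ey by simp
      finally have "dist (y, T - e / (2 * a)) (x, T) < \<delta>" by simp
      from \<delta>(2)[OF this] show "\<bar>U y (T - e / (2 * a)) - U x T\<bar> \<le> \<epsilon>" by (simp add: dist_real_def)
    qed
  qed
  then show ?thesis by simp
qed

section \<open>Solutions with absorption\<close>

text \<open>A normal form of the solution: sign, bound and measurability hold without exception,
  continuity and the equation off \<open>Z\<close>. As \<open>J\<close> has integral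
  \<open>1\<close>, the nonlocal term is written as \<open>conv\<close> minus the identity.\<close>

locale absorption_solution = dispersal_kernel J \<a>
  for J :: "'a::euclidean_space \<Rightarrow> real" and \<a> :: real +
  fixes p B :: real and Z :: "'a set" and u :: "'a \<Rightarrow> real \<Rightarrow> real"
  assumes p_gt_1: "1 < p"
    and negligible_Z: "negligible Z"
    and u_nonneg: "0 \<le> u x t"
    and u_bounded: "u x t \<le> B"
    and u_measurable: "(\<lambda>x. u x t) \<in> borel_measurable lebesgue"
    and u_continuous: "x \<notin> Z \<Longrightarrow> continuous_on {0..} (u x)"
    and u_equation: "x \<notin> Z \<Longrightarrow> 0 < t \<Longrightarrow>
      (u x has_real_derivative conv (\<lambda>y. u y t) x - u x t - u x t powr p) (at t)"
    and u_initial_integrable: "integrable lebesgue (\<lambda>x. u x 0)"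
begin

lemma B_nonneg: "0 \<le> B"
  using u_nonneg[of undefined 0] u_bounded[of undefined 0] by linarith

lemma abs_u_le: "\<bar>u x t\<bar> \<le> B"
  using u_nonneg u_bounded by simp

text \<open>Since \<open>u\<close> is bounded, absorption is at most a constant multiple of
  \<open>u\<close> and inherits integrability and domination from it.\<close>

lemma u_powr_le: "u x t powr p \<le> B powr (p - 1) * u x t"
proof (cases "u x t = 0")
  case False
  then have "u x t powr p = u x t powr (p - 1) * u x t"
    using u_nonneg[of x t] by (simp add: powr_diff)
  also have "\<dots> \<le> B powr (p - 1) * u x t"
    using p_gt_1 u_nonneg[of x t] u_bounded[of x t] by (intro mult_right_mono powr_mono2) auto
  finally show ?thesis .
qed simp

lemma integrable_conv_u: "integrable lebesgue (\<lambda>y. J (x - y) * u y t)"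
  by (rule integrable_conv_bounded[OF u_measurable abs_u_le])

lemma subsolution_u:
  assumes "0 \<le> t0" shows "subsolution Z T (\<lambda>t x. u x (t0 + t))"
  unfolding subsolution_def
proof (intro conjI ballI allI impI)
  show "(\<lambda>x. u x (t0 + t)) \<in> borel_measurable lebesgue" for t by (rule u_measurable)
  show "\<exists>K. \<forall>t\<in>{0..T}. \<forall>x. \<bar>u x (t0 + t)\<bar> \<le> K" using abs_u_le by blast
  show "continuous_on {0..T} (\<lambda>t. u x (t0 + t))" if "x \<notin> Z" for x
    by (rule continuous_on_compose2[OF u_continuous[OF that]]) (use assms in \<open>auto intro!: continuous_intros\<close>)
  fix x t assume x: "x \<notin> Z" and t: "t \<in> {0<..<T}"
  have "((\<lambda>t. u x (t0 + t)) has_real_derivative conv (\<lambda>y. u y (t0 + t)) x - u x (t0 + t) - u x (t0 + t) powr p) (at t)"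
    using u_equation[OF x, of "t0 + t"] assms t DERIV_shift[of "u x" _ t t0] by (simp add: add.commute)
  then show "\<exists>d. ((\<lambda>t. u x (t0 + t)) has_real_derivative d) (at t) \<and> d \<le> conv (\<lambda>x. u x (t0 + t)) x - u x (t0 + t)"
    by force
qed

text \<open>The notion of solution asks for no integrability at positive times; it propagates from
  the initial datum because \<open>u\<close> is a subsolution of the linear equation.\<close>

lemma integrable_u:
  assumes "0 \<le> t" shows "integrable lebesgue (\<lambda>x. u x t)"
  using subsolution_mass(1)[OF subsolution_u[of 0 t] negligible_Z u_nonneg u_initial_integrable abs_u_le u_nonneg, of t] assms
  by simp

section \<open>Balance of mass\<close>

definition mass :: "real \<Rightarrow> real" where "mass t = (LINT x|lebesgue. u x t)"

definition absorbed :: "real \<Rightarrow> real" where "absorbed t = (LINT x|lebesgue. u x t powr p)"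

lemma mass_nonneg: "0 \<le> mass t" and absorbed_nonneg: "0 \<le> absorbed t"
  unfolding mass_def absorbed_def using u_nonneg by auto

text \<open>The rate at which \<open>u\<close> can fall: by \<open>u_powr_le\<close> the loss
  \<open>u + u powr p\<close> is at most \<open>growth * u\<close>.\<close>

definition growth :: real where "growth = 1 + B powr (p - 1)"

lemma growth_pos: "0 < growth" by (simp add: growth_def add_pos_nonneg)

text \<open>The function \<open>exp (growth t) * u x t\<close> increases in \<open>t\<close>, so that \<open>u\<close> at a later time dominates
  \<open>u\<close> at all earlier times up to a constant.\<close>

lemma u_dominated:
  assumes x: "x \<notin> Z" and t: "0 \<le> s" "s \<le> b"
  shows "u x s \<le> exp (growth * b) * u x b"
proof -
  let ?h = "\<lambda>r. exp (growth * r) * u x r"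
  have "?h s \<le> ?h b"
  proof (rule DERIV_nonneg_imp_increasing_open[OF t(2)])
    have "continuous_on {s..b} (u x)" by (rule continuous_on_subset[OF u_continuous[OF x]]) (use t in auto)
    then show "continuous_on {s..b} ?h" by (intro continuous_intros)
    fix r assume r: "s < r" "r < b"
    then have r0: "0 < r" using t by simp
    have "(?h has_real_derivative exp (growth * r) * (growth * u x r + (conv (\<lambda>y. u y r) x - u x r - u x r powr p))) (at r)"
      by (auto intro!: derivative_eq_intros u_equation[OF x r0] simp: algebra_simps)
    moreover have "0 \<le> conv (\<lambda>y. u y r) x" unfolding conv_def using u_nonneg by simp
    then have "0 \<le> growth * u x r + (conv (\<lambda>y. u y r) x - u x r - u x r powr p)"
      using u_powr_le[of x r] by (simp add: growth_def algebra_simps)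
    ultimately show "\<exists>y. (?h has_real_derivative y) (at r) \<and> 0 \<le> y" by force
  qed
  moreover have "u x s \<le> ?h s" using growth_pos t u_nonneg[of x s] by (simp add: mult_le_cancel_right1)
  ultimately show ?thesis by linarith
qed

lemma integrable_u_powr:
  assumes "0 \<le> t" shows "integrable lebesgue (\<lambda>x. u x t powr p)"
proof (rule Bochner_Integration.integrable_bound)
  show "integrable lebesgue (\<lambda>x. B powr (p - 1) * u x t)" using integrable_u[OF assms] by simp
  show "(\<lambda>x. u x t powr p) \<in> borel_measurable lebesgue" using u_measurable[of t] by measurable
  show "AE x in lebesgue. norm (u x t powr p) \<le> norm (B powr (p - 1) * u x t)"
    using u_powr_le[of _ t] u_nonneg[of _ t] by (intro AE_I2) (simp add: abs_mult)
qed

text \<open>Dispersal preserves mass by \<open>integral_conv\<close>, so integrating the equation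
  leaves only the absorption.\<close>

lemma has_real_derivative_mass:
  assumes t: "0 < t" shows "(mass has_real_derivative - absorbed t) (at t)"
proof -
  \<comment> \<open>The neighbourhood of radius \<open>t\<close> ends at \<open>2 * t\<close>, and
    \<open>u_dominated\<close> controls all of it by the values at that time.\<close>
  define b where "b = 2 * t"
  have b: "0 \<le> b" using t by (simp add: b_def)
  define w where "w x = exp (growth * b) * u x b" for x
  have wi: "integrable lebesgue w" unfolding w_def[abs_def] using integrable_u[OF b] by simp
  have w0: "0 \<le> w x" for x using u_nonneg by (simp add: w_def)
  let ?f' = "\<lambda>s x. conv (\<lambda>y. u y s) x - u x s - u x s powr p"
  have "((\<lambda>s. LINT x|lebesgue. u x s) has_real_derivative (LINT x|lebesgue. ?f' t x)) (at t)"
  proof (rule has_real_derivative_integral[where r=t and w="\<lambda>x. conv w x + growth * w x", OF t])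
    show "integrable lebesgue (\<lambda>x. u x s)" if "\<bar>s - t\<bar> < t" for s
      by (rule integrable_u) (use that in \<open>auto simp: abs_less_iff\<close>)
    show "?f' t \<in> borel_measurable lebesgue"
      using u_measurable[of t] conv_measurable[OF u_measurable[of t]] by measurable
    show "integrable lebesgue (\<lambda>x. conv w x + growth * w x)" using wi integrable_conv[OF wi] by simp
    show "AE x in lebesgue. \<forall>s. \<bar>s - t\<bar> < t \<longrightarrow> ((\<lambda>s. u x s) has_real_derivative ?f' s x) (at s) \<and> \<bar>?f' s x\<bar> \<le> conv w x + growth * w x"
      using AE_not_in_negligible[OF negligible_Z]
    proof eventually_elim
      case (elim x)
      show ?case
      proof (intro allI impI conjI)
        fix s assume "\<bar>s - t\<bar> < t"
        then have s: "0 < s" "s \<le> b" by (auto simp: b_def abs_less_iff)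
        show "((\<lambda>s. u x s) has_real_derivative ?f' s x) (at s)" using u_equation[OF elim s(1)] by simp
        have dom: "u y s \<le> w y" if "y \<notin> Z" for y using u_dominated[OF that, of s b] s by (simp add: w_def)
        have "conv (\<lambda>y. u y s) x \<le> conv w x"
          by (rule conv_mono_AE[OF integrable_conv_u integrable_conv_integrable[OF wi]])
            (use AE_not_in_negligible[OF negligible_Z] dom in \<open>auto elim: eventually_mono\<close>)
        moreover have "0 \<le> conv (\<lambda>y. u y s) x" unfolding conv_def using u_nonneg by simp
        moreover have "u x s + u x s powr p \<le> growth * u x s" using u_powr_le[of x s] by (simp add: growth_def algebra_simps)
        moreover have "growth * u x s \<le> growth * w x" using dom[OF elim] growth_pos by simp
        moreover have "0 \<le> growth * w x" "0 \<le> u x s + u x s powr p" using w0 growth_pos u_nonneg by (auto intro: add_nonneg_nonneg)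
        ultimately show "\<bar>?f' s x\<bar> \<le> conv w x + growth * w x" by linarith
      qed
    qed
  qed
  moreover have "(LINT x|lebesgue. ?f' t x) = - absorbed t"
    using integrable_u[of t] integrable_conv[OF integrable_u[of t]] integral_conv[OF integrable_u[of t]] integrable_u_powr[of t] t
    by (simp add: absorbed_def)
  ultimately show ?thesis by (simp add: mass_def[abs_def])
qed

text \<open>Used with \<open>v\<close> for the mass and with \<open>v powr p\<close> for the
  absorption. The time \<open>0\<close> is included because the initial mass occurs in
  \<open>M\<close>, while the equation is available only at positive times.\<close>

lemma tendsto_u_functional:
  assumes t: "0 \<le> t" and g: "continuous_on {0..} g"
    and gb: "\<And>v. 0 \<le> v \<Longrightarrow> v \<le> B \<Longrightarrow> \<bar>g v\<bar> \<le> K * v"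
  shows "((\<lambda>s. LINT x|lebesgue. g (u x s)) \<longlongrightarrow> (LINT x|lebesgue. g (u x t))) (at t within {0..})"
  unfolding tendsto_at_iff_sequentially comp_def
proof (intro allI impI)
  fix X assume X: "\<forall>i. X i \<in> {0..} - {t}" "X \<longlonglongrightarrow> t"
  define b where "b = t + 1"
  have b: "0 \<le> b" using t by (simp add: b_def)
  have "\<forall>\<^sub>F n in sequentially. X n < b" using X(2) by (rule order_tendstoD) (simp add: b_def)
  then obtain k where k: "\<And>n. k \<le> n \<Longrightarrow> X n \<le> b" by (auto simp: eventually_sequentially intro: less_imp_le)
  have gm: "(\<lambda>x. g (u x s)) \<in> borel_measurable lebesgue" for s
  proof -
    have "(\<lambda>v. if v \<in> {0..} then g v else 0) \<in> borel_measurable borel"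
      by (rule borel_measurable_continuous_on_if[OF _ g]) auto
    from measurable_compose[OF u_measurable[of s] this] show ?thesis using u_nonneg by simp
  qed
  have K0: "\<bar>K\<bar> * u x s \<ge> \<bar>g (u x s)\<bar>" for x s
    using gb[OF u_nonneg[of x s] u_bounded[of x s]] mult_right_mono[OF abs_ge_self[of K] u_nonneg[of x s]] by linarith
  have "(\<lambda>n. LINT x|lebesgue. g (u x (X (n + k)))) \<longlonglongrightarrow> (LINT x|lebesgue. g (u x t))"
  proof (rule integral_dominated_convergence[where w="\<lambda>x. \<bar>K\<bar> * (exp (growth * b) * u x b)"])
    show "integrable lebesgue (\<lambda>x. \<bar>K\<bar> * (exp (growth * b) * u x b))" using integrable_u[OF b] by simp
    show "AE x in lebesgue. (\<lambda>n. g (u x (X (n + k)))) \<longlonglongrightarrow> g (u x t)"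
      using AE_not_in_negligible[OF negligible_Z]
    proof eventually_elim
      case (elim x)
      have X': "(\<lambda>n. X (n + k)) \<longlonglongrightarrow> t" by (rule LIMSEQ_ignore_initial_segment[OF X(2)])
      have "(\<lambda>n. u x (X (n + k))) \<longlonglongrightarrow> u x t"
        by (rule continuous_on_tendsto_compose[OF u_continuous[OF elim] X']) (use X t in auto)
      from continuous_on_tendsto_compose[OF g this] u_nonneg show ?case by auto
    qed
    show "AE x in lebesgue. norm (g (u x (X (n + k)))) \<le> \<bar>K\<bar> * (exp (growth * b) * u x b)" for n
      using AE_not_in_negligible[OF negligible_Z]
    proof eventually_elim
      case (elim x)
      have "u x (X (n + k)) \<le> exp (growth * b) * u x b"
        by (rule u_dominated[OF elim]) (use X(1) k[of "n + k"] in auto)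
      then have "\<bar>K\<bar> * u x (X (n + k)) \<le> \<bar>K\<bar> * (exp (growth * b) * u x b)" by (rule mult_left_mono) simp
      then show ?case using K0[where x=x and s="X (n + k)"] by simp
    qed
  qed (rule gm)+
  then show "(\<lambda>n. LINT x|lebesgue. g (u x (X n))) \<longlonglongrightarrow> (LINT x|lebesgue. g (u x t))" by (rule LIMSEQ_offset)
qed

lemma mass_continuous: "0 \<le> t \<Longrightarrow> (mass \<longlongrightarrow> mass t) (at t within {0..})"
  unfolding mass_def[abs_def] by (rule tendsto_u_functional[where g="\<lambda>v. v" and K=1]) auto

lemma absorbed_continuous: "0 \<le> t \<Longrightarrow> (absorbed \<longlongrightarrow> absorbed t) (at t within {0..})"
  unfolding absorbed_def[abs_def]
proof (rule tendsto_u_functional[where g="\<lambda>v. v powr p" and K="B powr (p - 1)"])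
  show "continuous_on {0..} (\<lambda>v::real. v powr p)" using p_gt_1 by (intro continuous_on_powr') (auto intro!: continuous_intros)
  fix v :: real assume v: "0 \<le> v" "v \<le> B"
  show "\<bar>v powr p\<bar> \<le> B powr (p - 1) * v"
  proof (cases "v = 0")
    case False
    then have "v powr p = v powr (p - 1) * v" using v by (simp add: powr_diff)
    also have "\<dots> \<le> B powr (p - 1) * v" using p_gt_1 v by (intro mult_right_mono powr_mono2) auto
    finally show ?thesis by simp
  qed simp
qed auto

lemma mass_antimono:
  assumes "0 \<le> s" "s \<le> t" shows "mass t \<le> mass s"
proof (rule DERIV_nonpos_imp_decreasing_open[OF assms(2)])
  show "continuous_on {s..t} mass"
    unfolding continuous_on_def
  proof
    fix r assume "r \<in> {s..t}"
    then show "(mass \<longlongrightarrow> mass r) (at r within {s..t})"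
      using assms by (intro tendsto_within_subset[OF mass_continuous]) auto
  qed
  show "\<exists>y. (mass has_real_derivative y) (at r) \<and> y \<le> 0" if "s < r" "r < t" for r
    using has_real_derivative_mass[of r] absorbed_nonneg[of r] that assms by force
qed

definition limit_mass :: real where "limit_mass = (INF t\<in>{0..}. mass t)"

lemma mass_tendsto: "(mass \<longlongrightarrow> limit_mass) at_top" and limit_mass_le: "0 \<le> t \<Longrightarrow> limit_mass \<le> mass t"
  and limit_mass_nonneg: "0 \<le> limit_mass"
proof -
  have bd: "bdd_below (mass ` {0..})" using mass_nonneg by (intro bdd_belowI[of _ 0]) auto
  show le: "limit_mass \<le> mass t" if "0 \<le> t" for t
    unfolding limit_mass_def using that by (intro cINF_lower bd) auto
  show "0 \<le> limit_mass" unfolding limit_mass_def using mass_nonneg by (intro cINF_greatest) auto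
  show "(mass \<longlongrightarrow> limit_mass) at_top"
  proof (rule order_tendstoI)
    fix c assume c: "c < limit_mass"
    show "\<forall>\<^sub>F t in at_top. c < mass t"
      using eventually_ge_at_top[of 0] by eventually_elim (use le c in fastforce)
  next
    fix c assume "limit_mass < c"
    then obtain s where s: "0 \<le> s" "mass s < c"
      unfolding limit_mass_def using cINF_less_iff[OF _ bd, of c] by auto
    show "\<forall>\<^sub>F t in at_top. mass t < c"
      using eventually_ge_at_top[of s] by eventually_elim (use s mass_antimono in fastforce)
  qed
qed

text \<open>The fundamental theorem of calculus for a nonnegative derivative on
  \<open>(0, \<infinity>)\<close>, where convergence of the integral is part of the
  conclusion.\<close>

lemma integral_absorbed: "(LINT t:{0..}|lebesgue. absorbed t) = mass 0 - limit_mass"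
proof -
  have lim0: "(mass \<longlongrightarrow> mass 0) (at_right 0)"
    by (rule tendsto_within_subset[OF mass_continuous[OF order_refl]]) auto
  have cont: "isCont absorbed t" if "0 < t" for t
  proof -
    have "at t within {0..} = at t" using that by (intro at_within_interior) auto
    then show ?thesis using absorbed_continuous[of t] that by (simp add: isCont_def)
  qed
  have D: "((\<lambda>t. - mass t) has_real_derivative absorbed t) (at t)" if "0 < t" for t
    using DERIV_minus[OF has_real_derivative_mass[OF that]] by simp
  have "set_integrable lborel (einterval 0 \<infinity>) absorbed \<and> (LBINT t=0..\<infinity>. absorbed t) = - limit_mass - (- mass 0)"
  proof (intro conjI)
    have a: "(((\<lambda>t. - mass t) \<circ> real_of_ereal) \<longlongrightarrow> - mass 0) (at_right 0)"
      unfolding zero_ereal_def ereal_tendsto_simps by (intro tendsto_intros lim0)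
    have b: "(((\<lambda>t. - mass t) \<circ> real_of_ereal) \<longlongrightarrow> - limit_mass) (at_left \<infinity>)"
      unfolding ereal_tendsto_simps by (intro tendsto_intros mass_tendsto)
    show "set_integrable lborel (einterval 0 \<infinity>) absorbed"
      by (rule interval_integral_FTC_nonneg(1)[where F="\<lambda>t. - mass t", OF _ _ _ _ a b])
        (use D cont absorbed_nonneg in auto)
    show "(LBINT t=0..\<infinity>. absorbed t) = - limit_mass - (- mass 0)"
      by (rule interval_integral_FTC_nonneg(2)[where F="\<lambda>t. - mass t", OF _ _ _ _ a b])
        (use D cont absorbed_nonneg in auto)
  qed
  moreover have "einterval 0 \<infinity> = {0::real<..}" by (auto simp: einterval_iff)
  ultimately have si: "set_integrable lborel {0<..} absorbed" and i: "(LBINT t:{0<..}. absorbed t) = mass 0 - limit_mass"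
    by (auto simp: interval_lebesgue_integral_def)
  have m: "(\<lambda>t. indicat_real {0<..} t *\<^sub>R absorbed t) \<in> borel_measurable borel"
    using si unfolding set_integrable_def by auto
  \<comment> \<open>The fundamental theorem was applied on the open half-line; the endpoint is split
    off as a null set.\<close>
  have eq: "indicat_real {0..} t *\<^sub>R absorbed t = indicat_real {0<..} t *\<^sub>R absorbed t + indicat_real {0} t *\<^sub>R absorbed 0" for t :: real
    by (auto simp: indicator_def)
  have "(LINT t:{0..}|lebesgue. absorbed t) = (LINT t|lborel. indicat_real {0<..} t *\<^sub>R absorbed t + indicat_real {0} t *\<^sub>R absorbed 0)"
  proof -
    have "(\<lambda>t. indicat_real {0::real} t *\<^sub>R absorbed 0) \<in> borel_measurable borel" by (intro borel_measurable_scaleR) auto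
    from borel_measurable_add[OF m this] show ?thesis
      unfolding set_lebesgue_integral_def eq by (intro integral_completion) simp
  qed
  also have "\<dots> = (LINT t|lborel. indicat_real {0<..} t *\<^sub>R absorbed t) + (LINT t|lborel. indicat_real {0::real} t *\<^sub>R absorbed 0)"
    using si unfolding set_integrable_def by (intro Bochner_Integration.integral_add) auto
  also have "\<dots> = mass 0 - limit_mass" using i by (simp add: set_lebesgue_integral_def)
  finally show ?thesis .
qed

section \<open>The deficit against the linear flow\<close>

definition deficit :: "real \<Rightarrow> real \<Rightarrow> 'a \<Rightarrow> real" where
  "deficit t0 s x = semigroup (s - t0) (\<lambda>y. u y t0) x - u x s"

lemma semigroup_u:
  assumes "0 \<le> t0"
  shows "integrable lebesgue (\<lambda>y. u y t0)" "\<And>x. \<bar>u x t0\<bar> \<le> B"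
    "0 \<le> s \<Longrightarrow> 0 \<le> semigroup s (\<lambda>y. u y t0) x" "0 \<le> s \<Longrightarrow> semigroup s (\<lambda>y. u y t0) x \<le> B"
    "0 \<le> s \<Longrightarrow> integrable lebesgue (semigroup s (\<lambda>y. u y t0))"
    "0 \<le> s \<Longrightarrow> (LINT x|lebesgue. semigroup s (\<lambda>y. u y t0) x) \<le> mass t0"
  using integrable_u[OF assms] abs_u_le semigroup_bounds[OF integrable_u[OF assms] u_nonneg u_bounded, of s]
  by (auto simp: mass_def)

lemma abs_deficit_le:
  assumes "0 \<le> t0" "t0 \<le> s" shows "\<bar>deficit t0 s x\<bar> \<le> B"
  using semigroup_u(3,4)[OF assms(1), of "s - t0" x] assms(2) u_nonneg[of x s] u_bounded[of x s]
  unfolding deficit_def by (auto simp: abs_le_iff)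

lemma deficit_measurable: "0 \<le> t0 \<Longrightarrow> deficit t0 s \<in> borel_measurable lebesgue"
  unfolding deficit_def[abs_def] using semigroup_measurable[OF semigroup_u(1), of t0 "s - t0"] u_measurable[of s] by measurable

lemma conv_deficit:
  assumes "0 \<le> t0" "t0 \<le> s"
  shows "conv (deficit t0 s) x = conv (semigroup (s - t0) (\<lambda>y. u y t0)) x - conv (\<lambda>y. u y s) x"
proof -
  have i: "integrable lebesgue (\<lambda>y. J (x - y) * semigroup (s - t0) (\<lambda>y. u y t0) y)"
    by (rule integrable_conv_integrable) (use semigroup_u(5)[of t0 "s - t0"] assms in auto)
  from conv_affine[OF i integrable_conv_u[of x s], of 1 "-1" 0] show ?thesis by (simp add: deficit_def[abs_def])
qed

lemma has_real_derivative_deficit: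
  assumes "0 \<le> t0" "t0 < s" "x \<notin> Z"
  shows "((\<lambda>s. deficit t0 s x) has_real_derivative conv (deficit t0 s) x - deficit t0 s x + u x s powr p) (at s)"
proof -
  have "((\<lambda>s. semigroup s (\<lambda>y. u y t0) x) has_real_derivative conv (semigroup (s - t0) (\<lambda>y. u y t0)) x - semigroup (s - t0) (\<lambda>y. u y t0) x) (at (s - t0))"
    by (rule has_real_derivative_semigroup[OF semigroup_u(1,2)[OF assms(1)]])
  then have "((\<lambda>s. semigroup (s - t0) (\<lambda>y. u y t0) x) has_real_derivative conv (semigroup (s - t0) (\<lambda>y. u y t0)) x - semigroup (s - t0) (\<lambda>y. u y t0) x) (at s)"
    using DERIV_shift[of "\<lambda>s. semigroup s (\<lambda>y. u y t0) x" _ s "- t0"] by simp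
  from DERIV_diff[OF this u_equation[OF assms(3), of s]] assms show ?thesis
    by (simp add: deficit_def conv_deficit algebra_simps)
qed

lemma deficit_continuous:
  assumes "0 \<le> t0" "x \<notin> Z" shows "continuous_on {t0..} (\<lambda>s. deficit t0 s x)"
proof -
  have c: "continuous_on UNIV (\<lambda>s. semigroup s (\<lambda>y. u y t0) x)"
    by (rule DERIV_continuous_on, rule has_real_derivative_semigroup[OF semigroup_u(1,2)[OF assms(1)]])
  have "continuous_on {t0..} (u x)" by (rule continuous_on_subset[OF u_continuous[OF assms(2)]]) (use assms in auto)
  then show ?thesis unfolding deficit_def
    by (intro continuous_intros continuous_on_compose2[OF c]) auto
qed

text \<open>The equation of the deficit has the nonnegative source \<open>u powr p\<close>, so its
  negative is a subsolution starting at \<open>0\<close>.\<close>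

lemma deficit_nonneg:
  assumes t0: "0 \<le> t0" "t0 \<le> s" and x: "x \<notin> Z"
  shows "0 \<le> deficit t0 s x"
proof -
  have "subsolution Z (s - t0) (\<lambda>r x. - deficit t0 (t0 + r) x)"
    unfolding subsolution_def
  proof (intro conjI ballI allI impI)
    show "(\<lambda>x. - deficit t0 (t0 + r) x) \<in> borel_measurable lebesgue" for r using deficit_measurable[OF t0(1), of "t0 + r"] by measurable
    show "\<exists>K. \<forall>r\<in>{0..s - t0}. \<forall>x. \<bar>- deficit t0 (t0 + r) x\<bar> \<le> K" using abs_deficit_le[OF t0(1)] by (intro exI[of _ B]) auto
    show "continuous_on {0..s - t0} (\<lambda>r. - deficit t0 (t0 + r) x)" if "x \<notin> Z" for x
      by (intro continuous_intros continuous_on_compose2[OF deficit_continuous[OF t0(1) that]]) auto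
    fix x r assume x: "x \<notin> Z" and r: "r \<in> {0<..<s - t0}"
    have "((\<lambda>r. deficit t0 (t0 + r) x) has_real_derivative conv (deficit t0 (t0 + r)) x - deficit t0 (t0 + r) x + u x (t0 + r) powr p) (at r)"
      using has_real_derivative_deficit[OF t0(1) _ x, of "t0 + r"] r DERIV_shift[of "\<lambda>s. deficit t0 s x" _ r t0] by (simp add: add.commute)
    from DERIV_minus[OF this]
    have "((\<lambda>r. - deficit t0 (t0 + r) x) has_real_derivative - (conv (deficit t0 (t0 + r)) x - deficit t0 (t0 + r) x + u x (t0 + r) powr p)) (at r)" .
    moreover have "conv (\<lambda>x. - deficit t0 (t0 + r) x) x = - conv (deficit t0 (t0 + r)) x" by (simp add: conv_def)
    ultimately show "\<exists>d. ((\<lambda>r. - deficit t0 (t0 + r) x) has_real_derivative d) (at r) \<and> d \<le> conv (\<lambda>x. - deficit t0 (t0 + r) x) x - - deficit t0 (t0 + r) x"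
      by force
  qed
  from comparison_principle[OF this negligible_Z _ x, of "s - t0"] t0 show ?thesis by (simp add: deficit_def)
qed

lemma deficit_mass:
  assumes "0 \<le> t0" "t0 \<le> s"
  shows "integrable lebesgue (deficit t0 s)" "(LINT x|lebesgue. deficit t0 s x) \<le> mass t0 - mass s"
  using semigroup_u(5,6)[OF assms(1), of "s - t0"] integrable_u[of s] assms
  unfolding deficit_def[abs_def] by (auto simp: mass_def)

text \<open>On a window \<open>[\<tau>, t]\<close> the deficit obeys the linear equation with a source bounded by \<open>\<kappa>\<close>.\<close>

lemma deficit_window:
  assumes t: "0 \<le> t0" "t0 \<le> \<tau>" "\<tau> \<le> t" and x: "x \<notin> Z"
    and \<kappa>: "\<And>s x. \<tau> \<le> s \<Longrightarrow> s \<le> t \<Longrightarrow> x \<notin> Z \<Longrightarrow> u x s powr p \<le> \<kappa>"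
  obtains f where "integrable lebesgue f" "\<And>x. 0 \<le> f x" "\<And>x. f x \<le> B" "(LINT x|lebesgue. f x) \<le> mass t0 - mass \<tau>"
    "deficit t0 t x \<le> semigroup (t - \<tau>) f x + \<kappa> * (t - \<tau>)"
proof -
  \<comment> \<open>The deficit is known to be nonnegative only off \<open>Z\<close>; the positive
    part changes it on a null set and meets the hypotheses of \<open>semigroup_bounds\<close>
    everywhere.\<close>
  define f where "f y = max 0 (deficit t0 \<tau> y)" for y
  have fi: "integrable lebesgue f" unfolding f_def[abs_def] using deficit_mass(1)[OF t(1,2)] by (intro integrable_max) auto
  have f0: "0 \<le> f y" for y by (simp add: f_def)
  have fB: "f y \<le> B" for y using abs_deficit_le[OF t(1,2), of y] B_nonneg by (simp add: f_def abs_le_iff)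
  have fab: "\<bar>f y\<bar> \<le> B" for y using f0 fB by simp
  have fz: "f y = deficit t0 \<tau> y" if "y \<notin> Z" for y using deficit_nonneg[OF t(1,2) that] by (simp add: f_def)
  have "(LINT x|lebesgue. f x) = (LINT x|lebesgue. deficit t0 \<tau> x)"
    by (rule integral_cong_AE) (use fi deficit_mass(1)[OF t(1,2)] fz AE_not_in_negligible[OF negligible_Z] in \<open>auto elim: eventually_mono\<close>)
  then have fm: "(LINT x|lebesgue. f x) \<le> mass t0 - mass \<tau>" using deficit_mass(2)[OF t(1,2)] by simp
  have sB: "0 \<le> semigroup r f y" "semigroup r f y \<le> B" if "0 \<le> r" for r y
    using semigroup_bounds(1,2)[OF fi f0 fB that] by auto
  have sm: "semigroup r f \<in> borel_measurable lebesgue" for r by (rule semigroup_measurable[OF fi])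
  have cs: "continuous_on UNIV (\<lambda>r. semigroup r f y)" for y
    by (rule DERIV_continuous_on, rule has_real_derivative_semigroup[OF fi fab])
  \<comment> \<open>\<open>conv\<close> fixes constants, so subtracting \<open>\<kappa> * r\<close>
    lowers the derivative by exactly \<open>\<kappa>\<close> and pays for the source.\<close>
  let ?z = "\<lambda>r y. deficit t0 (\<tau> + r) y - semigroup r f y - \<kappa> * r"
  have "subsolution Z (t - \<tau>) ?z"
    unfolding subsolution_def
  proof (intro conjI ballI allI impI)
    show "?z r \<in> borel_measurable lebesgue" for r using deficit_measurable[OF t(1), of "\<tau> + r"] sm[of r] by measurable
    show "\<exists>K. \<forall>r\<in>{0..t - \<tau>}. \<forall>y. \<bar>?z r y\<bar> \<le> K"
    proof (intro exI[of _ "B + B + \<bar>\<kappa>\<bar> * (t - \<tau>)"] ballI allI)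
      fix r y assume r: "r \<in> {0..t - \<tau>}"
      have "\<bar>\<kappa> * r\<bar> \<le> \<bar>\<kappa>\<bar> * (t - \<tau>)" unfolding abs_mult using r by (intro mult_left_mono) auto
      moreover have "\<bar>semigroup r f y\<bar> \<le> B" using sB[of r y] r by simp
      moreover have "\<bar>deficit t0 (\<tau> + r) y\<bar> \<le> B" using r t by (intro abs_deficit_le) auto
      ultimately show "\<bar>?z r y\<bar> \<le> B + B + \<bar>\<kappa>\<bar> * (t - \<tau>)" by linarith
    qed
    show "continuous_on {0..t - \<tau>} (\<lambda>r. ?z r y)" if "y \<notin> Z" for y
      using t by (intro continuous_intros continuous_on_compose2[OF deficit_continuous[OF t(1) that]] continuous_on_compose2[OF cs]) auto
    fix y r assume y: "y \<notin> Z" and r: "r \<in> {0<..<t - \<tau>}"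
    have 1: "((\<lambda>r. deficit t0 (\<tau> + r) y) has_real_derivative conv (deficit t0 (\<tau> + r)) y - deficit t0 (\<tau> + r) y + u y (\<tau> + r) powr p) (at r)"
      using has_real_derivative_deficit[OF t(1) _ y, of "\<tau> + r"] r t DERIV_shift[of "\<lambda>s. deficit t0 s y" _ r \<tau>] by (simp add: add.commute)
    have 2: "((\<lambda>r. semigroup r f y) has_real_derivative conv (semigroup r f) y - semigroup r f y) (at r)"
      by (rule has_real_derivative_semigroup[OF fi fab])
    have 3: "((\<lambda>r. \<kappa> * r) has_real_derivative \<kappa>) (at r)" by (auto intro!: derivative_eq_intros)
    have i1: "integrable lebesgue (\<lambda>v. J (y - v) * deficit t0 (\<tau> + r) v)"
      by (rule integrable_conv_bounded[OF deficit_measurable[OF t(1)] abs_deficit_le[OF t(1)]]) (use r t in auto)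
    have i2: "integrable lebesgue (\<lambda>v. J (y - v) * semigroup r f v)"
      by (rule integrable_conv_bounded[OF sm, where B=B]) (use sB[of r] r in simp)
    have cz: "conv (?z r) y = conv (deficit t0 (\<tau> + r)) y - conv (semigroup r f) y - \<kappa> * r"
      using conv_affine[OF i1 i2, of 1 "-1" "- (\<kappa> * r)"] by simp
    have uk: "u y (\<tau> + r) powr p \<le> \<kappa>" using r by (intro \<kappa> y) auto
    show "\<exists>d. ((\<lambda>r. ?z r y) has_real_derivative d) (at r) \<and> d \<le> conv (?z r) y - ?z r y"
      using DERIV_diff[OF DERIV_diff[OF 1 2] 3] cz uk
      by (intro exI conjI) (assumption, simp)
  qed
  then have "?z (t - \<tau>) x \<le> 0"
    by (rule comparison_principle[OF _ negligible_Z _ x]) (use fz t in auto)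
  then have "deficit t0 t x \<le> semigroup (t - \<tau>) f x + \<kappa> * (t - \<tau>)" by simp
  then show ?thesis using that fi f0 fB fm by blast
qed

end

section \<open>Decay and asymptotics of the solution\<close>

context absorption_solution begin

lemma u_decay:
  obtains C where "0 < C" "\<And>t x. 0 < t \<Longrightarrow> x \<notin> Z \<Longrightarrow> u x t \<le> C * t powr (- (real DIM('a) / 2))"
proof -
  obtain C0 where C0: "0 < C0" "\<And>f B t x. integrable lebesgue f \<Longrightarrow> (\<And>x. \<bar>f x\<bar> \<le> B) \<Longrightarrow> 0 < t \<Longrightarrow>
     \<bar>semigroup t f x\<bar> \<le> (1 + t) * exp (- t) * B + C0 * t powr (- (real DIM('a) / 2)) * (LINT y|lebesgue. \<bar>f y\<bar>)"
    by (rule semigroup_decay) blast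
  obtain C2 where C2: "0 < C2" "\<And>t. 0 < t \<Longrightarrow> t powr (real DIM('a) / 2) * exp (- (t / 2)) \<le> C2"
    by (rule powr_times_exp_bounded[of "real DIM('a) / 2"]) auto
  have "u x t \<le> (2 * C2 * B + C0 * mass 0 + 1) * t powr (- (real DIM('a) / 2))" if t: "0 < t" and x: "x \<notin> Z" for t x
  proof -
    let ?q = "t powr (- (real DIM('a) / 2))"
    have "u x t \<le> semigroup t (\<lambda>y. u y 0) x" using deficit_nonneg[of 0 t x] t x by (simp add: deficit_def)
    also have "\<dots> \<le> (1 + t) * exp (- t) * B + C0 * ?q * mass 0"
      using C0(2)[OF semigroup_u(1,2)[OF order_refl] t, of x] u_nonneg by (simp add: mass_def)
    also have "(1 + t) * exp (- t) * B \<le> 2 * C2 * ?q * B"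
    proof (rule mult_right_mono[OF _ B_nonneg])
      \<comment> \<open>Half of the exponential absorbs the linear factor; the other half is bounded
        by the power of \<open>t\<close>.\<close>
      have "1 + t \<le> 2 * exp (t / 2)" using exp_ge_add_one_self[of "t / 2"] by linarith
      then have "(1 + t) * exp (- t) \<le> 2 * exp (t / 2) * exp (- t)" by (rule mult_right_mono) simp
      also have "\<dots> = 2 * exp (- (t / 2))" by (simp add: exp_add[symmetric])
      also have "exp (- (t / 2)) \<le> C2 * ?q"
        using C2(2)[OF t] t by (simp add: powr_minus field_simps)
      finally show "(1 + t) * exp (- t) \<le> 2 * C2 * ?q" by simp
    qed
    finally have "u x t \<le> 2 * C2 * ?q * B + C0 * ?q * mass 0" by simp
    also have "\<dots> \<le> (2 * C2 * B + C0 * mass 0 + 1) * ?q" by (simp add: algebra_simps)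
    finally show ?thesis .
  qed
  moreover have "0 < 2 * C2 * B + C0 * mass 0 + 1"
    using C0(1) C2(1) B_nonneg mass_nonneg[of 0] by (intro add_nonneg_pos) auto
  ultimately show ?thesis using that by blast
qed

lemma gauss_0_scaled:
  assumes "0 < s"
  shows "gauss (2 * \<a> * s) (0::'a) = (4 * pi * \<a>) powr (- (real DIM('a) / 2)) * s powr (- (real DIM('a) / 2))"
proof -
  have "2 * pi * (2 * \<a> * s) = (4 * pi * \<a>) * s" by simp
  then show ?thesis unfolding gauss_0 using a_pos assms by (simp only:) (subst powr_mult, auto)
qed

text \<open>Up to a time \<open>t0\<close> where little mass is left to be lost, \<open>u\<close> follows the linear semigroup; the
  deficit accumulated afterwards is small in \<open>L\<^sup>1\<close>, and the decay of the semigroup over the window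
  \<open>[(1 - \<delta>) t, t]\<close> turns this into a uniform bound.  The source in that window contributes \<open>O(\<delta>)\<close>,
  which is where \<open>p \<ge> 1 + 2 / N\<close> enters.\<close>

lemma u_asymptotics:
  assumes p: "1 + 2 / real DIM('a) \<le> p" and \<epsilon>: "0 < \<epsilon>"
  shows "\<forall>\<^sub>F t in at_top. \<forall>x. x \<notin> Z \<longrightarrow>
    t powr (real DIM('a) / 2) * \<bar>u x t - limit_mass * gauss (2 * \<a> * t) x\<bar> < \<epsilon>"
proof -
  define q where "q = real DIM('a) / 2"
  have q: "0 < q" by (simp add: q_def)
  have qp: "q + 1 \<le> q * p"
  proof -
    have "q * (1 + 2 / real DIM('a)) \<le> q * p" using p q by simp
    moreover have "q * (1 + 2 / real DIM('a)) = q + 1" by (simp add: q_def field_simps)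
    ultimately show ?thesis by simp
  qed
  obtain C1 where C1: "0 < C1" "\<And>t x. 0 < t \<Longrightarrow> x \<notin> Z \<Longrightarrow> u x t \<le> C1 * t powr (- q)"
    unfolding q_def by (rule u_decay) blast
  obtain C0 where C0: "0 < C0" "\<And>f B t x. integrable lebesgue f \<Longrightarrow> (\<And>x. \<bar>f x\<bar> \<le> B) \<Longrightarrow> 0 < t \<Longrightarrow>
     \<bar>semigroup t f x\<bar> \<le> (1 + t) * exp (- t) * B + C0 * t powr (- q) * (LINT y|lebesgue. \<bar>f y\<bar>)"
    unfolding q_def by (rule semigroup_decay) blast
  define Kg where "Kg = (4 * pi * \<a>) powr (- q)"
  have Kg: "0 < Kg" using a_pos by (simp add: Kg_def)
  have g0: "gauss (2 * \<a> * s) (0::'a) = Kg * s powr (- q)" if "0 < s" for s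
    using gauss_0_scaled[OF that] by (simp add: Kg_def q_def)
  \<comment> \<open>The decay of \<open>u\<close> at a time at least \<open>t / 2\<close>, raised to
    the power \<open>p\<close>; the halving produces \<open>2 powr (q * p)\<close>.\<close>
  define K1 where "K1 = C1 powr p * 2 powr (q * p)"
  have K1: "0 < K1" using C1 by (simp add: K1_def)
  \<comment> \<open>\<open>\<delta>\<close> is fixed first, from the source in the window alone. A
    short window costs \<open>\<delta> powr (- q)\<close> in the smoothing, which is collected in
    \<open>K2\<close>; \<open>t0\<close> is chosen last, against \<open>K2\<close>.\<close>
  define \<delta> where "\<delta> = min (1 / 2) (\<epsilon> / 8 / K1)"
  have \<delta>: "0 < \<delta>" "\<delta> \<le> 1 / 2" "K1 * \<delta> \<le> \<epsilon> / 8"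
  proof -
    show "0 < \<delta>" "\<delta> \<le> 1 / 2" using \<epsilon> K1 by (auto simp: \<delta>_def)
    have "\<delta> \<le> \<epsilon> / 8 / K1" by (simp add: \<delta>_def)
    then show "K1 * \<delta> \<le> \<epsilon> / 8" using K1 by (simp add: field_simps)
  qed
  \<comment> \<open>The first summand comes from smoothing the deficit, the second from replacing
    \<open>mass t0\<close> by \<open>limit_mass\<close> in the profile. Both multiply
    \<open>\<eta>\<close>, the mass still to be lost.\<close>
  define K2 where "K2 = C0 * \<delta> powr (- q) + Kg"
  have K2: "0 < K2" using C0 Kg by (simp add: K2_def add_nonneg_pos)
  have "\<forall>\<^sub>F t in at_top. mass t < limit_mass + \<epsilon> / 8 / K2"
    by (rule order_tendstoD[OF mass_tendsto]) (use \<epsilon> K2 in simp)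
  then have "\<forall>\<^sub>F t in at_top. 0 \<le> t \<and> mass t < limit_mass + \<epsilon> / 8 / K2"
    using eventually_ge_at_top[of 0] by eventually_elim simp
  then obtain t0 where t0: "0 \<le> t0" "mass t0 < limit_mass + \<epsilon> / 8 / K2"
    using eventually_happens'[OF trivial_limit_at_top_linorder] by blast
  define \<eta> where "\<eta> = mass t0 - limit_mass"
  have \<eta>: "0 \<le> \<eta>" "K2 * \<eta> \<le> \<epsilon> / 8"
  proof -
    show "0 \<le> \<eta>" using limit_mass_le[OF t0(1)] by (simp add: \<eta>_def)
    have "\<eta> \<le> \<epsilon> / 8 / K2" using t0(2) by (simp add: \<eta>_def)
    then show "K2 * \<eta> \<le> \<epsilon> / 8" using K2 by (simp add: field_simps)
  qed
  let ?f = "\<lambda>y. u y t0"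
  have m0: "(LINT y|lebesgue. u y t0) = mass t0" by (simp add: mass_def)
  have e1: "\<forall>\<^sub>F t in at_top. 1 \<le> t \<and> 2 * t0 + 1 \<le> t"
    using eventually_ge_at_top[of 1] eventually_ge_at_top[of "2 * t0 + 1"] by eventually_elim simp
  have e2: "\<forall>\<^sub>F t in at_top. B * (t powr q * ((1 + \<delta> * t) * exp (- (\<delta> * t)))) < \<epsilon> / 8"
  proof (rule order_tendstoD)
    have "((\<lambda>t. t powr q * ((1 + \<delta> * t) * exp (- (\<delta> * t)))) \<longlongrightarrow> 0) at_top" using \<delta>(1) by real_asymp
    then show "((\<lambda>t. B * (t powr q * ((1 + \<delta> * t) * exp (- (\<delta> * t))))) \<longlongrightarrow> 0) at_top" by (rule tendsto_mult_right_zero)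
  qed (use \<epsilon> in simp)
  \<comment> \<open>The factor \<open>2 powr q\<close> is the price of passing from
    \<open>t - t0\<close> to \<open>t\<close>, as \<open>t \<le> 2 * (t - t0)\<close>
    eventually.\<close>
  have e3: "\<forall>\<^sub>F t in at_top. \<forall>x. (t - t0) powr q * \<bar>semigroup (t - t0) ?f x - mass t0 * gauss (2 * \<a> * (t - t0)) x\<bar> < \<epsilon> / 8 / 2 powr q"
  proof -
    have "\<forall>\<^sub>F t in at_top. \<forall>x. t powr q * \<bar>semigroup t ?f x - mass t0 * gauss (2 * \<a> * t) x\<bar> < \<epsilon> / 8 / 2 powr q"
      unfolding q_def m0[symmetric] by (rule semigroup_asymptotics[OF semigroup_u(1,2)[OF t0(1)]]) (use \<epsilon> in simp)
    moreover have "filterlim (\<lambda>t. t - t0) at_top at_top" by real_asymp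
    ultimately show ?thesis by (rule eventually_compose_filterlim)
  qed
  have e4: "\<forall>\<^sub>F t in at_top. mass t0 * Kg * ((t / (t - t0)) powr q - 1) < \<epsilon> / 8"
  proof (rule order_tendstoD)
    have "((\<lambda>t. t / (t - t0)) \<longlongrightarrow> 1) at_top" by real_asymp
    then have "((\<lambda>t. mass t0 * Kg * ((t / (t - t0)) powr q - 1)) \<longlongrightarrow> mass t0 * Kg * (1 powr q - 1)) at_top"
      by (intro tendsto_intros) auto
    then show "((\<lambda>t. mass t0 * Kg * ((t / (t - t0)) powr q - 1)) \<longlongrightarrow> 0) at_top" by simp
  qed (use \<epsilon> in simp)
  from e1 e2 e3 e4 show ?thesis
  proof eventually_elim
    case (elim t)
    have t1: "1 \<le> t" "0 < t" "t0 < t" "0 < t - t0" "t / 2 \<le> t - t0" using elim(1) t0(1) by linarith+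
    define \<tau> where "\<tau> = (1 - \<delta>) * t"
    have \<tau>: "t / 2 \<le> \<tau>" "\<tau> \<le> t" "t - \<tau> = \<delta> * t"
    proof -
      have "(1 / 2) * t \<le> (1 - \<delta>) * t" using \<delta> t1 by (intro mult_right_mono) auto
      then show "t / 2 \<le> \<tau>" by (simp add: \<tau>_def)
      show "\<tau> \<le> t" using \<delta> t1 by (simp add: \<tau>_def mult_left_le_one_le)
      show "t - \<tau> = \<delta> * t" by (simp add: \<tau>_def algebra_simps)
    qed
    have \<tau>0: "0 < \<tau>" "t0 \<le> \<tau>" using \<tau>(1) t1 elim(1) by linarith+
    show ?case
    proof (intro allI impI)
      fix x assume x: "x \<notin> Z"
      define \<kappa> where "\<kappa> = (C1 * \<tau> powr (- q)) powr p"
      have \<kappa>: "u y s powr p \<le> \<kappa>" if "\<tau> \<le> s" "s \<le> t" "y \<notin> Z" for s y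
      proof -
        have "u y s \<le> C1 * s powr (- q)" using C1(2)[OF _ that(3)] that \<tau>0 by simp
        also have "\<dots> \<le> C1 * \<tau> powr (- q)" using C1(1) that \<tau>0 q by (intro mult_left_mono powr_mono2') auto
        finally show ?thesis unfolding \<kappa>_def using p_gt_1 u_nonneg by (intro powr_mono2) auto
      qed
      obtain f where f: "integrable lebesgue f" "\<And>x. 0 \<le> f x" "\<And>x. f x \<le> B" "(LINT x|lebesgue. f x) \<le> mass t0 - mass \<tau>"
        "deficit t0 t x \<le> semigroup (t - \<tau>) f x + \<kappa> * (t - \<tau>)"
        using deficit_window[OF t0(1) \<tau>0(2) \<tau>(2) x \<kappa>] by blast
      have tq: "t powr q * t powr (- q) = 1" using t1 by (simp add: powr_add[symmetric])
      have d1: "t powr q * deficit t0 t x \<le> \<epsilon> / 8 + C0 * \<delta> powr (- q) * \<eta> + \<epsilon> / 8"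
      proof -
        have dt: "0 < \<delta> * t" using \<delta> t1 by simp
        have "semigroup (\<delta> * t) f x \<le> (1 + \<delta> * t) * exp (- (\<delta> * t)) * B + C0 * (\<delta> * t) powr (- q) * (LINT y|lebesgue. \<bar>f y\<bar>)"
          using C0(2)[OF f(1) _ dt, of B x] f(2,3) by (simp add: abs_le_iff)
        also have "(LINT y|lebesgue. \<bar>f y\<bar>) = (LINT y|lebesgue. f y)" using f(2) by simp
        also have "C0 * (\<delta> * t) powr (- q) * (LINT y|lebesgue. f y) \<le> C0 * (\<delta> * t) powr (- q) * \<eta>"
          using f(4) limit_mass_le[of \<tau>] \<tau>0 C0(1) by (intro mult_left_mono) (auto simp: \<eta>_def)
        finally have s: "semigroup (\<delta> * t) f x \<le> (1 + \<delta> * t) * exp (- (\<delta> * t)) * B + C0 * (\<delta> * t) powr (- q) * \<eta>" by simp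
        have "t powr q * deficit t0 t x \<le> t powr q * (((1 + \<delta> * t) * exp (- (\<delta> * t)) * B + C0 * (\<delta> * t) powr (- q) * \<eta>) + \<kappa> * (\<delta> * t))"
          using f(5) s unfolding \<tau>(3) by (intro mult_left_mono) auto
        also have "\<dots> = B * (t powr q * ((1 + \<delta> * t) * exp (- (\<delta> * t)))) + C0 * \<delta> powr (- q) * \<eta> + t powr q * (\<kappa> * (\<delta> * t))"
        proof -
          have "(\<delta> * t) powr (- q) = \<delta> powr (- q) * t powr (- q)" using \<delta> t1 by (simp add: powr_mult)
          then have "t powr q * (C0 * (\<delta> * t) powr (- q) * \<eta>) = (t powr q * t powr (- q)) * (C0 * \<delta> powr (- q) * \<eta>)"
            by (simp only: mult_ac)
          then have "t powr q * (C0 * (\<delta> * t) powr (- q) * \<eta>) = C0 * \<delta> powr (- q) * \<eta>" unfolding tq by simp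
          then show ?thesis by (simp add: distrib_left mult_ac)
        qed
        also have "t powr q * (\<kappa> * (\<delta> * t)) \<le> \<epsilon> / 8"
        proof -
          have "\<kappa> = C1 powr p * \<tau> powr (- (q * p))"
            using C1 \<tau>0 by (simp add: \<kappa>_def powr_mult powr_powr)
          also have "\<tau> powr (- (q * p)) \<le> (t / 2) powr (- (q * p))"
            using \<tau> t1 q p_gt_1 by (intro powr_mono2') auto
          also have "(t / 2) powr (- (q * p)) = 2 powr (q * p) * t powr (- (q * p))"
            using t1 by (simp add: powr_divide powr_minus field_simps)
          finally have "\<kappa> \<le> K1 * t powr (- (q * p))" using C1 by (simp add: K1_def mult_ac mult_left_mono)
          then have "t powr q * (\<kappa> * (\<delta> * t)) \<le> t powr q * ((K1 * t powr (- (q * p))) * (\<delta> * t))"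
            using \<delta> t1 by (intro mult_left_mono mult_right_mono) auto
          also have "\<dots> = (K1 * \<delta>) * (t powr q * t powr (- (q * p)) * t powr 1)" using t1 by (simp add: mult_ac)
          also have "t powr q * t powr (- (q * p)) * t powr 1 = t powr (q + 1 - q * p)"
          proof -
            have "t powr (q + - (q * p) + 1) = t powr q * t powr (- (q * p)) * t powr 1" by (simp only: powr_add)
            moreover have "q + - (q * p) + 1 = q + 1 - q * p" by simp
            ultimately show ?thesis by (simp only:)
          qed
          \<comment> \<open>The lower bound on \<open>p\<close> makes the exponent nonpositive, and
            \<open>1 \<le> t\<close>.\<close>
          also have "(K1 * \<delta>) * t powr (q + 1 - q * p) \<le> (K1 * \<delta>) * t powr 0"
            using K1 \<delta> t1 qp by (intro mult_left_mono powr_mono) auto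
          also have "\<dots> \<le> \<epsilon> / 8" using \<delta>(3) t1 by simp
          finally show ?thesis .
        qed
        finally show ?thesis using elim(2) by linarith
      qed
      have d2: "t powr q * \<bar>semigroup (t - t0) ?f x - mass t0 * gauss (2 * \<a> * (t - t0)) x\<bar> \<le> \<epsilon> / 8"
      proof -
        have "t powr q \<le> (2 * (t - t0)) powr q" using t1 q by (intro powr_mono2) auto
        also have "\<dots> = 2 powr q * (t - t0) powr q" by (subst powr_mult) (use t1 in auto)
        finally have "t powr q * \<bar>semigroup (t - t0) ?f x - mass t0 * gauss (2 * \<a> * (t - t0)) x\<bar> \<le>
           2 powr q * (t - t0) powr q * \<bar>semigroup (t - t0) ?f x - mass t0 * gauss (2 * \<a> * (t - t0)) x\<bar>"
          by (rule mult_right_mono) simp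
        also have "\<dots> = 2 powr q * ((t - t0) powr q * \<bar>semigroup (t - t0) ?f x - mass t0 * gauss (2 * \<a> * (t - t0)) x\<bar>)"
          by (simp only: mult.assoc)
        also have "\<dots> \<le> 2 powr q * (\<epsilon> / 8 / 2 powr q)" using elim(3) by (intro mult_left_mono less_imp_le) auto
        finally show ?thesis by simp
      qed
      have d3: "t powr q * (mass t0 * \<bar>gauss (2 * \<a> * (t - t0)) x - gauss (2 * \<a> * t) x\<bar>) \<le> \<epsilon> / 8"
      proof -
        have "\<bar>gauss (2 * \<a> * (t - t0)) x - gauss (2 * \<a> * t) x\<bar> \<le> Kg * (t - t0) powr (- q) - Kg * t powr (- q)"
          using gauss_diff_le[of "2 * \<a> * (t - t0)" "2 * \<a> * t" x] a_pos t1 t0 by (simp add: g0 mult_left_mono)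
        then have "t powr q * (mass t0 * \<bar>gauss (2 * \<a> * (t - t0)) x - gauss (2 * \<a> * t) x\<bar>) \<le> t powr q * (mass t0 * (Kg * (t - t0) powr (- q) - Kg * t powr (- q)))"
          using mass_nonneg by (intro mult_left_mono) auto
        also have "\<dots> = mass t0 * Kg * (t powr q * (t - t0) powr (- q) - t powr q * t powr (- q))" by (simp add: algebra_simps)
        also have "t powr q * (t - t0) powr (- q) = (t / (t - t0)) powr q" using t1 by (simp add: powr_divide powr_minus_divide)
        finally show ?thesis using elim(4) unfolding tq by linarith
      qed
      have d4: "t powr q * (\<eta> * gauss (2 * \<a> * t) x) \<le> Kg * \<eta>"
      proof -
        have "gauss (2 * \<a> * t) x \<le> Kg * t powr (- q)"
          using gauss_le_gauss_0[of "2 * \<a> * t" x] a_pos t1 by (simp add: g0)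
        then have "t powr q * (\<eta> * gauss (2 * \<a> * t) x) \<le> t powr q * (\<eta> * (Kg * t powr (- q)))"
          using \<eta> by (intro mult_left_mono) auto
        also have "\<dots> = (t powr q * t powr (- q)) * (Kg * \<eta>)" by (simp only: mult_ac)
        finally show ?thesis unfolding tq by simp
      qed
      \<comment> \<open>Four replacements: \<open>u\<close> by the linear flow from
        \<open>t0\<close>, the flow by its Gaussian profile, the time \<open>t - t0\<close> by
        \<open>t\<close>, and \<open>mass t0\<close> by \<open>limit_mass\<close>.\<close>
      have "u x t - limit_mass * gauss (2 * \<a> * t) x = - deficit t0 t x + (semigroup (t - t0) ?f x - mass t0 * gauss (2 * \<a> * (t - t0)) x)
         + mass t0 * (gauss (2 * \<a> * (t - t0)) x - gauss (2 * \<a> * t) x) + \<eta> * gauss (2 * \<a> * t) x"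
        by (simp add: deficit_def \<eta>_def algebra_simps)
      moreover have "\<bar>mass t0 * (gauss (2 * \<a> * (t - t0)) x - gauss (2 * \<a> * t) x)\<bar> = mass t0 * \<bar>gauss (2 * \<a> * (t - t0)) x - gauss (2 * \<a> * t) x\<bar>"
        using mass_nonneg[of t0] by (simp add: abs_mult)
      moreover have "0 \<le> \<eta> * gauss (2 * \<a> * t) x" "0 \<le> deficit t0 t x" using \<eta> deficit_nonneg[OF t0(1) _ x] t1 by auto
      ultimately have "\<bar>u x t - limit_mass * gauss (2 * \<a> * t) x\<bar> \<le> deficit t0 t x + \<bar>semigroup (t - t0) ?f x - mass t0 * gauss (2 * \<a> * (t - t0)) x\<bar>
         + mass t0 * \<bar>gauss (2 * \<a> * (t - t0)) x - gauss (2 * \<a> * t) x\<bar> + \<eta> * gauss (2 * \<a> * t) x"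
        by linarith
      then have "t powr q * \<bar>u x t - limit_mass * gauss (2 * \<a> * t) x\<bar> \<le> t powr q * (deficit t0 t x + \<bar>semigroup (t - t0) ?f x - mass t0 * gauss (2 * \<a> * (t - t0)) x\<bar>
         + mass t0 * \<bar>gauss (2 * \<a> * (t - t0)) x - gauss (2 * \<a> * t) x\<bar> + \<eta> * gauss (2 * \<a> * t) x)"
        by (rule mult_left_mono) simp
      also have "\<dots> \<le> (\<epsilon> / 8 + C0 * \<delta> powr (- q) * \<eta> + \<epsilon> / 8) + \<epsilon> / 8 + \<epsilon> / 8 + Kg * \<eta>"
        unfolding distrib_left using d1 d2 d3 d4 by linarith
      also have "\<dots> = K2 * \<eta> + 4 * (\<epsilon> / 8)" by (simp add: K2_def algebra_simps)
      also have "\<dots> < \<epsilon>" using \<eta>(2) \<epsilon> by linarith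
      finally show "t powr (real DIM('a) / 2) * \<bar>u x t - limit_mass * gauss (2 * \<a> * t) x\<bar> < \<epsilon>" by (simp add: q_def)
    qed
  qed
qed

text \<open>If mass survived in the critical case, the diffusive profile would force \<open>absorbed t \<ge> c / t\<close>,
  which is not integrable.\<close>

lemma limit_mass_critical:
  assumes p: "p = 1 + 2 / real DIM('a)"
  shows "limit_mass = 0"
proof (rule ccontr)
  assume "limit_mass \<noteq> 0"
  then have lm: "0 < limit_mass" using limit_mass_nonneg by simp
  define q where "q = real DIM('a) / 2"
  have qp: "q * p = q + 1" by (simp add: q_def p field_simps)
  \<comment> \<open>Half of a lower bound for \<open>t powr q\<close> times the profile on the ball
    of radius \<open>sqrt t\<close>; the approximation error may use up the other half.\<close>
  define c0 where "c0 = limit_mass * ((4 * pi * \<a>) powr (- q) * exp (- 1 / (4 * \<a>))) / 2"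
  have c0: "0 < c0" using lm a_pos by (simp add: c0_def)
  have "\<forall>\<^sub>F t in at_top. \<forall>x. x \<notin> Z \<longrightarrow> t powr q * \<bar>u x t - limit_mass * gauss (2 * \<a> * t) x\<bar> < c0"
    unfolding q_def by (rule u_asymptotics[OF _ c0]) (simp add: p)
  then obtain T0 where T0: "\<And>t x. T0 \<le> t \<Longrightarrow> x \<notin> Z \<Longrightarrow> t powr q * \<bar>u x t - limit_mass * gauss (2 * \<a> * t) x\<bar> < c0"
    by (auto simp: eventually_at_top_linorder)
  define T where "T = max 1 T0"
  define V where "V = unit_ball_vol (real DIM('a))"
  have V: "0 < V" by (simp add: V_def)
  define c1 where "c1 = c0 powr p * V"
  have c1: "0 < c1" using c0 V by (simp add: c1_def)
  have low: "c1 / t \<le> absorbed t" if t: "T \<le> t" for t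
  proof -
    have t1: "0 < t" "T0 \<le> t" using t by (auto simp: T_def)
    have ul: "c0 * t powr (- q) \<le> u x t" if x: "x \<notin> Z" and n: "x \<in> cball 0 (sqrt t)" for x
    proof -
      have "(norm x)\<^sup>2 \<le> (sqrt t)\<^sup>2" using n by (intro power_mono) auto
      then have "(norm x)\<^sup>2 / (2 * (2 * \<a> * t)) \<le> 1 / (4 * \<a>)" using t1 a_pos by (simp add: field_simps)
      then have "exp (- 1 / (4 * \<a>)) \<le> exp (- (norm x)\<^sup>2 / (2 * (2 * \<a> * t)))" by simp
      then have "(4 * pi * \<a>) powr (- q) * t powr (- q) * exp (- 1 / (4 * \<a>)) \<le> gauss (2 * \<a> * t) (0::'a) * exp (- (norm x)\<^sup>2 / (2 * (2 * \<a> * t)))"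
        using gauss_0_scaled[OF t1(1)] by (simp add: q_def mult_left_mono)
      also have "\<dots> = gauss (2 * \<a> * t) x" by (simp add: gauss_def)
      finally have "limit_mass * ((4 * pi * \<a>) powr (- q) * t powr (- q) * exp (- 1 / (4 * \<a>))) \<le> limit_mass * gauss (2 * \<a> * t) x"
        using lm by (intro mult_left_mono) auto
      then have g: "2 * c0 * t powr (- q) \<le> limit_mass * gauss (2 * \<a> * t) x" by (simp add: c0_def mult_ac)
      have "\<bar>u x t - limit_mass * gauss (2 * \<a> * t) x\<bar> \<le> c0 * t powr (- q)"
        using T0[OF t1(2) x] t1 by (simp add: powr_minus field_simps less_imp_le)
      then show ?thesis using g by linarith
    qed
    \<comment> \<open>The ball has volume \<open>V * t powr q\<close>, and
      \<open>q * p = q + 1\<close> at the critical power, so the powers of \<open>t\<close> combine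
      to \<open>1 / t\<close>.\<close>
    have "c1 / t = (c0 * t powr (- q)) powr p * (V * sqrt t ^ DIM('a))"
    proof -
      have "sqrt t ^ DIM('a) = t powr q"
        using t1 by (simp add: q_def powr_half_sqrt[symmetric] powr_powr powr_realpow[symmetric] del: powr_half_sqrt)
      moreover have "(c0 * t powr (- q)) powr p = c0 powr p * t powr (- (q * p))"
        using c0 t1 by (simp add: powr_mult powr_powr)
      moreover have "t powr (- (q * p)) * t powr q = 1 / t" unfolding qp using t1
        by (simp add: powr_add[symmetric] powr_minus_divide)
      ultimately show ?thesis by (simp add: c1_def) (metis (no_types, lifting) mult.assoc mult.commute times_divide_eq_right mult_1_right)
    qed
    also have "\<dots> = (LINT x|lebesgue. (c0 * t powr (- q)) powr p * indicat_real (cball (0::'a) (sqrt t)) x)"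
      using content_cball[of "sqrt t" "0::'a"] t1 by (simp add: V_def)
    also have "\<dots> \<le> absorbed t"
      unfolding absorbed_def
    proof (rule integral_mono_AE)
      show "integrable lebesgue (\<lambda>x. (c0 * t powr (- q)) powr p * indicat_real (cball (0::'a) (sqrt t)) x)"
        using lmeasurable_cball lmeasurable_iff_integrable by (intro integrable_mult_right) blast
      show "integrable lebesgue (\<lambda>x. u x t powr p)" using integrable_u_powr t1 by simp
      show "AE x in lebesgue. (c0 * t powr (- q)) powr p * indicat_real (cball 0 (sqrt t)) x \<le> u x t powr p"
        using AE_not_in_negligible[OF negligible_Z]
      proof eventually_elim
        case (elim x)
        show ?case
        proof (cases "x \<in> cball 0 (sqrt t)")
          case True
          then show ?thesis using ul[OF elim True] c0 p_gt_1 by (simp add: powr_mono2)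
        qed simp
      qed
    qed
    finally show ?thesis .
  qed
  \<comment> \<open>The derivative \<open>- absorbed r + c1 / r\<close> is nonpositive by
    \<open>low\<close>: growth of the logarithm has to be paid for by the mass.\<close>
  have "mass t + c1 * ln t \<le> mass T + c1 * ln T" if t: "T \<le> t" for t
  proof (rule DERIV_nonpos_imp_decreasing_open[OF t])
    have T1: "0 < T" by (simp add: T_def)
    have d: "((\<lambda>t. mass t + c1 * ln t) has_real_derivative - absorbed r + c1 * (1 / r)) (at r)" if "T \<le> r" for r
      using T1 that by (auto intro!: derivative_eq_intros has_real_derivative_mass)
    show "continuous_on {T..t} (\<lambda>t. mass t + c1 * ln t)"
      by (rule DERIV_continuous_on, rule has_field_derivative_at_within, rule d) auto
    show "\<exists>y. ((\<lambda>t. mass t + c1 * ln t) has_real_derivative y) (at r) \<and> y \<le> 0" if "T < r" "r < t" for r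
      using d[of r] low[of r] that by (intro exI[of _ "- absorbed r + c1 * (1 / r)"]) auto
  qed
  \<comment> \<open>With this \<open>t\<close>, \<open>c1 * ln t\<close> exceeds
    \<open>c1 * ln T\<close> by \<open>mass T + 1\<close>, so \<open>mass t\<close> would be at most
    \<open>- 1\<close>.\<close>
  moreover define t where "t = T * exp ((mass T + 1) / c1)"
  have T1: "0 < T" by (simp add: T_def)
  have "0 \<le> (mass T + 1) / c1" using mass_nonneg[of T] c1 by simp
  then have "T * 1 \<le> t" unfolding t_def using T1 by (intro mult_left_mono) auto
  ultimately have "mass t + c1 * ln t \<le> mass T + c1 * ln T" by simp
  moreover have "ln t = ln T + (mass T + 1) / c1" using T1 by (simp add: t_def ln_mult)
  then have "c1 * ln t = c1 * ln T + (mass T + 1)" using c1 by (simp add: field_simps)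
  ultimately show False using mass_nonneg[of t] by linarith
qed

end

section \<open>The second moment of a radial kernel\<close>

text \<open>Permuting coordinates carries boxes to boxes with the same side lengths, and boxes
  determine the measure. As the permutation is its own inverse, preimages of boxes can be written
  with \<open>T\<close> itself.\<close>

lemma lborel_distr_involution:
  fixes T :: "'a::euclidean_space \<Rightarrow> 'a" and \<pi> :: "'a \<Rightarrow> 'a"
  assumes \<pi>: "bij_betw \<pi> Basis Basis" "\<And>b. b \<in> Basis \<Longrightarrow> \<pi> (\<pi> b) = b"
    and T: "\<And>x b. b \<in> Basis \<Longrightarrow> T x \<bullet> b = x \<bullet> \<pi> b" and m: "T \<in> borel_measurable borel"
  shows "distr lborel borel T = lborel"
proof (rule lborel_eqI[symmetric])
  fix l v :: 'a assume lv: "\<And>b. b \<in> Basis \<Longrightarrow> l \<bullet> b \<le> v \<bullet> b"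
  have \<pi>b: "\<pi> b \<in> Basis" if "b \<in> Basis" for b using \<pi>(1) that bij_betwE by blast
  have "T -` box l v = box (T l) (T v)"
  proof -
    have "(\<forall>b\<in>Basis. l \<bullet> b < x \<bullet> \<pi> b \<and> x \<bullet> \<pi> b < v \<bullet> b) \<longleftrightarrow> (\<forall>b\<in>Basis. l \<bullet> \<pi> b < x \<bullet> b \<and> x \<bullet> b < v \<bullet> \<pi> b)" for x
      using \<pi>b \<pi>(2) by metis
    then show ?thesis by (auto simp: box_def T)
  qed
  then have "emeasure (distr lborel borel T) (box l v) = emeasure lborel (box (T l) (T v))"
    using m by (simp add: emeasure_distr)
  also have "\<dots> = (\<Prod>b\<in>Basis. (T v - T l) \<bullet> b)"
    using lv \<pi>b by (subst emeasure_lborel_box) (auto simp: T)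
  also have "(\<Prod>b\<in>Basis. (T v - T l) \<bullet> b) = (\<Prod>b\<in>Basis. (v - l) \<bullet> \<pi> b)"
    by (intro prod.cong refl) (simp add: T inner_diff_left)
  also have "\<dots> = (\<Prod>b\<in>Basis. (v - l) \<bullet> b)" by (rule prod.reindex_bij_betw[OF \<pi>(1)])
  finally show "emeasure (distr lborel borel T) (box l v) = (\<Prod>b\<in>Basis. (v - l) \<bullet> b)" .
qed simp

lemma integral_lborel_involution:
  fixes T :: "'a::euclidean_space \<Rightarrow> 'a" and g :: "'a \<Rightarrow> real"
  assumes "distr lborel borel T = lborel" "T \<in> borel_measurable borel" "g \<in> borel_measurable borel"
  shows "(LINT x|lebesgue. g (T x)) = (LINT x|lebesgue. g x)"
proof -
  have "(LINT x|lborel. g (T x)) = (LINT x|distr lborel borel T. g x)"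
    by (rule integral_distr[symmetric]) (use assms(2,3) in simp_all)
  then have "(LINT x|lborel. g (T x)) = (LINT x|lborel. g x)" unfolding assms(1) .
  moreover have "(\<lambda>x. g (T x)) \<in> borel_measurable borel" using measurable_compose[OF assms(2,3)] .
  ultimately show ?thesis using assms(3) by (simp add: integral_completion)
qed

text \<open>A radial \<open>J\<close> is invariant under swapping two coordinates, which equates the
  diagonal moments, and under changing the sign of one, which kills the mixed ones. The trace then
  fixes the common diagonal value.\<close>

lemma radial_second_moment:
  fixes J :: "'a::euclidean_space \<Rightarrow> real"
  assumes c: "continuous_on UNIV J" and s: "\<And>x. J x \<noteq> 0 \<Longrightarrow> norm x \<le> \<rho>" and r: "radially_symmetric J"
  shows "(LINT x|lebesgue. J x * (x \<bullet> \<eta>)\<^sup>2) = 2 * diffusivity J * (norm \<eta>)\<^sup>2"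
proof -
  define m where "m i j = (LINT x|lebesgue. J x * ((x \<bullet> i) * (x \<bullet> j)))" for i j
  have int: "integrable lebesgue (\<lambda>x. J x * ((x \<bullet> i) * (x \<bullet> j)))" for i j
    by (rule integrable_continuous_bounded_support[where \<rho>=\<rho>]) (use s in \<open>auto intro!: continuous_intros c\<close>)
  have meas: "(\<lambda>x. J x * ((x \<bullet> i) * (x \<bullet> j))) \<in> borel_measurable borel" for i j
    by (intro borel_measurable_continuous_onI continuous_intros c)
  have diag: "m i i = m j j" if ij: "i \<in> Basis" "j \<in> Basis" "i \<noteq> j" for i j
  proof -
    \<comment> \<open>The reflection in the hyperplane orthogonal to \<open>i - j\<close>. Its usual
      factor \<open>2 / (norm (i - j))\<^sup>2\<close> equals \<open>1\<close>, and it swaps the two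
      coordinates.\<close>
    define T where "T x = x - (x \<bullet> (i - j)) *\<^sub>R (i - j)" for x
    define \<pi> where "\<pi> = Transposition.transpose i j"
    have Tb: "T x \<bullet> b = x \<bullet> \<pi> b" if "b \<in> Basis" for x b
      using that ij by (cases "b = i"; cases "b = j") (auto simp: T_def \<pi>_def Transposition.transpose_def inner_diff_left inner_diff_right inner_Basis algebra_simps)
    have bij: "bij_betw \<pi> Basis Basis"
      unfolding \<pi>_def by (rule bij_betwI[where g="Transposition.transpose i j"]) (use ij in \<open>auto simp: Transposition.transpose_def\<close>)
    have Tm: "T \<in> borel_measurable borel" unfolding T_def[abs_def] by measurable
    have d: "distr lborel borel T = lborel"
      by (rule lborel_distr_involution[OF bij _ Tb Tm]) (simp add: \<pi>_def)
    have "(norm (T x))\<^sup>2 = (norm x)\<^sup>2" for x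
    proof -
      have "(norm (i - j))\<^sup>2 = 2" using ij unfolding power2_norm_eq_inner by (simp add: inner_diff_left inner_diff_right inner_Basis)
      then show ?thesis unfolding T_def power2_norm_eq_inner[of "x - _"]
        by (simp add: inner_diff_left[of x] inner_diff_right[of _ x] power2_norm_eq_inner inner_commute)
    qed
    then have "norm (T x) = norm x" for x by (simp add: power2_eq_iff_nonneg)
    then have "J (T x) = J x" for x using r unfolding radially_symmetric_def by blast
    moreover have "T x \<bullet> i = x \<bullet> j" for x using Tb[OF ij(1)] by (simp add: \<pi>_def)
    ultimately show ?thesis using integral_lborel_involution[OF d Tm meas[of i i]] by (simp add: m_def)
  qed
  have off: "m i j = 0" if ij: "i \<in> Basis" "j \<in> Basis" "i \<noteq> j" for i j
  proof -
    \<comment> \<open>The sign change of the coordinate \<open>i\<close>, written as an affine map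
      so that \<open>lborel_affine_euclidean\<close> applies.\<close>
    define T where "T x = (0::'a) + (\<Sum>b\<in>Basis. ((if b = i then -1 else 1) * (x \<bullet> b)) *\<^sub>R b)" for x
    have Tb: "T x \<bullet> b = (if b = i then -1 else 1) * (x \<bullet> b)" if "b \<in> Basis" for x b
      using that by (simp add: T_def inner_sum_left_Basis)
    have Tm: "T \<in> borel_measurable borel" unfolding T_def[abs_def] by measurable
    have "lborel = density (distr lborel borel T) (\<lambda>_. (\<Prod>b\<in>Basis. \<bar>if b = i then -1 else 1 :: real\<bar>))"
      unfolding T_def[abs_def] by (rule lborel_affine_euclidean) auto
    moreover have "(\<Prod>b\<in>Basis. \<bar>if b = i then -1 else 1 :: real\<bar>) = 1" by (rule prod.neutral) auto
    ultimately have d: "distr lborel borel T = lborel" by (simp add: density_1)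
    have "norm (T x) = norm x" for x
      unfolding norm_eq_sqrt_inner by (subst (1 2) euclidean_inner) (auto simp: Tb intro!: arg_cong[where f=sqrt] sum.cong)
    then have "J (T x) = J x" for x using r unfolding radially_symmetric_def by blast
    then have "(LINT x|lebesgue. - (J x * ((x \<bullet> i) * (x \<bullet> j)))) = m i j"
      using integral_lborel_involution[OF d Tm meas[of i j]] ij by (simp add: m_def Tb)
    then show ?thesis by (simp add: m_def)
  qed
  obtain k :: 'a where k: "k \<in> Basis" using nonempty_Basis[where 'a='a] by blast
  have mk: "m i i = m k k" if "i \<in> Basis" for i using diag[OF that k] by (cases "i = k") auto
  have "(LINT x|lebesgue. J x * (norm x)\<^sup>2) = (\<Sum>i\<in>Basis. m i i)"
  proof -
    have "J x * (norm x)\<^sup>2 = (\<Sum>i\<in>Basis. J x * ((x \<bullet> i) * (x \<bullet> i)))" for x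
      unfolding power2_norm_eq_inner by (subst euclidean_inner) (simp add: sum_distrib_left)
    then show ?thesis using int by (simp add: m_def Bochner_Integration.integral_sum)
  qed
  then have tr: "2 * diffusivity J = m k k"
    using mk by (simp add: diffusivity_def)
  have "(LINT x|lebesgue. J x * (x \<bullet> \<eta>)\<^sup>2) = (\<Sum>i\<in>Basis. \<Sum>j\<in>Basis. (\<eta> \<bullet> i) * (\<eta> \<bullet> j) * m i j)"
  proof -
    have "J x * (x \<bullet> \<eta>)\<^sup>2 = (\<Sum>i\<in>Basis. \<Sum>j\<in>Basis. (\<eta> \<bullet> i) * (\<eta> \<bullet> j) * (J x * ((x \<bullet> i) * (x \<bullet> j))))" for x
    proof -
      have "(x \<bullet> \<eta>)\<^sup>2 = (\<Sum>i\<in>Basis. (x \<bullet> i) * (\<eta> \<bullet> i)) * (\<Sum>j\<in>Basis. (x \<bullet> j) * (\<eta> \<bullet> j))"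
        unfolding power2_eq_square by (subst (1 2) euclidean_inner) simp
      then show ?thesis by (simp add: sum_product sum_distrib_left mult_ac)
    qed
    then show ?thesis unfolding m_def using int
      by (simp add: Bochner_Integration.integral_sum Bochner_Integration.integrable_sum)
  qed
  also have "\<dots> = (\<Sum>i\<in>Basis. (\<eta> \<bullet> i)\<^sup>2 * m k k)"
  proof (rule sum.cong[OF refl])
    fix i :: 'a assume i: "i \<in> Basis"
    have "(\<Sum>j\<in>Basis. (\<eta> \<bullet> i) * (\<eta> \<bullet> j) * m i j) = (\<Sum>j\<in>Basis. if i = j then (\<eta> \<bullet> i)\<^sup>2 * m k k else 0)"
      by (rule sum.cong[OF refl]) (use off[OF i] mk[OF i] in \<open>auto simp: power2_eq_square\<close>)
    also have "\<dots> = (\<eta> \<bullet> i)\<^sup>2 * m k k" using i by (simp add: sum.delta')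
    finally show "(\<Sum>j\<in>Basis. (\<eta> \<bullet> i) * (\<eta> \<bullet> j) * m i j) = (\<eta> \<bullet> i)\<^sup>2 * m k k" .
  qed
  also have "\<dots> = (norm \<eta>)\<^sup>2 * m k k"
  proof -
    have "\<eta> \<bullet> \<eta> = (\<Sum>i\<in>Basis. (\<eta> \<bullet> i)\<^sup>2)" by (subst euclidean_inner) (simp add: power2_eq_square)
    then show ?thesis unfolding power2_norm_eq_inner by (simp add: sum_distrib_right)
  qed
  finally show ?thesis using tr by simp
qed

section \<open>Reduction of the hypotheses to the two locales\<close>

lemma dispersal_kernelI:
  fixes J :: "'a::euclidean_space \<Rightarrow> real"
  assumes J: "smooth_compact_support J" "radially_symmetric J" "\<And>x. 0 \<le> J x" "(LINT x|lebesgue. J x) = 1"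
  shows "dispersal_kernel J (diffusivity J)"
proof
  have "C_class 0 J" using J(1) unfolding smooth_compact_support_def by blast
  then show c: "continuous_on UNIV J" by simp
  have "bounded (closure (support_on UNIV J))"
    using J(1) unfolding smooth_compact_support_def compact_support_def by (auto intro: compact_imp_bounded)
  then have "bounded (support_on UNIV J)" using bounded_subset closure_subset by blast
  then obtain \<rho> where \<rho>: "\<forall>x\<in>support_on UNIV J. norm x \<le> \<rho>" unfolding bounded_iff by blast
  then have s: "J x \<noteq> 0 \<Longrightarrow> norm x \<le> \<rho>" for x by (auto simp: support_on_def)
  then show "\<exists>\<rho>. \<forall>x. J x \<noteq> 0 \<longrightarrow> norm x \<le> \<rho>" by blast
  show "0 \<le> J x" for x by (rule J(3))
  show "J (- x) = J x" for x using J(2) unfolding radially_symmetric_def by (metis norm_minus_cancel)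
  show "(LINT x|lebesgue. J x) = 1" by (rule J(4))
  show "(LINT x|lebesgue. J x * (x \<bullet> \<eta>)\<^sup>2) = 2 * diffusivity J * (norm \<eta>)\<^sup>2" for \<eta>
    by (rule radial_second_moment[OF c s J(2)])
qed

text \<open>Setting \<open>u\<close> to zero on the exceptional set changes no integral and makes the sign and the bound
  hold everywhere.\<close>

lemma absorption_solutionI:
  fixes J :: "'a::euclidean_space \<Rightarrow> real"
  assumes J: "dispersal_kernel J \<a>" and p: "1 < p" and Z: "negligible Z"
    and u0: "integrable lebesgue u0" and u: "nonlocal_solution J p u0 Z u"
  obtains B where "absorption_solution J \<a> p B Z (\<lambda>x t. if x \<in> Z \<or> t < 0 then 0 else u x t)"
proof -
  interpret dispersal_kernel J \<a> by (rule J)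
  \<comment> \<open>Negative times are cleared as well: \<open>nonlocal_solution\<close> says
    nothing about them, while the locale asks for sign, bound and measurability at every real
    time.\<close>
  let ?v = "\<lambda>x t. if x \<in> Z \<or> t < 0 then 0 else u x t"
  have nn: "\<And>x t. x \<notin> Z \<Longrightarrow> 0 \<le> t \<Longrightarrow> 0 \<le> u x t"
    and meas: "\<And>t. 0 \<le> t \<Longrightarrow> (\<lambda>x. u x t) \<in> borel_measurable lebesgue"
    and init: "\<And>x. x \<notin> Z \<Longrightarrow> u x 0 = u0 x"
    and cont: "\<And>x. x \<notin> Z \<Longrightarrow> continuous_on {0..} (u x)"
    and eqn: "\<And>x t. x \<notin> Z \<Longrightarrow> 0 < t \<Longrightarrow> (u x has_real_derivative
        (LINT y|lebesgue. J (x - y) * (u y t - u x t)) - u x t powr p) (at t)"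
    using u unfolding nonlocal_solution_def by auto
  have "\<exists>B. \<forall>x. x \<notin> Z \<longrightarrow> (\<forall>t\<ge>0. u x t \<le> B)"
    using u unfolding nonlocal_solution_def by (elim conjE) assumption
  then obtain B where B: "\<And>x t. x \<notin> Z \<Longrightarrow> 0 \<le> t \<Longrightarrow> u x t \<le> B" by metis
  have Zs: "Z \<in> sets lebesgue" using Z by (simp add: negligible_iff_null_sets null_setsD2)
  have vm: "(\<lambda>x. ?v x t) \<in> borel_measurable lebesgue" for t
  proof (cases "t < 0")
    case False
    then have "(\<lambda>x. if x \<in> Z then 0 else u x t) \<in> borel_measurable lebesgue"
      using Zs meas[of t] by (intro measurable_If_set) auto
    then show ?thesis using False by simp
  qed simp
  have nZ: "AE x in lebesgue. x \<notin> Z" by (rule AE_not_in_negligible[OF Z])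
  have v0: "0 \<le> ?v x t" "?v x t \<le> \<bar>B\<bar>" for x t using nn[of x t] B[of x t] by (auto intro: order.trans[OF _ abs_ge_self])
  have "absorption_solution J \<a> p \<bar>B\<bar> Z ?v"
  proof
    show "1 < p" "negligible Z" by fact+
    show "0 \<le> ?v x t" "?v x t \<le> \<bar>B\<bar>" for x t by (rule v0)+
    show "(\<lambda>x. ?v x t) \<in> borel_measurable lebesgue" for t by (rule vm)
    show "continuous_on {0..} (?v x)" if "x \<notin> Z" for x
      by (rule continuous_on_eq[OF cont[OF that]]) (use that in auto)
    show "integrable lebesgue (\<lambda>x. ?v x 0)"
      by (rule integrable_cong_AE_imp[OF u0 vm]) (use nZ init in \<open>auto elim: eventually_mono\<close>)
    fix x t assume x: "x \<notin> Z" and t: "0 < (t::real)"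
    have "(LINT y|lebesgue. J (x - y) * (u y t - u x t)) = (LINT y|lebesgue. J (x - y) * ?v y t - u x t * J (x - y))"
    proof (rule integral_cong_AE)
      have Jm: "(\<lambda>y. J (x - y)) \<in> borel_measurable lebesgue" by (rule J_shift_measurable)
      show "(\<lambda>y. J (x - y) * (u y t - u x t)) \<in> borel_measurable lebesgue" 
      proof -
        have "(\<lambda>y. u y t) \<in> borel_measurable lebesgue" using meas t by simp
        then show ?thesis by (intro borel_measurable_times borel_measurable_diff Jm borel_measurable_const)
      qed
      show "(\<lambda>y. J (x - y) * ?v y t - u x t * J (x - y)) \<in> borel_measurable lebesgue"
        by (intro borel_measurable_diff borel_measurable_times Jm vm borel_measurable_const)
      show "AE y in lebesgue. J (x - y) * (u y t - u x t) = J (x - y) * ?v y t - u x t * J (x - y)"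
        using nZ by eventually_elim (use t in \<open>simp add: algebra_simps\<close>)
    qed
    also have "\<dots> = conv (\<lambda>y. ?v y t) x - u x t"
    proof -
      have "integrable lebesgue (\<lambda>y. J (x - y) * ?v y t)"
        by (rule integrable_conv_bounded[OF vm, where B="\<bar>B\<bar>"]) (use v0[of _ t] in \<open>simp add: abs_le_iff\<close>)
      then have "(LINT y|lebesgue. J (x - y) * ?v y t - u x t * J (x - y)) = (LINT y|lebesgue. J (x - y) * ?v y t) - (LINT y|lebesgue. u x t * J (x - y))"
        using integrable_J_shift by (intro Bochner_Integration.integral_diff integrable_mult_right)
      then show ?thesis unfolding conv_def by (simp only: integral_mult_right_zero integral_J_shift mult_1_right)
    qed
    finally have "(u x has_real_derivative conv (\<lambda>y. ?v y t) x - ?v x t - ?v x t powr p) (at t)"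
      using eqn[OF x t] x t by simp
    then show "(?v x has_real_derivative conv (\<lambda>y. ?v y t) x - ?v x t - ?v x t powr p) (at t)"
      by (rule has_field_derivative_transform_within_open[of _ _ _ "{0<..}"]) (use x t in auto)
  qed
  then show ?thesis by (rule that)
qed

theorem theorem4p3:
  fixes J u0 :: "real ^ 'n \<Rightarrow> real"
    and u :: "real ^ 'n \<Rightarrow> real \<Rightarrow> real"
    and p M :: real
    and Z :: "(real ^ 'n) set"
  assumes J_smooth: "smooth_compact_support J"
    and J_radial: "radially_symmetric J"
    and J_nonneg: "\<And>x. 0 \<le> J x"
    and J_mass: "(LINT x|lebesgue. J x) = 1"
    and u0_L1: "integrable lebesgue u0"
    and u0_Linf: "\<exists>C. AE x in lebesgue. \<bar>u0 x\<bar> \<le> C"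
    and u0_nonneg: "AE x in lebesgue. 0 \<le> u0 x"
    and p: "p \<ge> 1 + 2 / real CARD('n)"
    and Z: "negligible Z"
    and u: "nonlocal_solution J p u0 Z u"
    and M: "M = (LINT x|lebesgue. u0 x)
                - (LINT t:{0..}|lebesgue. LINT x|lebesgue. u x t powr p)"
  shows "(p > 1 + 2 / real CARD('n) \<longrightarrow>
           (\<forall>U. heat_solution_delta (diffusivity J) M U \<longrightarrow>
             (\<forall>R>0. \<forall>\<epsilon>>0. \<forall>\<^sub>F t in at_top. \<forall>x. x \<notin> Z \<and> norm x \<le> R * sqrt t \<longrightarrow>
               t powr (real CARD('n) / 2) * \<bar>u x t - U x t\<bar> < \<epsilon>))) \<and>
         (p = 1 + 2 / real CARD('n) \<longrightarrow>
           (\<forall>R>0. \<forall>\<epsilon>>0. \<forall>\<^sub>F t in at_top. \<forall>x. x \<notin> Z \<and> norm x \<le> R * sqrt t \<longrightarrow>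
             t powr (real CARD('n) / 2) * u x t < \<epsilon>))"
proof -
  have k: "dispersal_kernel J (diffusivity J)" by (rule dispersal_kernelI[OF J_smooth J_radial J_nonneg J_mass])
  have p1: "1 < p"
  proof -
    have "0 < 2 / real CARD('n)" by simp
    with p show ?thesis by linarith
  qed
  let ?v = "\<lambda>x t. if x \<in> Z \<or> t < 0 then 0 else u x t"
  obtain B where "absorption_solution J (diffusivity J) p B Z ?v"
    by (rule absorption_solutionI[OF k p1 Z u0_L1 u])
  then interpret absorption_solution J "diffusivity J" p B Z ?v .
  have nZ: "AE x in lebesgue. x \<notin> Z" by (rule AE_not_in_negligible[OF Z])
  have meas: "(\<lambda>x. u x t) \<in> borel_measurable lebesgue" if "0 \<le> t" for t
    using u that unfolding nonlocal_solution_def by blast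
  \<comment> \<open>\<open>M\<close> is formed with \<open>u0\<close> and \<open>u\<close>, the mass
    balance with \<open>?v\<close>. For each time \<open>t \<ge> 0\<close> they differ on the null
    set \<open>Z\<close> alone, so the integrals agree and \<open>integral_absorbed\<close>
    applies.\<close>
  have M_eq: "M = limit_mass"
  proof -
    have "(LINT x|lebesgue. u0 x) = mass 0"
      unfolding mass_def
    proof (rule integral_cong_AE)
      show "AE x in lebesgue. u0 x = ?v x 0"
        using nZ u unfolding nonlocal_solution_def by (auto elim!: eventually_mono)
    qed (use u0_L1 u_initial_integrable in auto)
    moreover have "(LINT x|lebesgue. u x t powr p) = absorbed t" if "0 \<le> t" for t
      unfolding absorbed_def
    proof (rule integral_cong_AE)
      show "AE x in lebesgue. u x t powr p = ?v x t powr p"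
        using nZ that by (auto elim!: eventually_mono)
      show "(\<lambda>x. u x t powr p) \<in> borel_measurable lebesgue" using meas[OF that] by measurable
      show "(\<lambda>x. ?v x t powr p) \<in> borel_measurable lebesgue" using integrable_u_powr[OF that] by auto
    qed
    then have "(LINT t:{0..}|lebesgue. LINT x|lebesgue. u x t powr p) = (LINT t:{0..}|lebesgue. absorbed t)"
      unfolding set_lebesgue_integral_def by (intro Bochner_Integration.integral_cong) (auto simp: indicator_def)
    ultimately show ?thesis using M integral_absorbed by simp
  qed
  have p': "1 + 2 / real DIM(real ^ 'n) \<le> p" using p by simp
  have asym: "\<forall>\<^sub>F t in at_top. \<forall>x. x \<notin> Z \<longrightarrow>
      t powr (real CARD('n) / 2) * \<bar>u x t - limit_mass * gauss (2 * diffusivity J * t) x\<bar> < \<epsilon>" if "0 < \<epsilon>" for \<epsilon>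
    using u_asymptotics[OF p' that] eventually_gt_at_top[of 0] by eventually_elim auto
  show ?thesis
  proof (intro conjI impI allI)
    fix U :: "real ^ 'n \<Rightarrow> real \<Rightarrow> real" and R \<epsilon> :: real
    assume U: "heat_solution_delta (diffusivity J) M U" and \<epsilon>: "0 < \<epsilon>"
    show "\<forall>\<^sub>F t in at_top. \<forall>x. x \<notin> Z \<and> norm x \<le> R * sqrt t \<longrightarrow>
        t powr (real CARD('n) / 2) * \<bar>u x t - U x t\<bar> < \<epsilon>"
      using asym[OF \<epsilon>] eventually_gt_at_top[of 0]
      by eventually_elim (simp add: heat_solution_delta_eq[OF a_pos U] M_eq)
  next
    fix R \<epsilon> :: real
    assume "p = 1 + 2 / real CARD('n)" and \<epsilon>: "0 < \<epsilon>"
    then have lm: "limit_mass = 0" by (intro limit_mass_critical) simp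
    show "\<forall>\<^sub>F t in at_top. \<forall>x. x \<notin> Z \<and> norm x \<le> R * sqrt t \<longrightarrow>
        t powr (real CARD('n) / 2) * u x t < \<epsilon>"
      using asym[OF \<epsilon>] eventually_gt_at_top[of 0]
    proof eventually_elim
      case (elim t)
      show ?case
      proof (intro allI impI)
        fix x assume x: "x \<notin> Z \<and> norm x \<le> R * sqrt t"
        have "t powr (real CARD('n) / 2) * u x t \<le> t powr (real CARD('n) / 2) * \<bar>u x t\<bar>" by (intro mult_left_mono) auto
        also have "\<dots> < \<epsilon>" using elim(1) x lm by simp
        finally show "t powr (real CARD('n) / 2) * u x t < \<epsilon>" .
      qed
    qed
  qed
qed

end
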